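(* Let $\mathbb{C}$ and $\mathbb{D}$ be 2-multicategories, let $J : \mathbb{D} \to \mathbb{C}$ be a (strict) multicategorical 2-functor, and let $T=(T,i,(-)^t;\tilde t,\hat t,\theta)$ be a strong relative pseudomonad along $J$. Then $T$ is a pseudo-multifunctor $T : \mathbb{D}\to\mathbb{C}$: the function $X \mapsto TX$ on objects, together with the functors $$\mathbb{D}(X_1,\dots,X_n;Y)\to\mathbb{C}(TX_1,\dots,TX_n;TY),\qquad f\mapsto Tf:=(i_Y\circ Jf)^{t_1t_2\cdots t_n},$$ can be equipped with the structure of a pseudo-multifunctor.
   Context: **2-multicategories.** A 2-multicategory $\mathbb{C}$ is a multicategory enriched in $\mathrm{Cat}$: it has objects, a hom-category $\mathbb{C}(X_1,\dots,X_n;Y)$ for each $n\ge 0$ and objects $X_1,\dots,X_n,Y$ (its objects are multimorphisms $f:X_1,\dots,X_n\to Y$, its morphisms are 2-cells), identities $1_X\in\mathbb{C}(X;X)$, and composition functors $(f,g_1,\dots,g_n)\mapsto f\circ(g_1,\dots,g_n)$, strictly associative and unital. For $f:X_1,\dots,X_n\to Y$ and $g:W_1,\dots,W_m\to X_j$ write $f\circ_j g:=f\circ(1,\dots,1,g,1,\dots,1)$ ($g$ in position $j$). Restricting to unary multimorphisms gives a 2-category. A unary 2-functor between 2-multicategories is a 2-functor between these underlying 2-categories. **Strong relative pseudomonads.** Let $J:\mathbb{D}\to\mathbb{C}$ be a (unary) 2-functor between 2-multicategories. A strong relative pseudomonad $(T,i,(-)^t;\tilde t,\hat t,\theta)$ along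 $J$ consists of: - for every object $X$ of $\mathbb{D}$, an object $TX$ of $\mathbb{C}$ and a unit map $i_X:JX\to TX$; - for every $n$, index $1\le j\le n$, objects $B_k$ ($k\ne j$) of $\mathbb{C}$ and objects $X,Y$ of $\mathbb{D}$, a functor (the strength, or strengthening, in the $j$th argument) $$(-)^{t_j}:\mathbb{C}(B_1,\dots,B_{j-1},JX,B_{j+1},\dots,B_n;TY)\to\mathbb{C}(B_1,\dots,B_{j-1},TX,B_{j+1},\dots,B_n;TY),$$ pseudonatural in all arguments; in particular there are (unnamed) invertible 2-cells $(f\circ_k g)^t\cong f^t\circ_k g$ for $g:C_1,\dots,C_m\to B_k$, $k\neq j$; - three natural families of invertible 2-cells, for $f:B_1,\dots,JX,\dots,B_n\to TY$ and $g:C_1,\dots,JW,\dots,C_m\to TX$ ($JX$ in position $j$ and $JW$ in position $k$): $\tilde t_f:f\to f^{t_j}\circ_j i_X$, $\ \hat t_{f,g}:(f^{t_j}\circ_j g)^{t_{j+k-1}}\to f^{t_j}\circ_j g^{t_k}$, $\ \theta_X:(i_X)^{t_1}\to 1_{TX}$. When only one argument is being strengthened we write $f^t$ for $f^{t_j}$ and $f^t\circ_t g$ for composition in that strengthened argument; subscripts on $i$ and $\theta$ may be omitted. The data must satisfy: (1) for all $f:B_1,\dots,JX,\dots,B_n\to TY$, $g:C_1,\dots,JW,\dots,C_m\to TX$, $h:D_1,\dots,JV,\dots,D_l\to TW$, the 2-cells $((f^t\circ_t g)^t\circ_t h)^t\to f^t\circ_t g^t\circ_t h^t$ given by "$\hat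 t_{f^t\circ_t g,\,h}$, then $\hat t_{f,g}\circ_t h^t$" and "$(\hat t_{f,g}\circ_t h)^t$, then $\hat t_{f,\,g^t\circ_t h}$, then $f^t\circ_t\hat t_{g,h}$" are equal; (2) for all $f:B_1,\dots,JX,\dots,B_n\to TY$, the composite $f^t\xrightarrow{(\tilde t_f)^t}(f^t\circ_t i)^t\xrightarrow{\hat t_{f,i}}f^t\circ_t i^t\xrightarrow{f^t\circ_t\theta}f^t$ is the identity. Iterated strengthenings are written as a string read from left to right: $f^{t_1t_2\cdots t_n}=(\cdots((f^{t_1})^{t_2})\cdots)^{t_n}$. **Pseudo-multifunctors.** A pseudo-multifunctor $F:\mathbb{D}\to\mathbb{C}$ between 2-multicategories consists of a function $X\mapsto FX$ on objects; functors $\mathbb{D}(X_1,\dots,X_n;Y)\to\mathbb{C}(FX_1,\dots,FX_n;FY)$, $f\mapsto Ff$; for each $X$ an invertible 2-cell $\tilde F_X:F1_X\Rightarrow 1_{FX}$; and for each $f:X_1,\dots,X_n\to Y$, $1\le i\le n$, $g:W_1,\dots,W_m\to X_i$ an invertible 2-cell $\hat F_{f,g}:F(f\circ_i g)\Rightarrow Ff\circ_i Fg$; such that (1) $Ff=F(1_Y\circ f)\xrightarrow{\hat F_{1,f}}F1_Y\circ Ff\xrightarrow{\tilde F_Y\circ Ff}Ff$ is the identity; (2) $Ff=F(f\circ_i 1_{X_i})\xrightarrow{\hat F_{f,1}}Ff\circ_i F1_{X_i}\xrightarrow{Ff\circ_i\tilde F_{X_i}}Ff$ is the identity; (3) for $f:X_1,\dots,X_n\to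 Y$, $g:W_1,\dots,W_m\to X_i$ and $h:V_1,\dots,V_l\to W_j$, we have $(Ff\circ_i\hat F_{g,h})\cdot\hat F_{f,\,g\circ_j h}=(\hat F_{f,g}\circ_{i+j-1}Fh)\cdot\hat F_{f\circ_i g,\,h}$. If all $\tilde F,\hat F$ are identities, $F$ is a (strict) multicategorical 2-functor. *)

theory Defs
  imports Main
begin

section \<open>2-multicategories\<close>

text \<open>
  The hom-categories \<open>C(X\<^sub>1,\<dots>,X\<^sub>n;Y)\<close> are presented by their disjoint union: every
  multimorphism carries its list of domains and its codomain, every 2-cell its source and target,
  and 2-cells only exist between multimorphisms with the same domains and codomain.
  As usual for carrier-based structures, operations are unconstrained on arguments where they
  are not meaningful.
  In \<open>\<beta> \<cdot> \<alpha>\<close> the 2-cell \<open>\<alpha>\<close> comes first.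
\<close>

record ('o, 'm, 'c) two_multicat =
  Obj :: "'o set"
  Mor :: "'m set"
  Cell :: "'c set"
  Dom :: "'m \<Rightarrow> 'o list"
  Cod :: "'m \<Rightarrow> 'o"
  Src :: "'c \<Rightarrow> 'm"
  Tgt :: "'c \<Rightarrow> 'm"
  Id1 :: "'o \<Rightarrow> 'm" (\<open>\<one>\<index>\<close>)
  Id2 :: "'m \<Rightarrow> 'c" (\<open>\<iota>\<index>\<close>)
  Vcomp :: "'c \<Rightarrow> 'c \<Rightarrow> 'c" (infixl \<open>\<cdot>\<index>\<close> 60)
  Comp1 :: "'m \<Rightarrow> 'm list \<Rightarrow> 'm"
  Comp2 :: "'c \<Rightarrow> 'c list \<Rightarrow> 'c"

definition hom :: "('o, 'm, 'c, 'z) two_multicat_scheme \<Rightarrow> 'o list \<Rightarrow> 'o \<Rightarrow> 'm set" where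
  "hom C Xs Y = {f \<in> Mor C. Dom C f = Xs \<and> Cod C f = Y}"

definition cells :: "('o, 'm, 'c, 'z) two_multicat_scheme \<Rightarrow> 'm \<Rightarrow> 'm \<Rightarrow> 'c set" where
  "cells C f g = {\<alpha> \<in> Cell C. Src C \<alpha> = f \<and> Tgt C \<alpha> = g}"

definition inv_cells :: "('o, 'm, 'c, 'z) two_multicat_scheme \<Rightarrow> 'm \<Rightarrow> 'm \<Rightarrow> 'c set" where
  "inv_cells C f g = {\<alpha> \<in> cells C f g. \<exists>\<beta> \<in> cells C g f.
     Vcomp C \<beta> \<alpha> = Id2 C f \<and> Vcomp C \<alpha> \<beta> = Id2 C g}"

definition composable1 :: "('o, 'm, 'c, 'z) two_multicat_scheme \<Rightarrow> 'm \<Rightarrow> 'm list \<Rightarrow> bool" where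
  "composable1 C f gs \<longleftrightarrow> f \<in> Mor C \<and> set gs \<subseteq> Mor C \<and> map (Cod C) gs = Dom C f"

definition composable2 :: "('o, 'm, 'c, 'z) two_multicat_scheme \<Rightarrow> 'c \<Rightarrow> 'c list \<Rightarrow> bool" where
  "composable2 C \<alpha> \<beta>s \<longleftrightarrow>
     \<alpha> \<in> Cell C \<and> set \<beta>s \<subseteq> Cell C \<and> composable1 C (Src C \<alpha>) (map (Src C) \<beta>s)"

locale two_multicategory =
  fixes C :: "('o, 'm, 'c, 'z) two_multicat_scheme" (structure)
  assumes Dom_Obj: "f \<in> Mor C \<Longrightarrow> set (Dom C f) \<subseteq> Obj C"
    and Cod_Obj: "f \<in> Mor C \<Longrightarrow> Cod C f \<in> Obj C"
    and Src_Mor: "\<alpha> \<in> Cell C \<Longrightarrow> Src C \<alpha> \<in> Mor C"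
    and Tgt_hom: "\<alpha> \<in> Cell C \<Longrightarrow> Tgt C \<alpha> \<in> hom C (Dom C (Src C \<alpha>)) (Cod C (Src C \<alpha>))"
    and Id2_cells: "f \<in> Mor C \<Longrightarrow> \<iota> f \<in> cells C f f"
    and Vcomp_cells: "\<lbrakk>\<alpha> \<in> cells C f g; \<beta> \<in> cells C g h\<rbrakk> \<Longrightarrow> \<beta> \<cdot> \<alpha> \<in> cells C f h"
    and Vcomp_Id2_left: "\<alpha> \<in> cells C f g \<Longrightarrow> \<iota> g \<cdot> \<alpha> = \<alpha>"
    and Vcomp_Id2_right: "\<alpha> \<in> cells C f g \<Longrightarrow> \<alpha> \<cdot> \<iota> f = \<alpha>"
    and Vcomp_assoc:
      "\<lbrakk>\<alpha> \<in> cells C f g; \<beta> \<in> cells C g h; \<gamma> \<in> cells C h k\<rbrakk> \<Longrightarrow> (\<gamma> \<cdot> \<beta>) \<cdot> \<alpha> = \<gamma> \<cdot> (\<beta> \<cdot> \<alpha>)"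
    and Id1_hom: "X \<in> Obj C \<Longrightarrow> \<one> X \<in> hom C [X] X"
    and Comp1_hom:
      "composable1 C f gs \<Longrightarrow> Comp1 C f gs \<in> hom C (concat (map (Dom C) gs)) (Cod C f)"
    and Comp2_cells: "composable2 C \<alpha> \<beta>s \<Longrightarrow>
      Comp2 C \<alpha> \<beta>s \<in> cells C (Comp1 C (Src C \<alpha>) (map (Src C) \<beta>s))
                             (Comp1 C (Tgt C \<alpha>) (map (Tgt C) \<beta>s))"
    and Comp2_Id2: "composable1 C f gs \<Longrightarrow> Comp2 C (\<iota> f) (map \<iota> gs) = \<iota> (Comp1 C f gs)"
    and Comp2_Vcomp:
      "\<lbrakk>composable2 C \<alpha> \<beta>s; composable2 C \<alpha>' \<beta>s';
        Src C \<alpha>' = Tgt C \<alpha>; map (Src C) \<beta>s' = map (Tgt C) \<beta>s\<rbrakk> \<Longrightarrow>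
       Comp2 C (\<alpha>' \<cdot> \<alpha>) (map2 (Vcomp C) \<beta>s' \<beta>s) = Comp2 C \<alpha>' \<beta>s' \<cdot> Comp2 C \<alpha> \<beta>s"
    and Comp1_assoc: "\<lbrakk>composable1 C f gs; list_all2 (composable1 C) gs hss\<rbrakk> \<Longrightarrow>
      Comp1 C (Comp1 C f gs) (concat hss) = Comp1 C f (map2 (Comp1 C) gs hss)"
    and Comp2_assoc: "\<lbrakk>composable2 C \<alpha> \<beta>s; list_all2 (composable2 C) \<beta>s \<gamma>ss\<rbrakk> \<Longrightarrow>
      Comp2 C (Comp2 C \<alpha> \<beta>s) (concat \<gamma>ss) = Comp2 C \<alpha> (map2 (Comp2 C) \<beta>s \<gamma>ss)"
    and Comp1_Id1_left: "f \<in> Mor C \<Longrightarrow> Comp1 C (\<one> (Cod C f)) [f] = f"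
    and Comp1_Id1_right: "f \<in> Mor C \<Longrightarrow> Comp1 C f (map \<one> (Dom C f)) = f"
    and Comp2_Id1_left: "\<alpha> \<in> cells C f g \<Longrightarrow> Comp2 C (\<iota> (\<one> (Cod C f))) [\<alpha>] = \<alpha>"
    and Comp2_Id1_right: "\<alpha> \<in> cells C f g \<Longrightarrow> Comp2 C \<alpha> (map (\<lambda>X. \<iota> (\<one> X)) (Dom C f)) = \<alpha>"

text \<open>
  Composition in a single argument. Argument positions are counted from 0, so that
  \<open>(f \<circ>\<^sub>j g) \<circ>\<^sub>j\<^sub>+\<^sub>k h\<close> replaces the \<open>j+k-1\<close> of counting from 1.
\<close>

definition pcomp1 :: "('o, 'm, 'c, 'z) two_multicat_scheme \<Rightarrow> 'm \<Rightarrow> nat \<Rightarrow> 'm \<Rightarrow> 'm"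
    (\<open>(_ /\<odot>\<index>[_]/ _)\<close> [71, 0, 71] 70) where
  "pcomp1 C f j g = Comp1 C f ((map (Id1 C) (Dom C f))[j := g])"

definition pcomp2 :: "('o, 'm, 'c, 'z) two_multicat_scheme \<Rightarrow> 'c \<Rightarrow> nat \<Rightarrow> 'c \<Rightarrow> 'c"
    (\<open>(_ /\<star>\<index>[_]/ _)\<close> [71, 0, 71] 70) where
  "pcomp2 C \<alpha> j \<beta> = Comp2 C \<alpha> ((map (\<lambda>X. Id2 C (Id1 C X)) (Dom C (Src C \<alpha>)))[j := \<beta>])"

text \<open>
  Where argument \<open>j\<close> of \<open>f\<close> sits in \<open>f \<circ>\<^sub>k g\<close>, for \<open>k \<noteq> j\<close> and \<open>g\<close> of arity \<open>m\<close>.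
\<close>

definition shift :: "nat \<Rightarrow> nat \<Rightarrow> nat \<Rightarrow> nat" where
  "shift k m j = (if j < k then j else j + m - 1)"


section \<open>Unary 2-functors and pseudo-multifunctors\<close>

record ('x, 'n, 'd, 'o, 'm, 'c) functor_data =
  FO :: "'x \<Rightarrow> 'o"
  FM :: "'n \<Rightarrow> 'm"
  FC :: "'d \<Rightarrow> 'c"

locale unary_2functor = D: two_multicategory D + C: two_multicategory C
  for D :: "('x, 'n, 'd, 'y) two_multicat_scheme"
    and C :: "('o, 'm, 'c, 'z) two_multicat_scheme"
    and J :: "('x, 'n, 'd, 'o, 'm, 'c) functor_data" +
  assumes FO_Obj: "X \<in> Obj D \<Longrightarrow> FO J X \<in> Obj C"
    and FM_hom: "f \<in> hom D [X] Y \<Longrightarrow> FM J f \<in> hom C [FO J X] (FO J Y)"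
    and FC_cells:
      "\<lbrakk>f \<in> hom D [X] Y; \<alpha> \<in> cells D f f'\<rbrakk> \<Longrightarrow> FC J \<alpha> \<in> cells C (FM J f) (FM J f')"
    and FC_Id2: "f \<in> hom D [X] Y \<Longrightarrow> FC J (Id2 D f) = Id2 C (FM J f)"
    and FC_Vcomp: "\<lbrakk>f \<in> hom D [X] Y; \<alpha> \<in> cells D f f'; \<beta> \<in> cells D f' f''\<rbrakk> \<Longrightarrow>
      FC J (Vcomp D \<beta> \<alpha>) = Vcomp C (FC J \<beta>) (FC J \<alpha>)"
    and FM_Id1: "X \<in> Obj D \<Longrightarrow> FM J (Id1 D X) = Id1 C (FO J X)"
    and FM_Comp1: "\<lbrakk>f \<in> hom D [X] Y; g \<in> hom D [W] X\<rbrakk> \<Longrightarrow>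
      FM J (Comp1 D f [g]) = Comp1 C (FM J f) [FM J g]"
    and FC_Comp2:
      "\<lbrakk>f \<in> hom D [X] Y; g \<in> hom D [W] X; \<alpha> \<in> cells D f f'; \<beta> \<in> cells D g g'\<rbrakk> \<Longrightarrow>
      FC J (Comp2 D \<alpha> [\<beta>]) = Comp2 C (FC J \<alpha>) [FC J \<beta>]"

text \<open>
  \<open>Fu X\<close> and \<open>Fc f j g\<close> are the structure cells \<open>F 1\<^sub>X \<Rightarrow> 1\<^sub>F\<^sub>X\<close> and
  \<open>F (f \<circ>\<^sub>j g) \<Rightarrow> F f \<circ>\<^sub>j F g\<close>; the latter form a natural family.
\<close>

locale pseudo_multifunctor = D: two_multicategory D + C: two_multicategory C
  for D :: "('x, 'n, 'd, 'y) two_multicat_scheme" (structure)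
    and C :: "('o, 'm, 'c, 'z) two_multicat_scheme" (structure)
    and F :: "('x, 'n, 'd, 'o, 'm, 'c) functor_data"
    and Fu :: "'x \<Rightarrow> 'c"
    and Fc :: "'n \<Rightarrow> nat \<Rightarrow> 'n \<Rightarrow> 'c" +
  assumes FO_Obj: "X \<in> Obj D \<Longrightarrow> FO F X \<in> Obj C"
    and FM_hom: "f \<in> hom D Xs Y \<Longrightarrow> FM F f \<in> hom C (map (FO F) Xs) (FO F Y)"
    and FC_cells: "\<alpha> \<in> cells D f f' \<Longrightarrow> FC F \<alpha> \<in> cells C (FM F f) (FM F f')"
    and FC_Id2: "f \<in> Mor D \<Longrightarrow> FC F (\<iota>\<^bsub>D\<^esub> f) = \<iota>\<^bsub>C\<^esub> (FM F f)"
    and FC_Vcomp: "\<lbrakk>\<alpha> \<in> cells D f f'; \<beta> \<in> cells D f' f''\<rbrakk> \<Longrightarrow>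
      FC F (\<beta> \<cdot>\<^bsub>D\<^esub> \<alpha>) = FC F \<beta> \<cdot>\<^bsub>C\<^esub> FC F \<alpha>"
    and Fu_cells: "X \<in> Obj D \<Longrightarrow> Fu X \<in> inv_cells C (FM F (\<one>\<^bsub>D\<^esub> X)) (\<one>\<^bsub>C\<^esub> (FO F X))"
    and Fc_cells:
      "\<lbrakk>f \<in> Mor D; g \<in> Mor D; j < length (Dom D f); Cod D g = Dom D f ! j\<rbrakk> \<Longrightarrow>
       Fc f j g \<in> inv_cells C (FM F (f \<odot>\<^bsub>D\<^esub>[j] g)) (FM F f \<odot>\<^bsub>C\<^esub>[j] FM F g)"
    and Fc_natural:
      "\<lbrakk>\<alpha> \<in> cells D f f'; \<beta> \<in> cells D g g'; j < length (Dom D f); Cod D g = Dom D f ! j\<rbrakk> \<Longrightarrow>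
       (FC F \<alpha> \<star>\<^bsub>C\<^esub>[j] FC F \<beta>) \<cdot>\<^bsub>C\<^esub> Fc f j g = Fc f' j g' \<cdot>\<^bsub>C\<^esub> FC F (\<alpha> \<star>\<^bsub>D\<^esub>[j] \<beta>)"
    and unit_left: "f \<in> hom D Xs Y \<Longrightarrow>
       (Fu Y \<star>\<^bsub>C\<^esub>[0] \<iota>\<^bsub>C\<^esub> (FM F f)) \<cdot>\<^bsub>C\<^esub> Fc (\<one>\<^bsub>D\<^esub> Y) 0 f = \<iota>\<^bsub>C\<^esub> (FM F f)"
    and unit_right: "\<lbrakk>f \<in> hom D Xs Y; j < length Xs\<rbrakk> \<Longrightarrow>
       (\<iota>\<^bsub>C\<^esub> (FM F f) \<star>\<^bsub>C\<^esub>[j] Fu (Xs ! j)) \<cdot>\<^bsub>C\<^esub> Fc f j (\<one>\<^bsub>D\<^esub> (Xs ! j)) = \<iota>\<^bsub>C\<^esub> (FM F f)"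
    and assoc:
      "\<lbrakk>f \<in> Mor D; g \<in> Mor D; h \<in> Mor D;
        j < length (Dom D f); Cod D g = Dom D f ! j;
        k < length (Dom D g); Cod D h = Dom D g ! k\<rbrakk> \<Longrightarrow>
       (\<iota>\<^bsub>C\<^esub> (FM F f) \<star>\<^bsub>C\<^esub>[j] Fc g k h) \<cdot>\<^bsub>C\<^esub> Fc f j (g \<odot>\<^bsub>D\<^esub>[k] h) =
       (Fc f j g \<star>\<^bsub>C\<^esub>[j + k] \<iota>\<^bsub>C\<^esub> (FM F h)) \<cdot>\<^bsub>C\<^esub> Fc (f \<odot>\<^bsub>D\<^esub>[j] g) (j + k) h"

text \<open>
  Typing of the identity structure cells forces \<open>J 1\<^sub>X = 1\<^sub>J\<^sub>X\<close> and
  \<open>J (f \<circ>\<^sub>j g) = J f \<circ>\<^sub>j J g\<close>, and naturality the same for composition of 2-cells.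
\<close>

definition multi_2functor ::
  "('x, 'n, 'd, 'y) two_multicat_scheme \<Rightarrow> ('o, 'm, 'c, 'z) two_multicat_scheme \<Rightarrow>
   ('x, 'n, 'd, 'o, 'm, 'c) functor_data \<Rightarrow> bool" where
  "multi_2functor D C J \<longleftrightarrow>
     pseudo_multifunctor D C J (\<lambda>X. Id2 C (Id1 C (FO J X)))
       (\<lambda>f j g. Id2 C (pcomp1 C (FM J f) j (FM J g)))"


section \<open>Strong relative pseudomonads\<close>

text \<open>
  For \<open>f : B\<^sub>0,\<dots>,J X,\<dots>,B\<^sub>n\<^sub>-\<^sub>1 \<rightarrow> T Y\<close> with \<open>J X\<close> in position \<open>j\<close>, \<open>str1 T j X Y f\<close> is
  \<open>f\<^sup>t\<close> with respect to position \<open>j\<close>, and \<open>str2\<close> is its action on 2-cells. The objects \<open>X\<close> and \<open>Y\<close>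
  are parameters because \<open>J\<close> and \<open>T\<close> need not be injective on objects. Further,
  \<^item> \<open>str_nat T j X Y f k g : (f \<circ>\<^sub>k g)\<^sup>t \<Rightarrow> f\<^sup>t \<circ>\<^sub>k g\<close>, for \<open>k \<noteq> j\<close>, is the pseudonaturality
    constraint of the strength in position \<open>j\<close> at its argument \<open>k\<close>;
  \<^item> \<open>t_unit T j X Y f : f \<Rightarrow> f\<^sup>t \<circ>\<^sub>j i\<^sub>X\<close> is the family usually written with a tilde;
  \<^item> \<open>t_mult T j X Y f k W g : (f\<^sup>t \<circ>\<^sub>j g)\<^sup>t \<Rightarrow> f\<^sup>t \<circ>\<^sub>j g\<^sup>t\<close>, for \<open>g : C\<^sub>0,\<dots>,J W,\<dots>,C\<^sub>m\<^sub>-\<^sub>1 \<rightarrow> T X\<close> with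
    \<open>J W\<close> in position \<open>k\<close>, is the family usually written with a hat.
\<close>

record ('x, 'o, 'm, 'c) pseudomonad_data =
  TO :: "'x \<Rightarrow> 'o"
  unit :: "'x \<Rightarrow> 'm"
  str1 :: "nat \<Rightarrow> 'x \<Rightarrow> 'x \<Rightarrow> 'm \<Rightarrow> 'm"
  str2 :: "nat \<Rightarrow> 'x \<Rightarrow> 'x \<Rightarrow> 'c \<Rightarrow> 'c"
  str_nat :: "nat \<Rightarrow> 'x \<Rightarrow> 'x \<Rightarrow> 'm \<Rightarrow> nat \<Rightarrow> 'm \<Rightarrow> 'c"
  t_unit :: "nat \<Rightarrow> 'x \<Rightarrow> 'x \<Rightarrow> 'm \<Rightarrow> 'c"
  t_mult :: "nat \<Rightarrow> 'x \<Rightarrow> 'x \<Rightarrow> 'm \<Rightarrow> nat \<Rightarrow> 'x \<Rightarrow> 'm \<Rightarrow> 'c"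
  \<theta> :: "'x \<Rightarrow> 'c"

definition strengthenable ::
  "('x, 'n, 'd, 'y) two_multicat_scheme \<Rightarrow> ('o, 'm, 'c, 'z) two_multicat_scheme \<Rightarrow>
   ('x, 'n, 'd, 'o, 'm, 'c) functor_data \<Rightarrow> ('x, 'o, 'm, 'c) pseudomonad_data \<Rightarrow>
   nat \<Rightarrow> 'x \<Rightarrow> 'x \<Rightarrow> 'm set" where
  "strengthenable D C J T j X Y =
     {f \<in> Mor C. X \<in> Obj D \<and> Y \<in> Obj D \<and>
        j < length (Dom C f) \<and> Dom C f ! j = FO J X \<and> Cod C f = TO T Y}"

text \<open>
  The strength is pseudonatural jointly in the arguments other than the strengthened one:
  its constraints are natural in 2-cells, compatible with identities and composition in one
  argument, and independent of the order in which two different arguments are treated.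
  The families \<open>t_unit\<close> and \<open>t_mult\<close> are natural in 2-cells and compatible with these constraints.
  Pseudonaturality in the objects \<open>X\<close> and \<open>Y\<close> is not separate structure: the action
  \<open>x \<mapsto> (i \<circ> J x)\<^sup>t\<close> of \<open>T\<close> on morphisms is itself induced, and the constraints are composites
  of \<open>t_unit\<close> and \<open>t_mult\<close>.
\<close>

locale strong_relative_pseudomonad = J: unary_2functor D C J
  for D :: "('x, 'n, 'd, 'y) two_multicat_scheme"
    and C :: "('o, 'm, 'c, 'z) two_multicat_scheme" (structure)
    and J :: "('x, 'n, 'd, 'o, 'm, 'c) functor_data"
    and T :: "('x, 'o, 'm, 'c) pseudomonad_data" +
  assumes TO_Obj: "X \<in> Obj D \<Longrightarrow> TO T X \<in> Obj C"
    and unit_hom: "X \<in> Obj D \<Longrightarrow> unit T X \<in> hom C [FO J X] (TO T X)"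

    and str1_hom: "f \<in> strengthenable D C J T j X Y \<Longrightarrow>
      str1 T j X Y f \<in> hom C ((Dom C f)[j := TO T X]) (TO T Y)"
    and str2_cells: "\<lbrakk>f \<in> strengthenable D C J T j X Y; \<alpha> \<in> cells C f f'\<rbrakk> \<Longrightarrow>
      str2 T j X Y \<alpha> \<in> cells C (str1 T j X Y f) (str1 T j X Y f')"
    and str2_Id2: "f \<in> strengthenable D C J T j X Y \<Longrightarrow>
      str2 T j X Y (\<iota> f) = \<iota> (str1 T j X Y f)"
    and str2_Vcomp:
      "\<lbrakk>f \<in> strengthenable D C J T j X Y; \<alpha> \<in> cells C f f'; \<beta> \<in> cells C f' f''\<rbrakk> \<Longrightarrow>
      str2 T j X Y (\<beta> \<cdot> \<alpha>) = str2 T j X Y \<beta> \<cdot> str2 T j X Y \<alpha>"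

    and str_nat_cells:
      "\<lbrakk>f \<in> strengthenable D C J T j X Y; k < length (Dom C f); k \<noteq> j;
        g \<in> Mor C; Cod C g = Dom C f ! k\<rbrakk> \<Longrightarrow>
      str_nat T j X Y f k g \<in> inv_cells C
        (str1 T (shift k (length (Dom C g)) j) X Y (f \<odot>[k] g))
        (str1 T j X Y f \<odot>[k] g)"
    and str_nat_natural:
      "\<lbrakk>f \<in> strengthenable D C J T j X Y; k < length (Dom C f); k \<noteq> j;
        g \<in> Mor C; Cod C g = Dom C f ! k; \<alpha> \<in> cells C f f'; \<beta> \<in> cells C g g'\<rbrakk> \<Longrightarrow>
      (str2 T j X Y \<alpha> \<star>[k] \<beta>) \<cdot> str_nat T j X Y f k g =
      str_nat T j X Y f' k g' \<cdot> str2 T (shift k (length (Dom C g)) j) X Y (\<alpha> \<star>[k] \<beta>)"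
    and str_nat_Id1:
      "\<lbrakk>f \<in> strengthenable D C J T j X Y; k < length (Dom C f); k \<noteq> j\<rbrakk> \<Longrightarrow>
      str_nat T j X Y f k (\<one> (Dom C f ! k)) = \<iota> (str1 T j X Y f)"
    and str_nat_comp:
      "\<lbrakk>f \<in> strengthenable D C J T j X Y; k < length (Dom C f); k \<noteq> j;
        g \<in> Mor C; Cod C g = Dom C f ! k;
        l < length (Dom C g); h \<in> Mor C; Cod C h = Dom C g ! l\<rbrakk> \<Longrightarrow>
      str_nat T j X Y f k (g \<odot>[l] h) =
      (str_nat T j X Y f k g \<star>[k + l] \<iota> h)
        \<cdot> str_nat T (shift k (length (Dom C g)) j) X Y (f \<odot>[k] g) (k + l) h"
    and str_nat_exchange:
      "\<lbrakk>f \<in> strengthenable D C J T j X Y; k < k'; k' < length (Dom C f); k \<noteq> j; k' \<noteq> j;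
        g \<in> Mor C; Cod C g = Dom C f ! k; h \<in> Mor C; Cod C h = Dom C f ! k'\<rbrakk> \<Longrightarrow>
      (str_nat T j X Y f k g \<star>[k' + length (Dom C g) - 1] \<iota> h)
        \<cdot> str_nat T (shift k (length (Dom C g)) j) X Y (f \<odot>[k] g) (k' + length (Dom C g) - 1) h =
      (str_nat T j X Y f k' h \<star>[k] \<iota> g)
        \<cdot> str_nat T (shift k' (length (Dom C h)) j) X Y (f \<odot>[k'] h) k g"

    and t_unit_cells: "f \<in> strengthenable D C J T j X Y \<Longrightarrow>
      t_unit T j X Y f \<in> inv_cells C f (str1 T j X Y f \<odot>[j] unit T X)"
    and t_unit_natural: "\<lbrakk>f \<in> strengthenable D C J T j X Y; \<alpha> \<in> cells C f f'\<rbrakk> \<Longrightarrow>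
      (str2 T j X Y \<alpha> \<star>[j] \<iota> (unit T X)) \<cdot> t_unit T j X Y f = t_unit T j X Y f' \<cdot> \<alpha>"
    and t_unit_str_nat:
      "\<lbrakk>f \<in> strengthenable D C J T j X Y; k < length (Dom C f); k \<noteq> j;
        g \<in> Mor C; Cod C g = Dom C f ! k\<rbrakk> \<Longrightarrow>
      (str_nat T j X Y f k g \<star>[shift k (length (Dom C g)) j] \<iota> (unit T X))
        \<cdot> t_unit T (shift k (length (Dom C g)) j) X Y (f \<odot>[k] g) =
      t_unit T j X Y f \<star>[k] \<iota> g"

    and t_mult_cells:
      "\<lbrakk>f \<in> strengthenable D C J T j X Y; g \<in> strengthenable D C J T k W X\<rbrakk> \<Longrightarrow>
      t_mult T j X Y f k W g \<in> inv_cells C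
        (str1 T (j + k) W Y (str1 T j X Y f \<odot>[j] g))
        (str1 T j X Y f \<odot>[j] str1 T k W X g)"
    and t_mult_natural:
      "\<lbrakk>f \<in> strengthenable D C J T j X Y; g \<in> strengthenable D C J T k W X;
        \<alpha> \<in> cells C f f'; \<beta> \<in> cells C g g'\<rbrakk> \<Longrightarrow>
      (str2 T j X Y \<alpha> \<star>[j] str2 T k W X \<beta>) \<cdot> t_mult T j X Y f k W g =
      t_mult T j X Y f' k W g' \<cdot> str2 T (j + k) W Y (str2 T j X Y \<alpha> \<star>[j] \<beta>)"
    and t_mult_str_nat_outer:
      "\<lbrakk>f \<in> strengthenable D C J T j X Y; g \<in> strengthenable D C J T k W X;
        l < length (Dom C f); l \<noteq> j; h \<in> Mor C; Cod C h = Dom C f ! l;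
        j' = shift l (length (Dom C h)) j; l' = shift j (length (Dom C g)) l\<rbrakk> \<Longrightarrow>
      (str_nat T j X Y f l h \<star>[j'] \<iota> (str1 T k W X g))
        \<cdot> t_mult T j' X Y (f \<odot>[l] h) k W g =
      (t_mult T j X Y f k W g \<star>[l'] \<iota> h)
        \<cdot> (str_nat T (j + k) W Y (str1 T j X Y f \<odot>[j] g) l' h
        \<cdot> str2 T (j' + k) W Y (str_nat T j X Y f l h \<star>[j'] \<iota> g))"
    and t_mult_str_nat_inner:
      "\<lbrakk>f \<in> strengthenable D C J T j X Y; g \<in> strengthenable D C J T k W X;
        l < length (Dom C g); l \<noteq> k; h \<in> Mor C; Cod C h = Dom C g ! l;
        k' = shift l (length (Dom C h)) k\<rbrakk> \<Longrightarrow>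
      (\<iota> (str1 T j X Y f) \<star>[j] str_nat T k W X g l h)
        \<cdot> t_mult T j X Y f k' W (g \<odot>[l] h) =
      (t_mult T j X Y f k W g \<star>[j + l] \<iota> h)
        \<cdot> str_nat T (j + k) W Y (str1 T j X Y f \<odot>[j] g) (j + l) h"

    and \<theta>_cells: "X \<in> Obj D \<Longrightarrow>
      \<theta> T X \<in> inv_cells C (str1 T 0 X X (unit T X)) (\<one> (TO T X))"

    and mult_assoc:
      "\<lbrakk>f \<in> strengthenable D C J T j X Y; g \<in> strengthenable D C J T k W X;
        h \<in> strengthenable D C J T l V W\<rbrakk> \<Longrightarrow>
      (t_mult T j X Y f k W g \<star>[j + k] \<iota> (str1 T l V W h))
        \<cdot> t_mult T (j + k) W Y (str1 T j X Y f \<odot>[j] g) l V h =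
      (\<iota> (str1 T j X Y f) \<star>[j] t_mult T k W X g l V h)
        \<cdot> (t_mult T j X Y f (k + l) V (str1 T k W X g \<odot>[k] h)
        \<cdot> str2 T (j + k + l) V Y (t_mult T j X Y f k W g \<star>[j + k] \<iota> h))"
    and mult_unit: "f \<in> strengthenable D C J T j X Y \<Longrightarrow>
      (\<iota> (str1 T j X Y f) \<star>[j] \<theta> T X)
        \<cdot> (t_mult T j X Y f 0 X (unit T X)
        \<cdot> str2 T j X Y (t_unit T j X Y f)) =
      \<iota> (str1 T j X Y f)"

text \<open>
  \<open>T f = (i\<^sub>Y \<circ> J f)\<^sup>t\<^sup>\<dots>\<^sup>t\<close>, strengthened in the first argument first.
\<close>

definition induced_functor ::
  "('x, 'n, 'd, 'y) two_multicat_scheme \<Rightarrow> ('o, 'm, 'c, 'z) two_multicat_scheme \<Rightarrow>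
   ('x, 'n, 'd, 'o, 'm, 'c) functor_data \<Rightarrow> ('x, 'o, 'm, 'c) pseudomonad_data \<Rightarrow>
   ('x, 'n, 'd, 'o, 'm, 'c) functor_data" where
  "induced_functor D C J T =
     \<lparr>FO = TO T,
      FM = (\<lambda>f. fold (\<lambda>j. str1 T j (Dom D f ! j) (Cod D f)) [0..<length (Dom D f)]
                  (Comp1 C (unit T (Cod D f)) [FM J f])),
      FC = (\<lambda>\<alpha>. let f = Src D \<alpha> in
                fold (\<lambda>j. str2 T j (Dom D f ! j) (Cod D f)) [0..<length (Dom D f)]
                  (Comp2 C (Id2 C (unit T (Cod D f))) [FC J \<alpha>]))\<rparr>"

end

theory Submission
  imports Defs
begin

text \<open>
  The cell \<open>T (f \<circ>\<^sub>j g) \<Rightarrow> T f \<circ>\<^sub>j T g\<close> is built one argument at a time. The arguments of \<open>f\<close> before \<open>j\<close> are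
  strengthened past \<open>g\<close> by pseudonaturality, with result \<open>A \<circ>\<^sub>j J g\<close>; then \<open>A\<close> is replaced by \<open>A\<^sup>t \<circ>\<^sub>j i\<close> using
  \<open>t_unit\<close>; the arguments of \<open>g\<close> are strengthened inside \<open>A\<^sup>t \<circ>\<^sub>j (i \<circ> J g)\<close> by iterating \<open>t_mult\<close>; the remaining
  arguments of \<open>f\<close> are again strengthened past \<open>T g\<close>. The left unit law and the associativity law need the
  three further compatibilities of \<open>t_unit\<close>, \<open>t_mult\<close> and \<open>\<theta>\<close> that are redundant in the definition of a
  relative pseudomonad. Associativity is then a pasting of naturality squares around one essential
  square, which says that iterated \<open>t_mult\<close> commutes with the composition cell itself; only
  \<open>mult_assoc\<close>, \<open>t_mult_str_nat_inner\<close> and the derived unit law enter there.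
\<close>


text \<open>Strengthenings in two different arguments are not assumed to commute, so the cell has to
  respect the left-to-right order of \<open>T (f \<circ>\<^sub>j g)\<close>: the arguments of
  \<open>f\<close> before \<open>j\<close>, then those of \<open>g\<close>, then the rest. The
  detour through \<open>t_unit\<close> is forced: \<open>t_mult\<close> moves a strengthening into
  an argument that is itself already strengthened, and it needs an arrow into \<open>T X\<close>
  there, whereas \<open>J g\<close> ends in \<open>J X\<close>; inserting \<open>i\<close> supplies
  both at once. The unit cell is \<open>\<theta>\<close> itself, because \<open>J\<close> and the
  units are strict and hence \<open>T 1\<^sub>X\<close> is literally \<open>i\<^sup>t\<close>. What
  shapes the proof is the control of positions. A composition moves all later arguments, the
  position of an empty run of arguments is ambiguous, and objects of \<open>D\<close> cannot be
  recovered from objects of \<open>C\<close>. Hence every iterated operation carries a start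
  position and a list of objects of \<open>D\<close>, and coherence is stated in the form of typed
  commuting squares, which can be strengthened along further arguments and pasted.\<close>

lemma concat_update_singletons:
  "j < length xs \<Longrightarrow> concat ((map (\<lambda>x. [x]) xs)[j := ys]) = take j xs @ ys @ drop (Suc j) xs"
  by (simp add: upd_conv_take_nth_drop concat_append take_map drop_map)

text \<open>Both sides locate argument \<open>p\<close> after two substitutions at \<open>k\<close>:
  an arrow of arity \<open>m\<close>, then one of arity \<open>m'\<close> into its argument
  \<open>l\<close>. Their composite has arity \<open>m + m' - 1\<close>, and \<open>l < m\<close>
  makes \<open>m\<close> nonzero, so the truncated subtraction is harmless.\<close>

lemma shift_shift [simp]:
  "\<lbrakk>l < m; p \<noteq> k\<rbrakk> \<Longrightarrow> shift (k + l) m' (shift k m p) = shift k (m + m' - Suc 0) p"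
  by (auto simp: shift_def)

lemma shift_neq [simp]: "\<lbrakk>l < m; p \<noteq> k\<rbrakk> \<Longrightarrow> k + l \<noteq> shift k m p"
  "\<lbrakk>l < m; p \<noteq> k\<rbrakk> \<Longrightarrow> shift k m p \<noteq> k + l"
  by (auto simp: shift_def)

text \<open>
  Unfolds along a list of arguments in the same way as \<open>block\<close> below, so that side conditions on
  positions never become disjunctive. It is vacuous for \<open>n = 0\<close>, even if \<open>k = p\<close>.
\<close>

definition outside :: "nat \<Rightarrow> nat \<Rightarrow> nat \<Rightarrow> bool" where
  "outside p n k \<longleftrightarrow> k < p \<or> p + n \<le> k"

lemma outside_simps [simp]:
  "outside p 0 k"
  "outside p (Suc n) k \<longleftrightarrow> k \<noteq> p \<and> outside (Suc p) n k"
  "outside p (m + n) k \<longleftrightarrow> outside p m k \<and> outside (p + m) n k"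
  "k < p \<Longrightarrow> outside p n k"
  "p + n \<le> k \<Longrightarrow> outside p n k"
  by (auto simp: outside_def)

lemma outside_shift [simp]: "\<lbrakk>outside p n k; l < m\<rbrakk> \<Longrightarrow> outside (shift k m p) n (k + l)"
  by (auto simp: outside_def shift_def)

lemma outside_Suc_shift [simp]:
  "\<lbrakk>k \<noteq> p; outside (Suc p) n k; l < m\<rbrakk> \<Longrightarrow> outside (Suc (shift k m p)) n (k + l)"
  by (auto simp: outside_def shift_def)

lemma add_less_pred [simp]: "\<lbrakk>j < n; k < m\<rbrakk> \<Longrightarrow> j + k < n + m - Suc 0" for j k m n :: nat
  by simp

lemma shift_less [simp]: "\<lbrakk>j < n; k < n; j \<noteq> k\<rbrakk> \<Longrightarrow> shift k m j < n + m - Suc 0"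
  by (auto simp: shift_def)

lemma shift_add [simp]: "k \<noteq> l \<Longrightarrow> shift (j + l) m (j + k) = j + shift l m k"
  by (auto simp: shift_def)

lemma add_less_pred_pred [simp]:
  "\<lbrakk>j < n; k < m; l < p\<rbrakk> \<Longrightarrow> j + k + l < n + m + p - Suc (Suc 0)" for j k l m n p :: nat
  by simp

lemma outside_add [simp]:
  "outside (j + k) n (j + l) \<longleftrightarrow> outside k n l"
  "outside (Suc (j + k)) n (j + l) \<longleftrightarrow> outside (Suc k) n l"
  by (auto simp: outside_def)

lemma shift_Suc_self [simp]: "shift j m (Suc j) = j + m"
  by (simp add: shift_def)

lemma shift_Suc_add [simp]: "shift k m (Suc (k + n)) = k + m + n"
  by (simp add: shift_def)

lemma split_nth: "j < length Xs \<Longrightarrow> \<exists>Us Vs. Xs = Us @ Xs ! j # Vs \<and> length Us = j"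
  using id_take_nth_drop[of j Xs] by (intro exI[of _ "take j Xs"] exI[of _ "drop (Suc j) Xs"]) auto

section \<open>Composition in one argument\<close>

context two_multicategory
begin

lemma cell_simps [simp]:
  assumes "\<alpha> \<in> Cell C"
  shows "Src C \<alpha> \<in> Mor C" "Tgt C \<alpha> \<in> Mor C"
    "Dom C (Tgt C \<alpha>) = Dom C (Src C \<alpha>)" "Cod C (Tgt C \<alpha>) = Cod C (Src C \<alpha>)"
  using Src_Mor[OF assms] Tgt_hom[OF assms] by (auto simp: hom_def)

lemma Id2_simps [simp]:
  assumes "f \<in> Mor C"
  shows "\<iota> f \<in> Cell C" "Src C (\<iota> f) = f" "Tgt C (\<iota> f) = f"
  using Id2_cells[OF assms] by (auto simp: cells_def)

lemma Vcomp_simps [simp]: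
  assumes "\<alpha> \<in> Cell C" "\<beta> \<in> Cell C" "Src C \<beta> = Tgt C \<alpha>"
  shows "\<beta> \<cdot> \<alpha> \<in> Cell C" "Src C (\<beta> \<cdot> \<alpha>) = Src C \<alpha>" "Tgt C (\<beta> \<cdot> \<alpha>) = Tgt C \<beta>"
  using Vcomp_cells[of \<alpha> "Src C \<alpha>" "Tgt C \<alpha>" \<beta> "Tgt C \<beta>"] assms by (auto simp: cells_def)

lemma Vcomp_assoc':
  "\<lbrakk>\<alpha> \<in> Cell C; \<beta> \<in> Cell C; \<gamma> \<in> Cell C; Src C \<beta> = Tgt C \<alpha>; Src C \<gamma> = Tgt C \<beta>\<rbrakk> \<Longrightarrow>
   (\<gamma> \<cdot> \<beta>) \<cdot> \<alpha> = \<gamma> \<cdot> (\<beta> \<cdot> \<alpha>)"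
  by (rule Vcomp_assoc) (auto simp: cells_def)

lemma Vcomp_Id2_left' [simp]: "\<lbrakk>\<alpha> \<in> Cell C; Tgt C \<alpha> = f\<rbrakk> \<Longrightarrow> \<iota> f \<cdot> \<alpha> = \<alpha>"
  by (rule Vcomp_Id2_left[of _ "Src C \<alpha>"]) (auto simp: cells_def)

lemma Vcomp_Id2_right' [simp]: "\<lbrakk>\<alpha> \<in> Cell C; Src C \<alpha> = f\<rbrakk> \<Longrightarrow> \<alpha> \<cdot> \<iota> f = \<alpha>"
  by (rule Vcomp_Id2_right[of _ _ "Tgt C \<alpha>"]) (auto simp: cells_def)

lemma Id1_simps [simp]:
  assumes "X \<in> Obj C"
  shows "\<one> X \<in> Mor C" "Dom C (\<one> X) = [X]" "Cod C (\<one> X) = X"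
  using Id1_hom[OF assms] by (auto simp: hom_def)

lemma Dom_nth_Obj [simp]: "\<lbrakk>f \<in> Mor C; j < length (Dom C f)\<rbrakk> \<Longrightarrow> Dom C f ! j \<in> Obj C"
  using Dom_Obj by force

lemma Cod_Obj' [simp]: "f \<in> Mor C \<Longrightarrow> Cod C f \<in> Obj C"
  by (rule Cod_Obj)

lemma map_Cod_Id1: "set Xs \<subseteq> Obj C \<Longrightarrow> map (Cod C) (map \<one> Xs) = Xs"
  by (induction Xs) auto

lemma map_Dom_Id1: "set Xs \<subseteq> Obj C \<Longrightarrow> map (Dom C) (map \<one> Xs) = map (\<lambda>X. [X]) Xs"
  by (induction Xs) auto

lemma composable1_pcomp:
  assumes "f \<in> Mor C" "g \<in> Mor C" "j < length (Dom C f)" "Cod C g = Dom C f ! j"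
  shows "composable1 C f ((map \<one> (Dom C f))[j := g])"
proof -
  have "set ((map \<one> (Dom C f))[j := g]) \<subseteq> Mor C"
    using Dom_Obj[OF assms(1)] assms(2) by (intro order_trans[OF set_update_subset_insert]) auto
  then show ?thesis
    using assms map_Cod_Id1[OF Dom_Obj[OF assms(1)]]
    by (simp add: composable1_def map_update del: map_map)
qed

lemma pcomp1_simps [simp]:
  assumes "f \<in> Mor C" "g \<in> Mor C" "j < length (Dom C f)" "Cod C g = Dom C f ! j"
  shows "f \<odot>[j] g \<in> Mor C" "Cod C (f \<odot>[j] g) = Cod C f"
    and Dom_pcomp1: "Dom C (f \<odot>[j] g) = take j (Dom C f) @ Dom C g @ drop (Suc j) (Dom C f)"
  using Comp1_hom[OF composable1_pcomp[OF assms]] assms map_Dom_Id1[OF Dom_Obj[OF assms(1)]]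
  by (auto simp: hom_def pcomp1_def map_update concat_update_singletons simp del: map_map)

declare Dom_pcomp1 [simp del]

lemma length_Dom_pcomp1 [simp]:
  assumes "f \<in> Mor C" "g \<in> Mor C" "j < length (Dom C f)" "Cod C g = Dom C f ! j"
  shows "length (Dom C (f \<odot>[j] g)) = length (Dom C f) + length (Dom C g) - 1"
  using assms by (simp add: Dom_pcomp1)

lemma nth_Dom_pcomp1:
  assumes "f \<in> Mor C" "g \<in> Mor C" "j < length (Dom C f)" "Cod C g = Dom C f ! j"
  shows "i < j \<Longrightarrow> Dom C (f \<odot>[j] g) ! i = Dom C f ! i"
    and "k < length (Dom C g) \<Longrightarrow> Dom C (f \<odot>[j] g) ! (j + k) = Dom C g ! k"
    and "\<lbrakk>i \<noteq> j; m = length (Dom C g)\<rbrakk> \<Longrightarrow> Dom C (f \<odot>[j] g) ! shift j m i = Dom C f ! i"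
  using assms by (auto simp: Dom_pcomp1 nth_append shift_def)

lemma composable2_pcomp:
  assumes "\<alpha> \<in> Cell C" "\<beta> \<in> Cell C" "j < length (Dom C (Src C \<alpha>))"
    "Cod C (Src C \<beta>) = Dom C (Src C \<alpha>) ! j"
  shows "composable2 C \<alpha> ((map (\<lambda>X. \<iota> (\<one> X)) (Dom C (Src C \<alpha>)))[j := \<beta>])"
    "map (Src C) ((map (\<lambda>X. \<iota> (\<one> X)) (Dom C (Src C \<alpha>)))[j := \<beta>])
      = (map \<one> (Dom C (Src C \<alpha>)))[j := Src C \<beta>]"
    "map (Tgt C) ((map (\<lambda>X. \<iota> (\<one> X)) (Dom C (Src C \<alpha>)))[j := \<beta>])
      = (map \<one> (Dom C (Src C \<alpha>)))[j := Tgt C \<beta>]"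
proof -
  have O: "set (Dom C (Src C \<alpha>)) \<subseteq> Obj C" using assms Dom_Obj by simp
  then have e: "map (Src C) (map (\<lambda>X. \<iota> (\<one> X)) (Dom C (Src C \<alpha>))) = map \<one> (Dom C (Src C \<alpha>))"
      "map (Tgt C) (map (\<lambda>X. \<iota> (\<one> X)) (Dom C (Src C \<alpha>))) = map \<one> (Dom C (Src C \<alpha>))"
    by auto
  show s: "map (Src C) ((map (\<lambda>X. \<iota> (\<one> X)) (Dom C (Src C \<alpha>)))[j := \<beta>])
      = (map \<one> (Dom C (Src C \<alpha>)))[j := Src C \<beta>]"
    and "map (Tgt C) ((map (\<lambda>X. \<iota> (\<one> X)) (Dom C (Src C \<alpha>)))[j := \<beta>])
      = (map \<one> (Dom C (Src C \<alpha>)))[j := Tgt C \<beta>]"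
    using e by (simp_all add: map_update del: map_map)
  have "set ((map (\<lambda>X. \<iota> (\<one> X)) (Dom C (Src C \<alpha>)))[j := \<beta>]) \<subseteq> Cell C"
    using O assms(2) by (intro order_trans[OF set_update_subset_insert]) auto
  then show "composable2 C \<alpha> ((map (\<lambda>X. \<iota> (\<one> X)) (Dom C (Src C \<alpha>)))[j := \<beta>])"
    using assms s composable1_pcomp[of "Src C \<alpha>" "Src C \<beta>" j] by (simp add: composable2_def)
qed

lemma pcomp2_simps [simp]:
  assumes "\<alpha> \<in> Cell C" "\<beta> \<in> Cell C" "j < length (Dom C (Src C \<alpha>))"
    "Cod C (Src C \<beta>) = Dom C (Src C \<alpha>) ! j"
  shows "\<alpha> \<star>[j] \<beta> \<in> Cell C" "Src C (\<alpha> \<star>[j] \<beta>) = Src C \<alpha> \<odot>[j] Src C \<beta>"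
    "Tgt C (\<alpha> \<star>[j] \<beta>) = Tgt C \<alpha> \<odot>[j] Tgt C \<beta>"
  using Comp2_cells[OF composable2_pcomp(1)[OF assms]] assms
  by (auto simp: cells_def pcomp2_def pcomp1_def composable2_pcomp(2,3))

lemma pcomp2_Id2 [simp]:
  assumes "f \<in> Mor C" "g \<in> Mor C" "j < length (Dom C f)" "Cod C g = Dom C f ! j"
  shows "\<iota> f \<star>[j] \<iota> g = \<iota> (f \<odot>[j] g)"
  using Comp2_Id2[OF composable1_pcomp[OF assms]] assms
  by (simp add: pcomp2_def pcomp1_def map_update o_def)

lemma interchange:
  assumes "\<alpha> \<in> Cell C" "\<beta> \<in> Cell C" "\<alpha>' \<in> Cell C" "\<beta>' \<in> Cell C"
    "Src C \<alpha>' = Tgt C \<alpha>" "Src C \<beta>' = Tgt C \<beta>"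
    "j < length (Dom C (Src C \<alpha>))" "Cod C (Src C \<beta>) = Dom C (Src C \<alpha>) ! j"
  shows "(\<alpha>' \<star>[j] \<beta>') \<cdot> (\<alpha> \<star>[j] \<beta>) = (\<alpha>' \<cdot> \<alpha>) \<star>[j] (\<beta>' \<cdot> \<beta>)"
proof -
  let ?I = "map (\<lambda>X. \<iota> (\<one> X)) (Dom C (Src C \<alpha>))"
  have O: "set (Dom C (Src C \<alpha>)) \<subseteq> Obj C" using assms Dom_Obj by simp
  have "map2 (Vcomp C) ?I ?I = ?I"
    using O by (auto simp: map2_map_map)
  then have "map2 (Vcomp C) (?I[j := \<beta>']) (?I[j := \<beta>]) = ?I[j := \<beta>' \<cdot> \<beta>]"
    by (simp add: zip_update map_update del: zip_map1 zip_map2 map_map)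
  then show ?thesis
    using Comp2_Vcomp[of \<alpha> "?I[j := \<beta>]" \<alpha>' "?I[j := \<beta>']"] assms
      composable2_pcomp[of \<alpha> \<beta> j] composable2_pcomp[of \<alpha>' \<beta>' j]
    by (simp add: pcomp2_def)
qed

lemma pcomp1_assoc:
  assumes "f \<in> Mor C" "g \<in> Mor C" "h \<in> Mor C" "j < length (Dom C f)" "Cod C g = Dom C f ! j"
    "k < length (Dom C g)" "Cod C h = Dom C g ! k"
  shows "(f \<odot>[j] g) \<odot>[j + k] h = f \<odot>[j] (g \<odot>[k] h)"
proof -
  obtain Us Vs where f: "Dom C f = Us @ Cod C g # Vs" "length Us = j"
    using split_nth[OF assms(4)] assms(5) by metis
  obtain Us' Vs' where g: "Dom C g = Us' @ Cod C h # Vs'" "length Us' = k"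
    using split_nth[OF assms(6)] assms(7) by metis
  have O: "set Us \<subseteq> Obj C" "set Vs \<subseteq> Obj C" "set Us' \<subseteq> Obj C" "set Vs' \<subseteq> Obj C"
    using f g Dom_Obj[OF assms(1)] Dom_Obj[OF assms(2)] by auto
  let ?gs = "map \<one> Us @ g # map \<one> Vs"
  let ?hs = "map \<one> Us' @ h # map \<one> Vs'"
  \<comment> \<open>Each argument of \<open>f\<close> other than \<open>j\<close> receives a
    one-element list with an identity. Then \<open>concat ?hss\<close> is the padded list that
    defines \<open>(f \<odot>[j] g) \<odot>[j + k] h\<close>, while on the other side each extra
    entry \<open>Comp1 C (\<one> X) [\<one> X]\<close> collapses to \<open>\<one> X\<close>.\<close>
  let ?hss = "map (\<lambda>X. [\<one> X]) Us @ ?hs # map (\<lambda>X. [\<one> X]) Vs"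
  have gs: "(map \<one> (Dom C f))[j := g] = ?gs"
    using f by (auto simp: list_update_append)
  have hs: "(map \<one> (Dom C g))[k := h] = ?hs"
    using g by (auto simp: list_update_append)
  have conc: "concat (map (\<lambda>X. [\<one> X]) Xs) = map \<one> Xs" for Xs by (induction Xs) auto
  have hss: "(map \<one> (Dom C (f \<odot>[j] g)))[j + k := h] = concat ?hss"
    unfolding Dom_pcomp1[OF assms(1,2,4,5)] f(1) g(1) using f(2) g(2)
    by (auto simp: list_update_append conc)
  have l: "list_all2 (composable1 C) (map \<one> Xs) (map (\<lambda>X. [\<one> X]) Xs)"
       "map2 (Comp1 C) (map \<one> Xs) (map (\<lambda>X. [\<one> X]) Xs) = map \<one> Xs" if "set Xs \<subseteq> Obj C" for Xs
  proof -
    have "Comp1 C (\<one> X) [\<one> X] = \<one> X" if "X \<in> Obj C" for X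
      using Comp1_Id1_left[of "\<one> X"] that by simp
    then show "list_all2 (composable1 C) (map \<one> Xs) (map (\<lambda>X. [\<one> X]) Xs)"
       "map2 (Comp1 C) (map \<one> Xs) (map (\<lambda>X. [\<one> X]) Xs) = map \<one> Xs"
      using that by (induction Xs) (auto simp: composable1_def)
  qed
  have "list_all2 (composable1 C) ?gs ?hss"
    using composable1_pcomp[of g h k] assms O hs by (intro list_all2_appendI list.rel_intros l) auto
  moreover have "map2 (Comp1 C) ?gs ?hss = map \<one> Us @ (g \<odot>[k] h) # map \<one> Vs"
    using l(2)[OF O(1)] l(2)[OF O(2)] hs by (simp add: pcomp1_def)
  moreover have "(map \<one> (Dom C f))[j := g \<odot>[k] h] = map \<one> Us @ (g \<odot>[k] h) # map \<one> Vs"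
    using f by (auto simp: list_update_append)
  ultimately show ?thesis
    using Comp1_assoc[of f ?gs ?hss] composable1_pcomp[of f g j] assms gs hss
    by (simp add: pcomp1_def)
qed

lemma pcomp2_assoc:
  assumes "\<alpha> \<in> Cell C" "\<beta> \<in> Cell C" "\<gamma> \<in> Cell C" "j < length (Dom C (Src C \<alpha>))"
    "Cod C (Src C \<beta>) = Dom C (Src C \<alpha>) ! j"
    "k < length (Dom C (Src C \<beta>))" "Cod C (Src C \<gamma>) = Dom C (Src C \<beta>) ! k"
  shows "(\<alpha> \<star>[j] \<beta>) \<star>[j + k] \<gamma> = \<alpha> \<star>[j] (\<beta> \<star>[k] \<gamma>)"
proof -
  define f g h where fgh: "f = Src C \<alpha>" "g = Src C \<beta>" "h = Src C \<gamma>"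
  note a = assms[folded fgh]
  have M: "f \<in> Mor C" "g \<in> Mor C" "h \<in> Mor C" using assms fgh by auto
  obtain Us Vs where f: "Dom C f = Us @ Cod C g # Vs" "length Us = j"
    using split_nth[OF a(4)] a(5) by metis
  obtain Us' Vs' where g: "Dom C g = Us' @ Cod C h # Vs'" "length Us' = k"
    using split_nth[OF a(6)] a(7) by metis
  have O: "set Us \<subseteq> Obj C" "set Vs \<subseteq> Obj C" "set Us' \<subseteq> Obj C" "set Vs' \<subseteq> Obj C"
    using f g Dom_Obj[OF M(1)] Dom_Obj[OF M(2)] by auto
  let ?I = "\<lambda>X. \<iota> (\<one> X)"
  let ?gs = "map ?I Us @ \<beta> # map ?I Vs"
  let ?hs = "map ?I Us' @ \<gamma> # map ?I Vs'"
  let ?hss = "map (\<lambda>X. [?I X]) Us @ ?hs # map (\<lambda>X. [?I X]) Vs"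
  have gs: "(map ?I (Dom C f))[j := \<beta>] = ?gs"
    using f by (auto simp: list_update_append)
  have hs: "(map ?I (Dom C g))[k := \<gamma>] = ?hs"
    using g by (auto simp: list_update_append)
  have conc: "concat (map (\<lambda>X. [?I X]) Xs) = map ?I Xs" for Xs by (induction Xs) auto
  have hss: "(map ?I (Dom C (f \<odot>[j] g)))[j + k := \<gamma>] = concat ?hss"
    unfolding Dom_pcomp1[OF M(1,2) a(4,5)] f(1) g(1) using f(2) g(2)
    by (auto simp: list_update_append conc)
  have l: "list_all2 (composable2 C) (map ?I Xs) (map (\<lambda>X. [?I X]) Xs)"
       "map2 (Comp2 C) (map ?I Xs) (map (\<lambda>X. [?I X]) Xs) = map ?I Xs" if "set Xs \<subseteq> Obj C" for Xs
  proof -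
    have "Comp2 C (?I X) [?I X] = ?I X" if "X \<in> Obj C" for X
      using Comp2_Id1_left[of "?I X" "\<one> X" "\<one> X"] that by (auto simp: cells_def)
    then show "list_all2 (composable2 C) (map ?I Xs) (map (\<lambda>X. [?I X]) Xs)"
       "map2 (Comp2 C) (map ?I Xs) (map (\<lambda>X. [?I X]) Xs) = map ?I Xs"
      using that by (induction Xs) (auto simp: composable1_def composable2_def)
  qed
  have "list_all2 (composable2 C) ?gs ?hss"
    using composable2_pcomp(1)[of \<beta> \<gamma> k] a hs fgh
    by (intro list_all2_appendI list.rel_intros l O) auto
  moreover have "map2 (Comp2 C) ?gs ?hss = map ?I Us @ (\<beta> \<star>[k] \<gamma>) # map ?I Vs"
    using l(2)[OF O(1)] l(2)[OF O(2)] hs fgh by (simp add: pcomp2_def)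
  moreover have "(map ?I (Dom C f))[j := \<beta> \<star>[k] \<gamma>] = map ?I Us @ (\<beta> \<star>[k] \<gamma>) # map ?I Vs"
    using f by (auto simp: list_update_append)
  moreover have "Src C (\<alpha> \<star>[j] \<beta>) = f \<odot>[j] g" using a fgh by simp
  ultimately show ?thesis
    using Comp2_assoc[of \<alpha> ?gs ?hss] composable2_pcomp(1)[of \<alpha> \<beta> j] a gs hss fgh
    by (simp add: pcomp2_def)
qed

lemma pcomp1_Id1_left [simp]: "\<lbrakk>f \<in> Mor C; Cod C f = Y\<rbrakk> \<Longrightarrow> \<one> Y \<odot>[0] f = f"
  using Comp1_Id1_left[of f] by (auto simp: pcomp1_def)

lemma pcomp1_Id1_right [simp]:
  "\<lbrakk>f \<in> Mor C; j < length (Dom C f); X = Dom C f ! j\<rbrakk> \<Longrightarrow> f \<odot>[j] \<one> X = f"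
  using Comp1_Id1_right[of f] by (auto simp: pcomp1_def) (metis list_update_id nth_map)

lemma pcomp2_Id1_left [simp]: "\<lbrakk>\<alpha> \<in> Cell C; Cod C (Src C \<alpha>) = Y\<rbrakk> \<Longrightarrow> \<iota> (\<one> Y) \<star>[0] \<alpha> = \<alpha>"
  using Comp2_Id1_left[of \<alpha> "Src C \<alpha>" "Tgt C \<alpha>"] by (auto simp: pcomp2_def cells_def)

lemma pcomp2_Id1_right [simp]:
  "\<lbrakk>\<alpha> \<in> Cell C; j < length (Dom C (Src C \<alpha>)); X = Dom C (Src C \<alpha>) ! j\<rbrakk> \<Longrightarrow>
   \<alpha> \<star>[j] \<iota> (\<one> X) = \<alpha>"
  using Comp2_Id1_right[of \<alpha> "Src C \<alpha>" "Tgt C \<alpha>"]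
  by (auto simp: pcomp2_def cells_def) (metis (no_types, lifting) list_update_id nth_map)

subsection \<open>Invertible 2-cells and pasting\<close>

text \<open>Source and target are read off with \<open>Src\<close> and \<open>Tgt\<close> instead of
  being parameters as in \<open>inv_cells\<close>, so that typing a composite amounts to rewriting
  boundaries.\<close>

definition invertible :: "'c \<Rightarrow> bool" where
  "invertible \<alpha> \<longleftrightarrow> \<alpha> \<in> Cell C \<and> (\<exists>\<beta> \<in> Cell C. Src C \<beta> = Tgt C \<alpha> \<and> Tgt C \<beta> = Src C \<alpha> \<and>
     \<beta> \<cdot> \<alpha> = \<iota> (Src C \<alpha>) \<and> \<alpha> \<cdot> \<beta> = \<iota> (Tgt C \<alpha>))"

lemma invertibleI:
  "\<lbrakk>\<alpha> \<in> Cell C; \<beta> \<in> Cell C; Src C \<beta> = Tgt C \<alpha>; Tgt C \<beta> = Src C \<alpha>;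
    \<beta> \<cdot> \<alpha> = \<iota> (Src C \<alpha>); \<alpha> \<cdot> \<beta> = \<iota> (Tgt C \<alpha>)\<rbrakk> \<Longrightarrow> invertible \<alpha>"
  unfolding invertible_def by blast

lemma invertible_Cell [simp]: "invertible \<alpha> \<Longrightarrow> \<alpha> \<in> Cell C"
  unfolding invertible_def by blast

lemma inv_cells_iff:
  "\<alpha> \<in> inv_cells C f g \<longleftrightarrow> invertible \<alpha> \<and> Src C \<alpha> = f \<and> Tgt C \<alpha> = g"
proof
  assume a: "\<alpha> \<in> inv_cells C f g"
  then obtain \<beta> where "\<beta> \<in> cells C g f" "\<beta> \<cdot> \<alpha> = \<iota> f" "\<alpha> \<cdot> \<beta> = \<iota> g"
    unfolding inv_cells_def by blast
  moreover have "\<alpha> \<in> cells C f g" using a unfolding inv_cells_def by blast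
  ultimately show "invertible \<alpha> \<and> Src C \<alpha> = f \<and> Tgt C \<alpha> = g"
    by (intro conjI invertibleI[of _ \<beta>]) (simp_all add: cells_def)
next
  assume a: "invertible \<alpha> \<and> Src C \<alpha> = f \<and> Tgt C \<alpha> = g"
  then obtain \<beta> where "\<beta> \<in> Cell C" "Src C \<beta> = g" "Tgt C \<beta> = f" "\<beta> \<cdot> \<alpha> = \<iota> f" "\<alpha> \<cdot> \<beta> = \<iota> g"
    unfolding invertible_def by blast
  then show "\<alpha> \<in> inv_cells C f g"
    using a by (simp add: inv_cells_def cells_def) blast
qed

lemma invertibleE:
  assumes "invertible \<alpha>"
  obtains \<beta> where "\<beta> \<in> Cell C" "Src C \<beta> = Tgt C \<alpha>" "Tgt C \<beta> = Src C \<alpha>"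
    "\<beta> \<cdot> \<alpha> = \<iota> (Src C \<alpha>)" "\<alpha> \<cdot> \<beta> = \<iota> (Tgt C \<alpha>)" "invertible \<beta>"
proof -
  obtain \<beta> where b: "\<beta> \<in> Cell C" "Src C \<beta> = Tgt C \<alpha>" "Tgt C \<beta> = Src C \<alpha>"
    "\<beta> \<cdot> \<alpha> = \<iota> (Src C \<alpha>)" "\<alpha> \<cdot> \<beta> = \<iota> (Tgt C \<alpha>)"
    using assms unfolding invertible_def by blast
  then have "invertible \<beta>"
    using assms by (intro invertibleI[of \<beta> \<alpha>]) simp_all
  then show thesis using b that by blast
qed

lemma invertible_Id2 [simp]: "f \<in> Mor C \<Longrightarrow> invertible (\<iota> f)"
  by (rule invertibleI[of _ "\<iota> f"]) auto

lemma invertible_Vcomp [simp]: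
  assumes "invertible \<alpha>" "invertible \<beta>" "Src C \<beta> = Tgt C \<alpha>"
  shows "invertible (\<beta> \<cdot> \<alpha>)"
proof -
  obtain \<alpha>' where a: "\<alpha>' \<in> Cell C" "Src C \<alpha>' = Tgt C \<alpha>" "Tgt C \<alpha>' = Src C \<alpha>"
    "\<alpha>' \<cdot> \<alpha> = \<iota> (Src C \<alpha>)" "\<alpha> \<cdot> \<alpha>' = \<iota> (Tgt C \<alpha>)" using assms(1) by (rule invertibleE)
  obtain \<beta>' where b: "\<beta>' \<in> Cell C" "Src C \<beta>' = Tgt C \<beta>" "Tgt C \<beta>' = Src C \<beta>"
    "\<beta>' \<cdot> \<beta> = \<iota> (Src C \<beta>)" "\<beta> \<cdot> \<beta>' = \<iota> (Tgt C \<beta>)" using assms(2) by (rule invertibleE)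
  have "(\<alpha>' \<cdot> \<beta>') \<cdot> (\<beta> \<cdot> \<alpha>) = \<alpha>' \<cdot> ((\<beta>' \<cdot> \<beta>) \<cdot> \<alpha>)"
    "(\<beta> \<cdot> \<alpha>) \<cdot> (\<alpha>' \<cdot> \<beta>') = \<beta> \<cdot> ((\<alpha> \<cdot> \<alpha>') \<cdot> \<beta>')"
    using assms a(1-3) b(1-3) by (simp_all add: Vcomp_assoc')
  then show ?thesis
    using assms a b by (intro invertibleI[of _ "\<alpha>' \<cdot> \<beta>'"]) auto
qed

lemma invertible_pcomp2 [simp]:
  assumes "invertible \<alpha>" "invertible \<beta>" "j < length (Dom C (Src C \<alpha>))"
    "Cod C (Src C \<beta>) = Dom C (Src C \<alpha>) ! j"
  shows "invertible (\<alpha> \<star>[j] \<beta>)"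
proof -
  obtain \<alpha>' where a: "\<alpha>' \<in> Cell C" "Src C \<alpha>' = Tgt C \<alpha>" "Tgt C \<alpha>' = Src C \<alpha>"
    "\<alpha>' \<cdot> \<alpha> = \<iota> (Src C \<alpha>)" "\<alpha> \<cdot> \<alpha>' = \<iota> (Tgt C \<alpha>)" using assms(1) by (rule invertibleE)
  obtain \<beta>' where b: "\<beta>' \<in> Cell C" "Src C \<beta>' = Tgt C \<beta>" "Tgt C \<beta>' = Src C \<beta>"
    "\<beta>' \<cdot> \<beta> = \<iota> (Src C \<beta>)" "\<beta> \<cdot> \<beta>' = \<iota> (Tgt C \<beta>)" using assms(2) by (rule invertibleE)
  show ?thesis
    using assms a b by (intro invertibleI[of _ "\<alpha>' \<star>[j] \<beta>'"]) (auto simp: interchange)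
qed

lemma cancel_right:
  assumes "invertible \<alpha>" "\<beta> \<in> Cell C" "\<gamma> \<in> Cell C" "Src C \<beta> = Tgt C \<alpha>" "Src C \<gamma> = Tgt C \<alpha>"
    "\<beta> \<cdot> \<alpha> = \<gamma> \<cdot> \<alpha>"
  shows "\<beta> = \<gamma>"
proof -
  obtain \<alpha>' where a: "\<alpha>' \<in> Cell C" "Src C \<alpha>' = Tgt C \<alpha>" "Tgt C \<alpha>' = Src C \<alpha>"
    "\<alpha> \<cdot> \<alpha>' = \<iota> (Tgt C \<alpha>)" using assms(1) by (rule invertibleE)
  have "\<beta> \<cdot> (\<alpha> \<cdot> \<alpha>') = (\<beta> \<cdot> \<alpha>) \<cdot> \<alpha>'"
    by (rule Vcomp_assoc'[symmetric]) (use assms(1-5) a(1-3) in auto)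
  also have "\<dots> = \<gamma> \<cdot> (\<alpha> \<cdot> \<alpha>')"
    unfolding assms(6) by (rule Vcomp_assoc') (use assms(1-5) a(1-3) in auto)
  finally show ?thesis using a assms(1-5) by simp
qed

lemma cancel_left:
  assumes "invertible \<alpha>" "\<beta> \<in> Cell C" "\<gamma> \<in> Cell C" "Tgt C \<beta> = Src C \<alpha>" "Tgt C \<gamma> = Src C \<alpha>"
    "\<alpha> \<cdot> \<beta> = \<alpha> \<cdot> \<gamma>"
  shows "\<beta> = \<gamma>"
proof -
  obtain \<alpha>' where a: "\<alpha>' \<in> Cell C" "Src C \<alpha>' = Tgt C \<alpha>" "Tgt C \<alpha>' = Src C \<alpha>"
    "\<alpha>' \<cdot> \<alpha> = \<iota> (Src C \<alpha>)" using assms(1) by (rule invertibleE)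
  have "(\<alpha>' \<cdot> \<alpha>) \<cdot> \<beta> = \<alpha>' \<cdot> (\<alpha> \<cdot> \<beta>)"
    by (rule Vcomp_assoc') (use assms(1-5) a(1-3) in auto)
  also have "\<dots> = (\<alpha>' \<cdot> \<alpha>) \<cdot> \<gamma>"
    unfolding assms(6) by (rule Vcomp_assoc'[symmetric]) (use assms(1-5) a(1-3) in auto)
  finally show ?thesis using a assms(1-5) by simp
qed

text \<open>The arguments are the top, right, left and bottom edge. The typing of all four edges is
  carried along with the equation, so squares can be pasted without new boundary conditions.\<close>

definition csquare :: "'c \<Rightarrow> 'c \<Rightarrow> 'c \<Rightarrow> 'c \<Rightarrow> bool" where
  "csquare t r l b \<longleftrightarrow> t \<in> Cell C \<and> r \<in> Cell C \<and> l \<in> Cell C \<and> b \<in> Cell C \<and>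
     Src C t = Src C l \<and> Src C r = Tgt C t \<and> Src C b = Tgt C l \<and> Tgt C b = Tgt C r \<and>
     r \<cdot> t = b \<cdot> l"

lemma csquare_eq: "csquare t r l b \<Longrightarrow> r \<cdot> t = b \<cdot> l"
  by (simp add: csquare_def)

lemma csquare_hpaste:
  assumes "csquare t m l b" "csquare t' r m b'"
  shows "csquare (t' \<cdot> t) r l (b' \<cdot> b)"
proof -
  note a = assms[unfolded csquare_def]
  have "r \<cdot> (t' \<cdot> t) = (r \<cdot> t') \<cdot> t" by (rule Vcomp_assoc'[symmetric]) (use a in auto)
  also have "\<dots> = (b' \<cdot> m) \<cdot> t" using a by simp
  also have "\<dots> = b' \<cdot> (m \<cdot> t)" by (rule Vcomp_assoc') (use a in auto)
  also have "\<dots> = b' \<cdot> (b \<cdot> l)" using a by simp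
  also have "\<dots> = (b' \<cdot> b) \<cdot> l" by (rule Vcomp_assoc'[symmetric]) (use a in auto)
  finally show ?thesis using a by (simp add: csquare_def)
qed

lemma csquare_transpose: "csquare t r l b \<Longrightarrow> csquare l b t r"
  by (auto simp: csquare_def)

lemma csquare_vpaste:
  assumes "csquare t r l m" "csquare m r' l' b"
  shows "csquare t (r' \<cdot> r) (l' \<cdot> l) b"
  by (rule csquare_transpose, rule csquare_hpaste[of l m t r]) (rule assms[THEN csquare_transpose])+

lemma csquare_pcomp2:
  assumes "csquare t r l b" "csquare t' r' l' b'"
    "j < length (Dom C (Src C t))" "Cod C (Src C t') = Dom C (Src C t) ! j"
  shows "csquare (t \<star>[j] t') (r \<star>[j] r') (l \<star>[j] l') (b \<star>[j] b')"
  using assms by (auto simp: csquare_def interchange)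

text \<open>The form in which naturality is applied inside a composite of four cells: the two inner
  factors are traded for the other two sides of a square, the outer ones stay.\<close>

lemma csquare_middle:
  assumes "csquare c b c' b'" "a \<in> Cell C" "e \<in> Cell C" "Src C a = Tgt C b" "Tgt C e = Src C c"
  shows "(a \<cdot> b) \<cdot> (c \<cdot> e) = (a \<cdot> b') \<cdot> (c' \<cdot> e)"
proof -
  note t = assms(1)[unfolded csquare_def] assms(2-5)
  have "(a \<cdot> b) \<cdot> (c \<cdot> e) = a \<cdot> (b \<cdot> (c \<cdot> e))" by (rule Vcomp_assoc') (use t in auto)
  also have "b \<cdot> (c \<cdot> e) = (b \<cdot> c) \<cdot> e" by (rule Vcomp_assoc'[symmetric]) (use t in auto)
  also have "b \<cdot> c = b' \<cdot> c'" using t by simp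
  also have "(b' \<cdot> c') \<cdot> e = b' \<cdot> (c' \<cdot> e)" by (rule Vcomp_assoc') (use t in auto)
  also have "a \<cdot> (b' \<cdot> (c' \<cdot> e)) = (a \<cdot> b') \<cdot> (c' \<cdot> e)"
    by (rule Vcomp_assoc'[symmetric]) (use t in auto)
  finally show ?thesis .
qed

lemma csquare_Id2_h: "\<alpha> \<in> Cell C \<Longrightarrow> csquare (\<iota> (Src C \<alpha>)) \<alpha> \<alpha> (\<iota> (Tgt C \<alpha>))"
  by (simp add: csquare_def)

lemma csquare_Id2_v: "\<alpha> \<in> Cell C \<Longrightarrow> csquare \<alpha> (\<iota> (Tgt C \<alpha>)) (\<iota> (Src C \<alpha>)) \<alpha>"
  by (simp add: csquare_def)

lemmas nth_Dom_pcomp1_simps [simp] =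
  nth_Dom_pcomp1 nth_Dom_pcomp1(2)[where k = 0, simplified] nth_Dom_pcomp1(2)[where j = 0, simplified]

lemma Vcomp_assoc5:
  assumes "a \<in> Cell C" "b \<in> Cell C" "c \<in> Cell C" "d \<in> Cell C" "e \<in> Cell C"
    "Src C a = Tgt C b" "Src C b = Tgt C c" "Src C c = Tgt C d" "Src C d = Tgt C e"
  shows "(a \<cdot> (b \<cdot> c)) \<cdot> (d \<cdot> e) = (a \<cdot> (b \<cdot> (c \<cdot> d))) \<cdot> e"
  using assms by (simp add: Vcomp_assoc')

lemma Vcomp_assoc5':
  assumes "a \<in> Cell C" "b \<in> Cell C" "c \<in> Cell C" "d \<in> Cell C" "e \<in> Cell C"
    "Src C a = Tgt C b" "Src C b = Tgt C c" "Src C c = Tgt C d" "Src C d = Tgt C e"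
  shows "((a \<cdot> b) \<cdot> c) \<cdot> (d \<cdot> e) = a \<cdot> ((b \<cdot> (c \<cdot> d)) \<cdot> e)"
  using assms by (simp add: Vcomp_assoc')

text \<open>The pentagon \<open>mult_assoc\<close> becomes a square only with a composite edge. This
  lemma and \<open>csquare_unshift\<close> carry one factor of such an edge across a corner, so that
  the pentagon can be pasted along a single factor.\<close>

lemma csquare_shift:
  assumes "csquare t (r \<cdot> s) l b" "s \<in> Cell C" "r \<in> Cell C" "Src C s = Tgt C t" "Src C r = Tgt C s"
  shows "csquare (s \<cdot> t) r l b"
proof -
  note a = assms(1)[unfolded csquare_def] assms(2-5)
  have "r \<cdot> (s \<cdot> t) = (r \<cdot> s) \<cdot> t" by (rule Vcomp_assoc'[symmetric]) (use a in auto)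
  also have "\<dots> = b \<cdot> l" using a by simp
  finally show ?thesis using a by (simp add: csquare_def)
qed

lemma csquare_precomp:
  assumes "csquare t r l b" "z \<in> Cell C" "Tgt C z = Src C l"
  shows "csquare (t \<cdot> z) r (l \<cdot> z) b"
proof -
  have a: "t \<in> Cell C" "r \<in> Cell C" "l \<in> Cell C" "b \<in> Cell C" "Src C t = Src C l" "Src C r = Tgt C t"
    "Src C b = Tgt C l" "Tgt C b = Tgt C r" "r \<cdot> t = b \<cdot> l"
    using assms by (simp_all add: csquare_def)
  have "r \<cdot> (t \<cdot> z) = (r \<cdot> t) \<cdot> z" by (rule Vcomp_assoc'[symmetric]) (use a assms(2,3) in simp_all)
  also have "\<dots> = b \<cdot> (l \<cdot> z)" unfolding a(9) by (rule Vcomp_assoc') (use a(1-8) assms(2,3) in simp_all)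
  finally show ?thesis using a(1-8) assms(2,3) by (simp add: csquare_def)
qed

lemma csquare_unshift:
  assumes "csquare (s \<cdot> t) r l b" "s \<in> Cell C" "t \<in> Cell C" "Src C s = Tgt C t"
  shows "csquare t (r \<cdot> s) l b"
proof -
  have a: "r \<in> Cell C" "l \<in> Cell C" "b \<in> Cell C" "Src C t = Src C l" "Src C r = Tgt C s"
    "Src C b = Tgt C l" "Tgt C b = Tgt C r" "r \<cdot> (s \<cdot> t) = b \<cdot> l"
    using assms by (simp_all add: csquare_def)
  have "(r \<cdot> s) \<cdot> t = r \<cdot> (s \<cdot> t)" by (rule Vcomp_assoc') (use a assms(2-4) in auto)
  also have "\<dots> = b \<cdot> l" by (rule a(8))
  finally show ?thesis using a(1-7) assms(2-4) by (simp add: csquare_def)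
qed

end

section \<open>Iterated strengthening\<close>

context strong_relative_pseudomonad
begin

abbreviation strengthen_dom :: "nat \<Rightarrow> 'x \<Rightarrow> 'x \<Rightarrow> 'm set" where
  "strengthen_dom \<equiv> strengthenable D C J T"

lemmas strengthen_dom_def [simp] = strengthenable_def

text \<open>A run of consecutive arguments that can be strengthened one after the other, since
  \<open>str1\<close> changes the domain only at its own position. The objects \<open>Xs\<close> are
  part of the data because \<open>FO J\<close> need not be injective. The length bound applies to
  \<open>Xs = []\<close> as well, so even an empty run has its position within the arity.\<close>

definition block :: "nat \<Rightarrow> 'x list \<Rightarrow> 'x \<Rightarrow> 'm \<Rightarrow> bool" where
  "block p Xs Y f \<longleftrightarrow> f \<in> Mor C \<and> Y \<in> Obj D \<and> Cod C f = TO T Y \<and> set Xs \<subseteq> Obj D \<and>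
     p + length Xs \<le> length (Dom C f) \<and> (\<forall>i < length Xs. Dom C f ! (p + i) = FO J (Xs ! i))"

primrec strs :: "nat \<Rightarrow> 'x list \<Rightarrow> 'x \<Rightarrow> 'm \<Rightarrow> 'm" where
  "strs p [] Y f = f"
| "strs p (X # Xs) Y f = strs (Suc p) Xs Y (str1 T p X Y f)"

primrec strs2 :: "nat \<Rightarrow> 'x list \<Rightarrow> 'x \<Rightarrow> 'c \<Rightarrow> 'c" where
  "strs2 p [] Y \<alpha> = \<alpha>"
| "strs2 p (X # Xs) Y \<alpha> = strs2 (Suc p) Xs Y (str2 T p X Y \<alpha>)"

lemma unit_simps [simp]:
  assumes "X \<in> Obj D"
  shows "unit T X \<in> Mor C" "Dom C (unit T X) = [FO J X]" "Cod C (unit T X) = TO T X"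
  using unit_hom[OF assms] by (auto simp: hom_def)

lemma str1_simps [simp]:
  assumes "f \<in> strengthen_dom j X Y"
  shows "str1 T j X Y f \<in> Mor C" "Dom C (str1 T j X Y f) = (Dom C f)[j := TO T X]"
    "Cod C (str1 T j X Y f) = TO T Y"
  using str1_hom[OF assms] by (auto simp: hom_def)

lemma block_Tgt [simp]: "\<alpha> \<in> Cell C \<Longrightarrow> block p Xs Y (Tgt C \<alpha>) \<longleftrightarrow> block p Xs Y (Src C \<alpha>)"
  by (auto simp: block_def)

lemma str2_simps [simp]:
  assumes "\<alpha> \<in> Cell C" "Src C \<alpha> \<in> strengthen_dom j X Y"
  shows "str2 T j X Y \<alpha> \<in> Cell C" "Src C (str2 T j X Y \<alpha>) = str1 T j X Y (Src C \<alpha>)"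
    "Tgt C (str2 T j X Y \<alpha>) = str1 T j X Y (Tgt C \<alpha>)"
  using str2_cells[OF assms(2), of \<alpha> "Tgt C \<alpha>"] assms(1) by (auto simp: cells_def)

lemma str2_Vcomp' [simp]:
  assumes "\<alpha> \<in> Cell C" "\<beta> \<in> Cell C" "Src C \<beta> = Tgt C \<alpha>" "Src C \<alpha> \<in> strengthen_dom j X Y"
  shows "str2 T j X Y (\<beta> \<cdot> \<alpha>) = str2 T j X Y \<beta> \<cdot> str2 T j X Y \<alpha>"
  by (rule str2_Vcomp[OF assms(4)]) (use assms in \<open>auto simp: cells_def\<close>)

lemma blockD:
  assumes "block p Xs Y f"
  shows "f \<in> Mor C" "Y \<in> Obj D" "Cod C f = TO T Y" "p + length Xs \<le> length (Dom C f)"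
  using assms by (auto simp: block_def)

lemma block_Nil [simp]: "block p [] Y f \<longleftrightarrow> f \<in> Mor C \<and> Y \<in> Obj D \<and> Cod C f = TO T Y \<and> p \<le> length (Dom C f)"
  by (auto simp: block_def)

lemma block_append [simp]: "block p (Xs @ Ys) Y f \<longleftrightarrow> block p Xs Y f \<and> block (p + length Xs) Ys Y f"
proof -
  have "(\<forall>i < length Xs + length Ys. P i) \<longleftrightarrow>
      (\<forall>i < length Xs. P i) \<and> (\<forall>i < length Ys. P (length Xs + i))" for P :: "nat \<Rightarrow> bool"
  proof (safe)
    fix i assume "\<forall>i < length Xs. P i" "\<forall>i < length Ys. P (length Xs + i)" "i < length Xs + length Ys"
    then show "P i"
      by (cases "i < length Xs") (auto dest: spec[of _ "i - length Xs"])
  qed auto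
  from this[of "\<lambda>i. Dom C f ! (p + i) = FO J ((Xs @ Ys) ! i)"] show ?thesis
    by (auto simp: block_def nth_append add.assoc)
qed

lemma block_single: "block p [X] Y f \<longleftrightarrow> f \<in> strengthen_dom p X Y"
  by (auto simp: block_def)

lemma block_Cons [simp]: "block p (X # Xs) Y f \<longleftrightarrow> f \<in> strengthen_dom p X Y \<and> block (Suc p) Xs Y f"
  using block_append[of p "[X]" Xs] by (simp add: block_single)

lemma block_str1 [simp]:
  assumes "f \<in> strengthen_dom j X Y" "outside p (length Xs) j"
  shows "block p Xs Y (str1 T j X Y f) \<longleftrightarrow> block p Xs Y f"
  using assms by (auto simp: block_def nth_list_update outside_def)

lemma strs_simps:
  assumes "block p Xs Y f"
  shows "strs p Xs Y f \<in> Mor C \<and> Cod C (strs p Xs Y f) = TO T Y \<and>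
    length (Dom C (strs p Xs Y f)) = length (Dom C f) \<and>
    (\<forall>i. Dom C (strs p Xs Y f) ! i =
      (if p \<le> i \<and> i < p + length Xs then TO T (Xs ! (i - p)) else Dom C f ! i))"
  using assms
proof (induction Xs arbitrary: p f)
  case (Cons X Xs)
  then show ?case
    using Cons.IH[of "Suc p" "str1 T p X Y f"]
    by (auto simp: nth_list_update nth_Cons' Suc_le_eq)
qed (auto simp: blockD)

lemma strs_Mor [simp]: "block p Xs Y f \<Longrightarrow> strs p Xs Y f \<in> Mor C"
  and Cod_strs [simp]: "block p Xs Y f \<Longrightarrow> Cod C (strs p Xs Y f) = TO T Y"
  and length_Dom_strs [simp]:
    "block p Xs Y f \<Longrightarrow> length (Dom C (strs p Xs Y f)) = length (Dom C f)"
  and nth_Dom_strs_out [simp]: "\<lbrakk>block p Xs Y f; outside p (length Xs) i\<rbrakk> \<Longrightarrow>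
    Dom C (strs p Xs Y f) ! i = Dom C f ! i"
  and nth_Dom_strs_in: "\<lbrakk>block p Xs Y f; i < length Xs\<rbrakk> \<Longrightarrow>
    Dom C (strs p Xs Y f) ! (p + i) = TO T (Xs ! i)"
  using strs_simps[of p Xs Y f] by (auto simp: outside_def)

lemma block_strs [simp]:
  assumes "block p Xs Y f" "p + length Xs \<le> q \<or> q + length Ys \<le> p"
  shows "block q Ys Y (strs p Xs Y f) \<longleftrightarrow> block q Ys Y f"
  using assms blockD[OF assms(1)] unfolding block_def[of q] by auto

lemma strs2_simps [simp]:
  assumes "\<alpha> \<in> Cell C" "block p Xs Y (Src C \<alpha>)"
  shows "strs2 p Xs Y \<alpha> \<in> Cell C" "Src C (strs2 p Xs Y \<alpha>) = strs p Xs Y (Src C \<alpha>)"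
    "Tgt C (strs2 p Xs Y \<alpha>) = strs p Xs Y (Tgt C \<alpha>)"
  using assms by (induction Xs arbitrary: p \<alpha>) auto

lemma strs2_Id2 [simp]: "block p Xs Y f \<Longrightarrow> strs2 p Xs Y (\<iota> f) = \<iota> (strs p Xs Y f)"
  by (induction Xs arbitrary: p f) (auto simp: str2_Id2)

lemma strs2_Vcomp:
  assumes "\<alpha> \<in> Cell C" "\<beta> \<in> Cell C" "Src C \<beta> = Tgt C \<alpha>" "block p Xs Y (Src C \<alpha>)"
  shows "strs2 p Xs Y (\<beta> \<cdot> \<alpha>) = strs2 p Xs Y \<beta> \<cdot> strs2 p Xs Y \<alpha>"
  using assms by (induction Xs arbitrary: p \<alpha> \<beta>) auto

lemma strs_append: "strs p (Xs @ Ys) Y f = strs (p + length Xs) Ys Y (strs p Xs Y f)"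
  by (induction Xs arbitrary: p f) auto

lemma strs2_append: "strs2 p (Xs @ Ys) Y f = strs2 (p + length Xs) Ys Y (strs2 p Xs Y f)"
  by (induction Xs arbitrary: p f) auto

lemma invertible_str2 [simp]:
  assumes "J.C.invertible \<alpha>" "Src C \<alpha> \<in> strengthen_dom j X Y"
  shows "J.C.invertible (str2 T j X Y \<alpha>)"
proof -
  obtain \<beta> where b: "\<beta> \<in> Cell C" "Src C \<beta> = Tgt C \<alpha>" "Tgt C \<beta> = Src C \<alpha>"
    "\<beta> \<cdot> \<alpha> = \<iota> (Src C \<alpha>)" "\<alpha> \<cdot> \<beta> = \<iota> (Tgt C \<alpha>)" using assms(1) by (rule J.C.invertibleE)
  then show ?thesis
    using assms by (intro J.C.invertibleI[of _ "str2 T j X Y \<beta>"])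
      (simp_all add: str2_Vcomp'[symmetric] str2_Id2 del: str2_Vcomp')
qed

lemma invertible_strs2 [simp]:
  "\<lbrakk>J.C.invertible \<alpha>; block p Xs Y (Src C \<alpha>)\<rbrakk> \<Longrightarrow> J.C.invertible (strs2 p Xs Y \<alpha>)"
  by (induction Xs arbitrary: p \<alpha>) auto

lemma csquare_strs2:
  assumes "J.C.csquare t r l b" "block p Xs Y (Src C t)"
  shows "J.C.csquare (strs2 p Xs Y t) (strs2 p Xs Y r) (strs2 p Xs Y l) (strs2 p Xs Y b)"
proof -
  have c: "t \<in> Cell C" "r \<in> Cell C" "l \<in> Cell C" "b \<in> Cell C" "Src C t = Src C l"
    "Src C r = Tgt C t" "Src C b = Tgt C l" "Tgt C b = Tgt C r" and e: "r \<cdot> t = b \<cdot> l"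
    using assms(1) by (auto simp: J.C.csquare_def)
  have "strs2 p Xs Y r \<cdot> strs2 p Xs Y t = strs2 p Xs Y (r \<cdot> t)"
    by (rule strs2_Vcomp[symmetric]) (use c assms(2) in auto)
  also have "\<dots> = strs2 p Xs Y b \<cdot> strs2 p Xs Y l"
    unfolding e by (rule strs2_Vcomp) (use c assms(2) in auto)
  finally show ?thesis
    using c assms(2) by (simp add: J.C.csquare_def)
qed

text \<open>
  For \<open>Xs = []\<close> the two positions may differ, but then they do not matter.
\<close>

lemma strs_shift_Suc:
  "k \<noteq> p \<and> outside (Suc p) (length Xs) k \<Longrightarrow> strs (shift k m (Suc p)) Xs = strs (Suc (shift k m p)) Xs"
  and strs2_shift_Suc:
  "k \<noteq> p \<and> outside (Suc p) (length Xs) k \<Longrightarrow> strs2 (shift k m (Suc p)) Xs = strs2 (Suc (shift k m p)) Xs"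
  by (cases Xs; auto simp: shift_def fun_eq_iff outside_def)+

lemma block_pcomp_out [simp]:
  assumes "block p Xs Y f" "outside p (length Xs) k" "k < length (Dom C f)" "g \<in> Mor C"
    "Cod C g = Dom C f ! k" "m = length (Dom C g)"
  shows "block (shift k m p) Xs Y (f \<odot>[k] g)"
proof -
  have "Dom C (f \<odot>[k] g) ! (shift k m p + i) = Dom C f ! (p + i)" if "i < length Xs" for i
  proof -
    have "shift k m p + i = shift k m (p + i)" "p + i \<noteq> k"
      using that assms(2) by (auto simp: shift_def outside_def)
    then show ?thesis
      using assms blockD[OF assms(1)] by (simp add: J.C.nth_Dom_pcomp1)
  qed
  then show ?thesis
    using assms by (auto simp: block_def) (auto simp: shift_def outside_def)
qed

lemma block_pcomp_in [simp]:
  assumes "F \<in> Mor C" "j < length (Dom C F)" "Cod C F = TO T Y" "Y \<in> Obj D" "block k Ws X g"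
    "Dom C F ! j = TO T X"
  shows "block (j + k) Ws Y (F \<odot>[j] g)"
proof -
  have "Dom C (F \<odot>[j] g) ! (j + k + i) = FO J (Ws ! i)" if "i < length Ws" for i
    using that assms J.C.nth_Dom_pcomp1(2)[of F g j "k + i"] by (simp add: add.assoc block_def)
  then show ?thesis
    using assms by (auto simp: block_def)
qed

section \<open>Structure cells, and pseudonaturality for a run of strengthenings\<close>

lemma str_nat_simps [simp]:
  assumes "f \<in> strengthen_dom j X Y" "k < length (Dom C f)" "k \<noteq> j" "g \<in> Mor C" "Cod C g = Dom C f ! k"
  shows "J.C.invertible (str_nat T j X Y f k g)"
    "Src C (str_nat T j X Y f k g) = str1 T (shift k (length (Dom C g)) j) X Y (f \<odot>[k] g)"
    "Tgt C (str_nat T j X Y f k g) = str1 T j X Y f \<odot>[k] g"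
  using str_nat_cells[OF assms] by (auto simp: J.C.inv_cells_iff)

lemma t_unit_simps [simp]:
  assumes "f \<in> strengthen_dom j X Y"
  shows "J.C.invertible (t_unit T j X Y f)" "Src C (t_unit T j X Y f) = f"
    "Tgt C (t_unit T j X Y f) = str1 T j X Y f \<odot>[j] unit T X"
  using t_unit_cells[OF assms] by (auto simp: J.C.inv_cells_iff)

lemma t_mult_simps [simp]:
  assumes "f \<in> strengthen_dom j X Y" "g \<in> strengthen_dom k W X"
  shows "J.C.invertible (t_mult T j X Y f k W g)"
    "Src C (t_mult T j X Y f k W g) = str1 T (j + k) W Y (str1 T j X Y f \<odot>[j] g)"
    "Tgt C (t_mult T j X Y f k W g) = str1 T j X Y f \<odot>[j] str1 T k W X g"
  using t_mult_cells[OF assms] by (auto simp: J.C.inv_cells_iff)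

lemma \<theta>_simps [simp]:
  assumes "X \<in> Obj D"
  shows "J.C.invertible (\<theta> T X)" "Src C (\<theta> T X) = str1 T 0 X X (unit T X)"
    "Tgt C (\<theta> T X) = \<one> (TO T X)"
  using \<theta>_cells[OF assms] by (auto simp: J.C.inv_cells_iff)

text \<open>The pseudonaturality constraint of a whole run, pulling \<open>g\<close> out of all its
  strengthenings. The first argument is strengthened innermost, so its constraint still has to be
  strengthened in the remaining arguments.\<close>

primrec strs_nat :: "nat \<Rightarrow> 'x list \<Rightarrow> 'x \<Rightarrow> 'm \<Rightarrow> nat \<Rightarrow> 'm \<Rightarrow> 'c" where
  "strs_nat p [] Y f k g = \<iota> (f \<odot>[k] g)"
| "strs_nat p (X # Xs) Y f k g = strs_nat (Suc p) Xs Y (str1 T p X Y f) k g \<cdot>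
     strs2 (Suc (shift k (length (Dom C g)) p)) Xs Y (str_nat T p X Y f k g)"

lemma strs_nat_typing:
  assumes "block p Xs Y f" "outside p (length Xs) k" "k < length (Dom C f)" "g \<in> Mor C"
    "Cod C g = Dom C f ! k"
  shows "J.C.invertible (strs_nat p Xs Y f k g) \<and>
    Src C (strs_nat p Xs Y f k g) = strs (shift k (length (Dom C g)) p) Xs Y (f \<odot>[k] g) \<and>
    Tgt C (strs_nat p Xs Y f k g) = strs p Xs Y f \<odot>[k] g"
  using assms
proof (induction Xs arbitrary: p f)
  case (Cons X Xs)
  have b: "block (shift k (length (Dom C g)) p) (X # Xs) Y (f \<odot>[k] g)"
    by (rule block_pcomp_out) (use Cons.prems in auto)
  show ?case
    using Cons.prems b Cons.IH[of "Suc p" "str1 T p X Y f"]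
      strs_shift_Suc[of k p Xs "length (Dom C g)"]
    by auto
qed simp

lemma strs_nat_simps [simp]:
  assumes "block p Xs Y f" "outside p (length Xs) k" "k < length (Dom C f)" "g \<in> Mor C"
    "Cod C g = Dom C f ! k"
  shows "J.C.invertible (strs_nat p Xs Y f k g)"
    "Src C (strs_nat p Xs Y f k g) = strs (shift k (length (Dom C g)) p) Xs Y (f \<odot>[k] g)"
    "Tgt C (strs_nat p Xs Y f k g) = strs p Xs Y f \<odot>[k] g"
  using strs_nat_typing[OF assms] by auto

lemma csquare_str_nat:
  assumes "\<alpha> \<in> Cell C" "\<beta> \<in> Cell C" "Src C \<alpha> \<in> strengthen_dom j X Y" "k < length (Dom C (Src C \<alpha>))" "k \<noteq> j"
    "Cod C (Src C \<beta>) = Dom C (Src C \<alpha>) ! k"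
  shows "J.C.csquare (str_nat T j X Y (Src C \<alpha>) k (Src C \<beta>)) (str2 T j X Y \<alpha> \<star>[k] \<beta>)
    (str2 T (shift k (length (Dom C (Src C \<beta>))) j) X Y (\<alpha> \<star>[k] \<beta>))
    (str_nat T j X Y (Tgt C \<alpha>) k (Tgt C \<beta>))"
proof -
  have "(str2 T j X Y \<alpha> \<star>[k] \<beta>) \<cdot> str_nat T j X Y (Src C \<alpha>) k (Src C \<beta>) =
      str_nat T j X Y (Tgt C \<alpha>) k (Tgt C \<beta>) \<cdot>
      str2 T (shift k (length (Dom C (Src C \<beta>))) j) X Y (\<alpha> \<star>[k] \<beta>)"
    by (rule str_nat_natural) (use assms in \<open>auto simp: cells_def\<close>)
  then show ?thesis
    using assms by (simp add: J.C.csquare_def)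
qed

lemma csquare_strs_nat:
  assumes "\<alpha> \<in> Cell C" "\<beta> \<in> Cell C" "block p Xs Y (Src C \<alpha>)" "outside p (length Xs) k"
    "k < length (Dom C (Src C \<alpha>))" "Cod C (Src C \<beta>) = Dom C (Src C \<alpha>) ! k"
  shows "J.C.csquare (strs_nat p Xs Y (Src C \<alpha>) k (Src C \<beta>)) (strs2 p Xs Y \<alpha> \<star>[k] \<beta>)
    (strs2 (shift k (length (Dom C (Src C \<beta>))) p) Xs Y (\<alpha> \<star>[k] \<beta>))
    (strs_nat p Xs Y (Tgt C \<alpha>) k (Tgt C \<beta>))"
  using assms
proof (induction Xs arbitrary: p \<alpha>)
  case Nil
  then show ?case using J.C.csquare_Id2_h[of "\<alpha> \<star>[k] \<beta>"] by simp
next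
  case (Cons X Xs)
  let ?m = "length (Dom C (Src C \<beta>))"
  have b: "block (shift k ?m p) (X # Xs) Y (Src C \<alpha> \<odot>[k] Src C \<beta>)"
    by (rule block_pcomp_out) (use Cons.prems in auto)
  have "J.C.csquare (str_nat T p X Y (Src C \<alpha>) k (Src C \<beta>)) (str2 T p X Y \<alpha> \<star>[k] \<beta>)
    (str2 T (shift k ?m p) X Y (\<alpha> \<star>[k] \<beta>)) (str_nat T p X Y (Tgt C \<alpha>) k (Tgt C \<beta>))"
    by (rule csquare_str_nat) (use Cons.prems in auto)
  then have "J.C.csquare (strs2 (Suc (shift k ?m p)) Xs Y (str_nat T p X Y (Src C \<alpha>) k (Src C \<beta>)))
    (strs2 (Suc (shift k ?m p)) Xs Y (str2 T p X Y \<alpha> \<star>[k] \<beta>))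
    (strs2 (Suc (shift k ?m p)) Xs Y (str2 T (shift k ?m p) X Y (\<alpha> \<star>[k] \<beta>)))
    (strs2 (Suc (shift k ?m p)) Xs Y (str_nat T p X Y (Tgt C \<alpha>) k (Tgt C \<beta>)))"
    by (rule csquare_strs2) (use Cons.prems b in auto)
  from J.C.csquare_hpaste[OF this, of "strs_nat (Suc p) Xs Y (str1 T p X Y (Src C \<alpha>)) k (Src C \<beta>)"]
    Cons.IH[of "str2 T p X Y \<alpha>" "Suc p"]
  show ?case
    using Cons.prems strs2_shift_Suc[of k p Xs ?m] by auto
qed

lemma strs_nat_shift_Suc:
  "\<lbrakk>k \<noteq> p; outside (Suc p) (length Xs) k\<rbrakk> \<Longrightarrow> strs_nat (shift k m (Suc p)) Xs = strs_nat (Suc (shift k m p)) Xs"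
  by (cases Xs; auto simp: shift_def fun_eq_iff outside_def)+

text \<open>\<open>str1 T p X Y f \<odot>[k] g\<close> is the target of a cell
  \<open>str_nat\<close> whose source is a strengthening of \<open>f \<odot>[k] g\<close>. Cells
  preserve domains, and that strengthening takes place before the run at \<open>q\<close>.\<close>

lemma block_str1_pcomp_out [simp]:
  assumes "f \<in> strengthen_dom p X Y" "block q Xs Y (f \<odot>[k] g)" "k < length (Dom C f)" "g \<in> Mor C"
    "Cod C g = Dom C f ! k" "k \<noteq> p" "shift k (length (Dom C g)) p < q"
  shows "block q Xs Y (str1 T p X Y f \<odot>[k] g)"
proof -
  have "block q Xs Y (Tgt C (str_nat T p X Y f k g)) \<longleftrightarrow> block q Xs Y (Src C (str_nat T p X Y f k g))"
    by (rule block_Tgt, rule J.C.invertible_Cell, rule str_nat_simps) (use assms in simp_all)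
  moreover have "f \<odot>[k] g \<in> strengthen_dom (shift k (length (Dom C g)) p) X Y"
    using assms by simp
  ultimately show ?thesis
    using assms str_nat_simps(2,3)[of f p X Y k g] block_str1[of "f \<odot>[k] g" _ X Y q Xs] by simp
qed

text \<open>The axiom \<open>str_nat_comp\<close> splits the constraint of the first argument, the
  induction hypothesis that of the others. This gives the order \<open>g\<close>, \<open>h\<close>
  twice in succession; naturality of the later constraint past \<open>h\<close>, in the first
  constraint past \<open>g\<close>, exchanges the two inner factors.\<close>

lemma strs_nat_comp:
  assumes "block p Xs Y f" "outside p (length Xs) k" "k < length (Dom C f)" "g \<in> Mor C"
    "Cod C g = Dom C f ! k" "l < length (Dom C g)" "h \<in> Mor C" "Cod C h = Dom C g ! l"
  shows "strs_nat p Xs Y f k (g \<odot>[l] h) = (strs_nat p Xs Y f k g \<star>[k + l] \<iota> h)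
     \<cdot> strs_nat (shift k (length (Dom C g)) p) Xs Y (f \<odot>[k] g) (k + l) h"
  using assms
proof (induction Xs arbitrary: p f)
  case Nil
  then show ?case by (simp add: J.C.pcomp1_assoc)
next
  case (Cons X Xs)
  let ?m = "length (Dom C g)" and ?m' = "length (Dom C h)" and ?F = "str1 T p X Y f"
  let ?p = "shift k ?m p" 
  let ?q = "shift (k + l) ?m' ?p"
  have b: "block ?p (X # Xs) Y (f \<odot>[k] g)"
    by (rule block_pcomp_out) (use Cons.prems in auto)
  have b': "block ?q (X # Xs) Y ((f \<odot>[k] g) \<odot>[k + l] h)"
    by (rule block_pcomp_out[OF b]) (use Cons.prems in auto)
  note prems = Cons.prems[simplified] b[simplified] b'[simplified]
  let ?S = "strs2 (Suc ?q) Xs Y"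
  have "strs_nat p (X # Xs) Y f k (g \<odot>[l] h) = strs_nat (Suc p) Xs Y ?F k (g \<odot>[l] h) \<cdot>
      ?S (str_nat T p X Y f k (g \<odot>[l] h))"
    using Cons.prems by simp
  also have "str_nat T p X Y f k (g \<odot>[l] h) = (str_nat T p X Y f k g \<star>[k + l] \<iota> h)
        \<cdot> str_nat T ?p X Y (f \<odot>[k] g) (k + l) h"
    by (rule str_nat_comp) (use prems in auto)
  also have "?S \<dots> = ?S (str_nat T p X Y f k g \<star>[k + l] \<iota> h) \<cdot>
      ?S (str_nat T ?p X Y (f \<odot>[k] g) (k + l) h)"
    by (rule strs2_Vcomp) (use prems in auto)
  also have "strs_nat (Suc p) Xs Y ?F k (g \<odot>[l] h) = (strs_nat (Suc p) Xs Y ?F k g \<star>[k + l] \<iota> h)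
     \<cdot> strs_nat (Suc ?p) Xs Y (?F \<odot>[k] g) (k + l) h"
    using Cons.IH[of "Suc p" ?F] prems strs_nat_shift_Suc[of k p Xs ?m] by simp
  also have "((strs_nat (Suc p) Xs Y ?F k g \<star>[k + l] \<iota> h) \<cdot> strs_nat (Suc ?p) Xs Y (?F \<odot>[k] g) (k + l) h) \<cdot>
      (?S (str_nat T p X Y f k g \<star>[k + l] \<iota> h) \<cdot> ?S (str_nat T ?p X Y (f \<odot>[k] g) (k + l) h)) =
      ((strs_nat (Suc p) Xs Y ?F k g \<star>[k + l] \<iota> h) \<cdot>
        (strs2 (Suc ?p) Xs Y (str_nat T p X Y f k g) \<star>[k + l] \<iota> h)) \<cdot>
      (strs_nat (Suc ?p) Xs Y (str1 T ?p X Y (f \<odot>[k] g)) (k + l) h \<cdot>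
        ?S (str_nat T ?p X Y (f \<odot>[k] g) (k + l) h))"
  proof (rule J.C.csquare_middle)
    show "J.C.csquare (?S (str_nat T p X Y f k g \<star>[k + l] \<iota> h)) (strs_nat (Suc ?p) Xs Y (?F \<odot>[k] g) (k + l) h)
        (strs_nat (Suc ?p) Xs Y (str1 T ?p X Y (f \<odot>[k] g)) (k + l) h)
        (strs2 (Suc ?p) Xs Y (str_nat T p X Y f k g) \<star>[k + l] \<iota> h)"
      using J.C.csquare_transpose[OF csquare_strs_nat[of "str_nat T p X Y f k g" "\<iota> h" "Suc ?p" Xs Y "k + l"]]
        prems strs2_shift_Suc[of "k + l" ?p Xs ?m'] by simp
  qed (use prems strs_nat_shift_Suc[of k p Xs ?m] strs_shift_Suc[of k p Xs ?m]
     strs_shift_Suc[of "k + l" ?p Xs ?m'] in simp_all)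
  also have "(strs_nat (Suc p) Xs Y ?F k g \<star>[k + l] \<iota> h) \<cdot>
      (strs2 (Suc ?p) Xs Y (str_nat T p X Y f k g) \<star>[k + l] \<iota> h) =
      strs_nat p (X # Xs) Y f k g \<star>[k + l] \<iota> h"
    using prems strs_shift_Suc[of k p Xs ?m] by (subst J.C.interchange) auto
  finally show ?case by simp
qed

lemma strs_nat_append:
  assumes "block p (Xs @ Ys) Y f" "outside p (length (Xs @ Ys)) k" "k < length (Dom C f)" "g \<in> Mor C"
    "Cod C g = Dom C f ! k"
  shows "strs_nat p (Xs @ Ys) Y f k g = strs_nat (p + length Xs) Ys Y (strs p Xs Y f) k g \<cdot>
    strs2 (shift k (length (Dom C g)) p + length Xs) Ys Y (strs_nat p Xs Y f k g)"
  using assms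
proof (induction Xs arbitrary: p f)
  case Nil
  have "block (shift k (length (Dom C g)) p) Ys Y (f \<odot>[k] g)"
    by (rule block_pcomp_out) (use Nil.prems in auto)
  then show ?case using Nil by simp
next
  case (Cons X Xs)
  let ?m = "length (Dom C g)"
  let ?p = "shift k ?m p" 
  have b: "block ?p (X # Xs @ Ys) Y (f \<odot>[k] g)"
    by (rule block_pcomp_out) (use Cons.prems in auto)
  \<comment> \<open>Only for nonempty \<open>Ys\<close> do the start positions agree: with
    \<open>Ys = []\<close> nothing prevents \<open>k\<close> from being the position right after the
    run. An empty run ignores its position, which is why \<open>e\<close> holds in both
    cases.\<close>
  have sh: "shift k ?m (Suc p) + length Xs = Suc (?p + length Xs)"
      "shift k ?m (Suc (p + length Xs)) = Suc (?p + length Xs)" if "0 < length Ys"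
    using Cons.prems(2) that by (cases Ys; auto simp: shift_def outside_def)+
  have e: "strs2 (shift k ?m (Suc p) + length Xs) Ys = strs2 (Suc (?p + length Xs)) Ys"
      "strs (shift k ?m (Suc p) + length Xs) Ys = strs (Suc (?p + length Xs)) Ys"
      "strs (shift k ?m (Suc (p + length Xs))) Ys = strs (Suc (?p + length Xs)) Ys"
    using sh by (cases Ys; simp add: fun_eq_iff)+
  note prems = Cons.prems[simplified] b[simplified]
  note f = strs2_shift_Suc[of k p Xs ?m] strs2_shift_Suc[of k p "Xs @ Ys" ?m]
     strs_shift_Suc[of k p Xs ?m] strs_shift_Suc[of k p "Xs @ Ys" ?m] e
  let ?S = "strs2 (Suc (?p + length Xs)) Ys Y"
  have "strs_nat p ((X # Xs) @ Ys) Y f k g = strs_nat (Suc p) (Xs @ Ys) Y (str1 T p X Y f) k g \<cdot> 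
      strs2 (Suc ?p) (Xs @ Ys) Y (str_nat T p X Y f k g)"
    by simp
  also have "strs_nat (Suc p) (Xs @ Ys) Y (str1 T p X Y f) k g =
     strs_nat (Suc p + length Xs) Ys Y (strs (Suc p) Xs Y (str1 T p X Y f)) k g \<cdot>
     ?S (strs_nat (Suc p) Xs Y (str1 T p X Y f) k g)"
    using Cons.IH[of "Suc p" "str1 T p X Y f"] prems e by simp
  also have "\<dots> \<cdot> strs2 (Suc ?p) (Xs @ Ys) Y (str_nat T p X Y f k g) =
    strs_nat (Suc p + length Xs) Ys Y (strs (Suc p) Xs Y (str1 T p X Y f)) k g \<cdot>
    ?S (strs_nat (Suc p) Xs Y (str1 T p X Y f) k g \<cdot> strs2 (Suc ?p) Xs Y (str_nat T p X Y f k g))"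
    using prems f by (simp add: strs2_append strs2_Vcomp J.C.Vcomp_assoc' )
  finally show ?case by simp
qed

lemma strs_nat_Id1:
  assumes "block p Xs Y f" "outside p (length Xs) k" "k < length (Dom C f)" "X = Dom C f ! k"
  shows "strs_nat p Xs Y f k (\<one> X) = \<iota> (strs p Xs Y f)"
  using assms
proof (induction Xs arbitrary: p f)
  case (Cons X' Xs)
  then have "shift k 1 p = p" by (auto simp: shift_def outside_def)
  then show ?case
    using Cons.prems Cons.IH[of "Suc p" "str1 T p X' Y f"] str_nat_Id1[of f p X' Y k] by auto
qed simp

subsection \<open>Iterated \<open>t_mult\<close>\<close>

text \<open>Moves the strengthenings of a run in \<open>g\<close> from the outside of
  \<open>str1 T j X Y f \<odot>[j] g\<close> to the inside. As in \<open>strs_nat\<close>, the cell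
  for the first argument is strengthened in all later ones.\<close>

primrec t_mults :: "nat \<Rightarrow> 'x \<Rightarrow> 'x \<Rightarrow> 'm \<Rightarrow> nat \<Rightarrow> 'x list \<Rightarrow> 'm \<Rightarrow> 'c" where
  "t_mults j X Y f k [] g = \<iota> (str1 T j X Y f \<odot>[j] g)"
| "t_mults j X Y f k (W # Ws) g = t_mults j X Y f (Suc k) Ws (str1 T k W X g) \<cdot>
     strs2 (Suc (j + k)) Ws Y (t_mult T j X Y f k W g)"

lemma block_pcomp_str1 [simp]:
  assumes "f \<in> strengthen_dom j X Y" "block k Ws X g"
  shows "block (j + k) Ws Y (str1 T j X Y f \<odot>[j] g)"
  by (rule block_pcomp_in[where X = X]) (use assms in simp_all)

lemma block_pcomp_str1_Suc [simp]:
  assumes "f \<in> strengthen_dom j X Y" "block (Suc k) Ws X g"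
  shows "block (Suc (j + k)) Ws Y (str1 T j X Y f \<odot>[j] g)"
  using block_pcomp_str1[OF assms] by simp

lemma t_mults_typing:
  assumes "f \<in> strengthen_dom j X Y" "block k Ws X g"
  shows "J.C.invertible (t_mults j X Y f k Ws g) \<and>
    Src C (t_mults j X Y f k Ws g) = strs (j + k) Ws Y (str1 T j X Y f \<odot>[j] g) \<and>
    Tgt C (t_mults j X Y f k Ws g) = str1 T j X Y f \<odot>[j] strs k Ws X g"
  using assms
proof (induction Ws arbitrary: k g)
  case (Cons W Ws)
  show ?case
    using Cons.prems Cons.IH[of "Suc k" "str1 T k W X g"] by simp
qed simp

lemma t_mults_simps [simp]:
  assumes "f \<in> strengthen_dom j X Y" "block k Ws X g"
  shows "J.C.invertible (t_mults j X Y f k Ws g)"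
    "Src C (t_mults j X Y f k Ws g) = strs (j + k) Ws Y (str1 T j X Y f \<odot>[j] g)"
    "Tgt C (t_mults j X Y f k Ws g) = str1 T j X Y f \<odot>[j] strs k Ws X g"
  using t_mults_typing[OF assms] by auto

lemma csquare_t_mult:
  assumes "\<alpha> \<in> Cell C" "\<beta> \<in> Cell C" "Src C \<alpha> \<in> strengthen_dom j X Y" "Src C \<beta> \<in> strengthen_dom k W X"
  shows "J.C.csquare (t_mult T j X Y (Src C \<alpha>) k W (Src C \<beta>))
    (str2 T j X Y \<alpha> \<star>[j] str2 T k W X \<beta>)
    (str2 T (j + k) W Y (str2 T j X Y \<alpha> \<star>[j] \<beta>))
    (t_mult T j X Y (Tgt C \<alpha>) k W (Tgt C \<beta>))"
proof -
  have "(str2 T j X Y \<alpha> \<star>[j] str2 T k W X \<beta>) \<cdot> t_mult T j X Y (Src C \<alpha>) k W (Src C \<beta>) =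
      t_mult T j X Y (Tgt C \<alpha>) k W (Tgt C \<beta>) \<cdot> str2 T (j + k) W Y (str2 T j X Y \<alpha> \<star>[j] \<beta>)"
    by (rule t_mult_natural) (use assms in \<open>simp_all add: cells_def\<close>)
  then show ?thesis
    using assms by (simp add: J.C.csquare_def)
qed

lemma csquare_t_mults:
  assumes "\<alpha> \<in> Cell C" "\<beta> \<in> Cell C" "Src C \<alpha> \<in> strengthen_dom j X Y" "block k Ws X (Src C \<beta>)"
  shows "J.C.csquare (t_mults j X Y (Src C \<alpha>) k Ws (Src C \<beta>))
    (str2 T j X Y \<alpha> \<star>[j] strs2 k Ws X \<beta>)
    (strs2 (j + k) Ws Y (str2 T j X Y \<alpha> \<star>[j] \<beta>))
    (t_mults j X Y (Tgt C \<alpha>) k Ws (Tgt C \<beta>))"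
  using assms
proof (induction Ws arbitrary: k \<beta>)
  case Nil
  then show ?case
    using J.C.csquare_Id2_h[of "str2 T j X Y \<alpha> \<star>[j] \<beta>"] by simp
next
  case (Cons W Ws)
  have "J.C.csquare (t_mult T j X Y (Src C \<alpha>) k W (Src C \<beta>))
    (str2 T j X Y \<alpha> \<star>[j] str2 T k W X \<beta>)
    (str2 T (j + k) W Y (str2 T j X Y \<alpha> \<star>[j] \<beta>))
    (t_mult T j X Y (Tgt C \<alpha>) k W (Tgt C \<beta>))"
    by (rule csquare_t_mult) (use Cons.prems in simp_all)
  from csquare_strs2[OF this, of "Suc (j + k)" Ws Y]
  show ?case
    using Cons.prems J.C.csquare_hpaste Cons.IH[of "str2 T k W X \<beta>" "Suc k"] by simp
qed

lemma t_mults_append: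
  assumes "f \<in> strengthen_dom j X Y" "block k (Ws @ Vs) X g"
  shows "t_mults j X Y f k (Ws @ Vs) g = t_mults j X Y f (k + length Ws) Vs (strs k Ws X g) \<cdot>
    strs2 (j + k + length Ws) Vs Y (t_mults j X Y f k Ws g)"
  using assms
proof (induction Ws arbitrary: k g)
  case (Cons W Ws)
  have "block (j + k) (W # Ws @ Vs) Y (str1 T j X Y f \<odot>[j] g)"
    by (rule block_pcomp_str1) (use Cons.prems in simp_all)
  moreover have "block (j + Suc (k + length Ws)) Vs Y (str1 T j X Y f \<odot>[j] g)"
    "block (j + Suc (k + length Ws)) Vs Y (str1 T j X Y f \<odot>[j] str1 T k W X g)"
    by (rule block_pcomp_str1; use Cons.prems in simp)+
  ultimately show ?case
    using Cons.prems Cons.IH[of "Suc k" "str1 T k W X g"]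
    by (simp add: strs2_append strs2_Vcomp J.C.Vcomp_assoc' add.assoc)
qed simp

lemma t_mults_shift_Suc:
  "\<lbrakk>l \<noteq> k; outside (Suc k) (length Ws) l\<rbrakk> \<Longrightarrow>
   t_mults j X Y f (shift l m (Suc k)) Ws = t_mults j X Y f (Suc (shift l m k)) Ws"
  by (cases Ws; auto simp: shift_def fun_eq_iff outside_def)+

lemma csquare_t_mult_inner:
  assumes "f \<in> strengthen_dom j X Y" "g \<in> strengthen_dom k W X" "l < length (Dom C g)" "l \<noteq> k"
    "h \<in> Mor C" "Cod C h = Dom C g ! l"
  shows "J.C.csquare (t_mult T j X Y f (shift l (length (Dom C h)) k) W (g \<odot>[l] h))
    (\<iota> (str1 T j X Y f) \<star>[j] str_nat T k W X g l h)
    (str_nat T (j + k) W Y (str1 T j X Y f \<odot>[j] g) (j + l) h)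
    (t_mult T j X Y f k W g \<star>[j + l] \<iota> h)"
  using t_mult_str_nat_inner[OF assms refl] assms
  by (simp add: J.C.csquare_def J.C.pcomp1_assoc)

text \<open>The induction step is a two-by-two grid. Its first square is the axiom for the single
  argument \<open>W\<close>, strengthened along the rest, and its last square is the induction
  hypothesis; the other two are naturality of \<open>t_mults\<close> in \<open>str_nat\<close> and
  of \<open>strs_nat\<close> in \<open>t_mult\<close>.\<close>

lemma csquare_t_mults_inner:
  assumes "f \<in> strengthen_dom j X Y" "block k Ws X g" "outside k (length Ws) l" "l < length (Dom C g)"
    "h \<in> Mor C" "Cod C h = Dom C g ! l"
  shows "J.C.csquare (t_mults j X Y f (shift l (length (Dom C h)) k) Ws (g \<odot>[l] h))
    (\<iota> (str1 T j X Y f) \<star>[j] strs_nat k Ws X g l h)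
    (strs_nat (j + k) Ws Y (str1 T j X Y f \<odot>[j] g) (j + l) h)
    (t_mults j X Y f k Ws g \<star>[j + l] \<iota> h)"
  using assms
proof (induction Ws arbitrary: k g)
  case Nil
  then show ?case
    using J.C.csquare_Id2_h[of "\<iota> ((str1 T j X Y f \<odot>[j] g) \<odot>[j + l] h)"]
    by (simp add: J.C.pcomp1_assoc)
next
  case (Cons W Ws)
  let ?m = "length (Dom C h)" and ?F = "str1 T j X Y f" and ?G = "str1 T k W X g"
  let ?k = "shift l ?m k"
  have b: "block ?k (W # Ws) X (g \<odot>[l] h)"
    by (rule block_pcomp_out) (use Cons.prems in simp_all)
  have bF: "block (j + ?k) (W # Ws) Y (?F \<odot>[j] (g \<odot>[l] h))"
    by (rule block_pcomp_str1[OF _ b]) (use Cons.prems in simp_all)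
  note prems = Cons.prems[simplified] b[simplified]
  have st: "block (Suc (j + ?k)) Ws Y (str1 T (j + ?k) W Y (?F \<odot>[j] (g \<odot>[l] h)))"
    using bF by simp
  have "J.C.csquare (t_mult T j X Y f ?k W (g \<odot>[l] h)) (\<iota> ?F \<star>[j] str_nat T k W X g l h)
      (str_nat T (j + k) W Y (?F \<odot>[j] g) (j + l) h) (t_mult T j X Y f k W g \<star>[j + l] \<iota> h)"
    by (rule csquare_t_mult_inner) (use prems in simp_all)
  then have Q1: "J.C.csquare (strs2 (Suc (j + ?k)) Ws Y (t_mult T j X Y f ?k W (g \<odot>[l] h)))
      (strs2 (Suc (j + ?k)) Ws Y (\<iota> ?F \<star>[j] str_nat T k W X g l h))
      (strs2 (Suc (j + ?k)) Ws Y (str_nat T (j + k) W Y (?F \<odot>[j] g) (j + l) h))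
      (strs2 (Suc (j + ?k)) Ws Y (t_mult T j X Y f k W g \<star>[j + l] \<iota> h))"
    by (rule csquare_strs2) (use prems st in simp_all)
  have Q2: "J.C.csquare (t_mults j X Y f (Suc ?k) Ws (str1 T ?k W X (g \<odot>[l] h)))
      (\<iota> ?F \<star>[j] strs2 (Suc ?k) Ws X (str_nat T k W X g l h))
      (strs2 (Suc (j + ?k)) Ws Y (\<iota> ?F \<star>[j] str_nat T k W X g l h))
      (t_mults j X Y f (Suc ?k) Ws (?G \<odot>[l] h))"
    using csquare_t_mults[of "\<iota> f" "str_nat T k W X g l h" j X Y "Suc ?k" Ws] prems
    by (simp add: str2_Id2)
  have Q3: "J.C.csquare (strs_nat (Suc (j + k)) Ws Y (str1 T (j + k) W Y (?F \<odot>[j] g)) (j + l) h)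
      (strs2 (Suc (j + k)) Ws Y (t_mult T j X Y f k W g) \<star>[j + l] \<iota> h)
      (strs2 (Suc (j + ?k)) Ws Y (t_mult T j X Y f k W g \<star>[j + l] \<iota> h))
      (strs_nat (Suc (j + k)) Ws Y (?F \<odot>[j] ?G) (j + l) h)"
    using csquare_strs_nat[of "t_mult T j X Y f k W g" "\<iota> h" "Suc (j + k)" Ws Y "j + l"] prems
      strs2_shift_Suc[of "j + l" "j + k" Ws ?m]
    by simp
  have Q4: "J.C.csquare (t_mults j X Y f (Suc ?k) Ws (?G \<odot>[l] h))
      (\<iota> ?F \<star>[j] strs_nat (Suc k) Ws X ?G l h) (strs_nat (Suc (j + k)) Ws Y (?F \<odot>[j] ?G) (j + l) h)
      (t_mults j X Y f (Suc k) Ws ?G \<star>[j + l] \<iota> h)"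
    using Cons.IH[of "Suc k" ?G] prems t_mults_shift_Suc[of l k Ws j X Y f ?m] by simp
  have e1: "(\<iota> ?F \<star>[j] strs_nat (Suc k) Ws X ?G l h) \<cdot>
      (\<iota> ?F \<star>[j] strs2 (Suc ?k) Ws X (str_nat T k W X g l h)) = \<iota> ?F \<star>[j] strs_nat k (W # Ws) X g l h"
    using prems strs_shift_Suc[of l k Ws ?m] by (subst J.C.interchange) simp_all
  have e2: "(t_mults j X Y f (Suc k) Ws ?G \<star>[j + l] \<iota> h) \<cdot>
      (strs2 (Suc (j + k)) Ws Y (t_mult T j X Y f k W g) \<star>[j + l] \<iota> h) =
      t_mults j X Y f k (W # Ws) g \<star>[j + l] \<iota> h"
    using prems by (subst J.C.interchange) simp_all
  from J.C.csquare_vpaste[OF J.C.csquare_hpaste[OF Q1 Q2] J.C.csquare_hpaste[OF J.C.csquare_transpose[OF Q3] Q4]]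
  show ?case
    unfolding e1 e2 using prems by simp
qed

text \<open>The pentagon \<open>mult_assoc\<close> with two consecutive edges composed into one,
  which makes the pasting of squares applicable to it.\<close>

lemma csquare_mult_assoc:
  assumes "f \<in> strengthen_dom j X Y" "g \<in> strengthen_dom k W X" "h \<in> strengthen_dom l V W"
  shows "J.C.csquare (str2 T (j + k + l) V Y (t_mult T j X Y f k W g \<star>[j + k] \<iota> h))
    ((\<iota> (str1 T j X Y f) \<star>[j] t_mult T k W X g l V h) \<cdot> t_mult T j X Y f (k + l) V (str1 T k W X g \<odot>[k] h))
    (t_mult T (j + k) W Y (str1 T j X Y f \<odot>[j] g) l V h)
    (t_mult T j X Y f k W g \<star>[j + k] \<iota> (str1 T l V W h))"
proof -
  let ?F = "str1 T j X Y f" and ?G = "str1 T k W X g"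
  have a: "(?F \<odot>[j] ?G) \<odot>[j + k] h = ?F \<odot>[j] (?G \<odot>[k] h)"
     "(?F \<odot>[j] ?G) \<odot>[j + k] str1 T l V W h = ?F \<odot>[j] (?G \<odot>[k] str1 T l V W h)"
    using assms by (simp_all add: J.C.pcomp1_assoc)
  have "((\<iota> ?F \<star>[j] t_mult T k W X g l V h) \<cdot> t_mult T j X Y f (k + l) V (?G \<odot>[k] h)) \<cdot>
      str2 T (j + k + l) V Y (t_mult T j X Y f k W g \<star>[j + k] \<iota> h) =
      (\<iota> ?F \<star>[j] t_mult T k W X g l V h) \<cdot> (t_mult T j X Y f (k + l) V (?G \<odot>[k] h) \<cdot>
      str2 T (j + k + l) V Y (t_mult T j X Y f k W g \<star>[j + k] \<iota> h))"
    by (rule J.C.Vcomp_assoc') (simp_all add: assms[simplified] a add.assoc[of j k l, symmetric])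
  also note mult_assoc[OF assms, symmetric]
  finally have e: "((\<iota> ?F \<star>[j] t_mult T k W X g l V h) \<cdot> t_mult T j X Y f (k + l) V (?G \<odot>[k] h)) \<cdot>
      str2 T (j + k + l) V Y (t_mult T j X Y f k W g \<star>[j + k] \<iota> h) =
      (t_mult T j X Y f k W g \<star>[j + k] \<iota> (str1 T l V W h)) \<cdot>
      t_mult T (j + k) W Y (?F \<odot>[j] g) l V h" .
  show ?thesis
    unfolding J.C.csquare_def
    by (intro conjI; (rule e)?) (simp_all add: assms[simplified] a add.assoc[of j k l, symmetric])
qed

lemma csquare_t_mults_assoc:
  assumes "f \<in> strengthen_dom j X Y" "g \<in> strengthen_dom k W X" "block l Vs W h"
  shows "J.C.csquare (strs2 (j + k + l) Vs Y (t_mult T j X Y f k W g \<star>[j + k] \<iota> h))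
    ((\<iota> (str1 T j X Y f) \<star>[j] t_mults k W X g l Vs h) \<cdot> t_mults j X Y f (k + l) Vs (str1 T k W X g \<odot>[k] h))
    (t_mults (j + k) W Y (str1 T j X Y f \<odot>[j] g) l Vs h)
    (t_mult T j X Y f k W g \<star>[j + k] \<iota> (strs l Vs W h))"
  using assms
proof (induction Vs arbitrary: l h)
  case Nil
  then show ?case
    using J.C.csquare_Id2_v[of "t_mult T j X Y f k W g \<star>[j + k] \<iota> h"] by (simp add: J.C.pcomp1_assoc)
next
  case (Cons V Vs)
  let ?F = "str1 T j X Y f" and ?G = "str1 T k W X g" and ?t = "t_mult T j X Y f k W g"
  let ?H = "str1 T l V W h" and ?S = "strs2 (Suc (j + k + l)) Vs Y"
  note prems = Cons.prems[simplified]
  have b: "block (j + k + l) (V # Vs) Y (str1 T (j + k) W Y (?F \<odot>[j] g) \<odot>[j + k] h)"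
    by (rule block_pcomp_str1) (use prems in simp_all)
  have b2: "block (k + l) (V # Vs) X (?G \<odot>[k] h)"
    by (rule block_pcomp_str1) (use prems in simp_all)
  have b3: "block (j + (k + l)) (V # Vs) Y (?F \<odot>[j] (?G \<odot>[k] h))"
    by (rule block_pcomp_str1[OF _ b2]) (use prems in simp_all)
  have b4: "block (Suc (j + k + l)) Vs Y (?F \<odot>[j] str1 T (k + l) V X (?G \<odot>[k] h))"
    using block_pcomp_str1[of f j X Y "Suc (k + l)" Vs "str1 T (k + l) V X (?G \<odot>[k] h)"] prems b2
    by (simp add: add.assoc)
  have "J.C.csquare (str2 T (j + k + l) V Y (?t \<star>[j + k] \<iota> h))
    ((\<iota> ?F \<star>[j] t_mult T k W X g l V h) \<cdot> t_mult T j X Y f (k + l) V (?G \<odot>[k] h))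
    (t_mult T (j + k) W Y (?F \<odot>[j] g) l V h) (?t \<star>[j + k] \<iota> ?H)"
    by (rule csquare_mult_assoc) (use prems in simp_all)
  then have Q1: "J.C.csquare (?S (str2 T (j + k + l) V Y (?t \<star>[j + k] \<iota> h)))
    (?S ((\<iota> ?F \<star>[j] t_mult T k W X g l V h) \<cdot> t_mult T j X Y f (k + l) V (?G \<odot>[k] h)))
    (?S (t_mult T (j + k) W Y (?F \<odot>[j] g) l V h)) (?S (?t \<star>[j + k] \<iota> ?H))"
    by (rule csquare_strs2) (use prems b in simp_all)
  have Q2: "J.C.csquare (?S (?t \<star>[j + k] \<iota> ?H))
    ((\<iota> ?F \<star>[j] t_mults k W X g (Suc l) Vs ?H) \<cdot> t_mults j X Y f (Suc (k + l)) Vs (?G \<odot>[k] ?H))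
    (t_mults (j + k) W Y (?F \<odot>[j] g) (Suc l) Vs ?H)
    (?t \<star>[j + k] \<iota> (strs (Suc l) Vs W ?H))"
    using Cons.IH[of "Suc l" ?H] prems by simp
  have Q3: "J.C.csquare (t_mults j X Y f (Suc (k + l)) Vs (str1 T (k + l) V X (?G \<odot>[k] h)))
    (\<iota> ?F \<star>[j] strs2 (Suc (k + l)) Vs X (t_mult T k W X g l V h))
    (?S (\<iota> ?F \<star>[j] t_mult T k W X g l V h)) (t_mults j X Y f (Suc (k + l)) Vs (?G \<odot>[k] ?H))"
    using csquare_t_mults[of "\<iota> f" "t_mult T k W X g l V h" j X Y "Suc (k + l)" Vs] prems b2
    by (simp add: str2_Id2 add.assoc)
  \<comment> \<open>Pasting the pentagon for \<open>V\<close> to the induction hypothesis leaves the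
    multiplications into \<open>g\<close> and into \<open>f\<close> alternating along the right
    edge. Naturality \<open>Q3\<close> of those into \<open>f\<close> brings them into the order in
    which \<open>t_mults\<close> unfolds.\<close>
  have e: "((\<iota> ?F \<star>[j] t_mults k W X g (Suc l) Vs ?H) \<cdot> t_mults j X Y f (Suc (k + l)) Vs (?G \<odot>[k] ?H)) \<cdot>
     ?S ((\<iota> ?F \<star>[j] t_mult T k W X g l V h) \<cdot> t_mult T j X Y f (k + l) V (?G \<odot>[k] h)) =
     (\<iota> ?F \<star>[j] t_mults k W X g l (V # Vs) h) \<cdot> t_mults j X Y f (k + l) (V # Vs) (?G \<odot>[k] h)"
    (is "(?a \<cdot> ?b) \<cdot> _ = _")
  proof -
    have "?S ((\<iota> ?F \<star>[j] t_mult T k W X g l V h) \<cdot> t_mult T j X Y f (k + l) V (?G \<odot>[k] h)) =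
       ?S (\<iota> ?F \<star>[j] t_mult T k W X g l V h) \<cdot> ?S (t_mult T j X Y f (k + l) V (?G \<odot>[k] h))"
      by (rule strs2_Vcomp) (use prems b2 b3 b4 in \<open>simp_all add: add.assoc\<close>)
    moreover have "(?a \<cdot> ?b) \<cdot> (?S (\<iota> ?F \<star>[j] t_mult T k W X g l V h) \<cdot> ?S (t_mult T j X Y f (k + l) V (?G \<odot>[k] h))) =
      (?a \<cdot> (\<iota> ?F \<star>[j] strs2 (Suc (k + l)) Vs X (t_mult T k W X g l V h))) \<cdot>
      (t_mults j X Y f (Suc (k + l)) Vs (str1 T (k + l) V X (?G \<odot>[k] h)) \<cdot> ?S (t_mult T j X Y f (k + l) V (?G \<odot>[k] h)))"
      by (rule J.C.csquare_middle[OF J.C.csquare_transpose[OF Q3]])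
         (use prems b2 b3 b4 in \<open>simp_all add: add.assoc\<close>)
    moreover have "?a \<cdot> (\<iota> ?F \<star>[j] strs2 (Suc (k + l)) Vs X (t_mult T k W X g l V h)) =
       \<iota> ?F \<star>[j] t_mults k W X g l (V # Vs) h"
      using prems b2 by (subst J.C.interchange) simp_all
    ultimately show ?thesis by (simp add: add.assoc)
  qed
  from J.C.csquare_vpaste[OF Q1 Q2] show ?case
    unfolding e by simp
qed

subsection \<open>Derived unit laws\<close>

text \<open>
  The unit laws below follow from \<open>mult_assoc\<close> and \<open>mult_unit\<close> by Kelly's argument for the redundancy
  of coherence axioms: strengthening is faithful because \<open>t_unit\<close> is natural and invertible.
\<close>

lemma str2_faithful:
  assumes "\<alpha> \<in> Cell C" "\<beta> \<in> Cell C" "Src C \<alpha> \<in> strengthen_dom j X Y" "Src C \<beta> = Src C \<alpha>" "Tgt C \<beta> = Tgt C \<alpha>"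
    "str2 T j X Y \<alpha> = str2 T j X Y \<beta>"
  shows "\<alpha> = \<beta>"
proof (rule J.C.cancel_left)
  have n: "(str2 T j X Y \<gamma> \<star>[j] \<iota> (unit T X)) \<cdot> t_unit T j X Y (Src C \<alpha>) =
      t_unit T j X Y (Tgt C \<alpha>) \<cdot> \<gamma>"
    if "\<gamma> \<in> Cell C" "Src C \<gamma> = Src C \<alpha>" "Tgt C \<gamma> = Tgt C \<alpha>" for \<gamma>
    by (rule t_unit_natural) (use assms(3) that in \<open>simp_all add: cells_def\<close>)
  show "t_unit T j X Y (Tgt C \<alpha>) \<cdot> \<alpha> = t_unit T j X Y (Tgt C \<alpha>) \<cdot> \<beta>"
    using n[OF assms(1)] n[OF assms(2,4,5)] assms(6) by simp
  show "J.C.invertible (t_unit T j X Y (Tgt C \<alpha>))"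
    "Tgt C \<alpha> = Src C (t_unit T j X Y (Tgt C \<alpha>))"
    using assms(1,3) by simp_all
  then show "Tgt C \<beta> = Src C (t_unit T j X Y (Tgt C \<alpha>))"
    using assms(5) by simp
qed fact+

lemma whisker_exchange:
  assumes "\<alpha> \<in> Cell C" "\<beta> \<in> Cell C" "j < length (Dom C (Src C \<alpha>))"
    "Cod C (Src C \<beta>) = Dom C (Src C \<alpha>) ! j"
  shows "(\<alpha> \<star>[j] \<iota> (Tgt C \<beta>)) \<cdot> (\<iota> (Src C \<alpha>) \<star>[j] \<beta>) = (\<iota> (Tgt C \<alpha>) \<star>[j] \<beta>) \<cdot> (\<alpha> \<star>[j] \<iota> (Src C \<beta>))"
  using assms by (simp add: J.C.interchange)

text \<open>Strengthening is faithful, so it suffices to compare the strengthened sides followed by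
  an invertible \<open>?P\<close>. Both composites then equal \<open>t_mult\<close>: the left one by
  \<open>mult_assoc\<close> and by \<open>mult_unit\<close> at \<open>?F \<odot>[j] g\<close>, the
  right one by naturality of \<open>t_mult\<close> and by \<open>mult_unit\<close> at
  \<open>g\<close>.\<close>

lemma t_unit_pcomp:
  assumes "f \<in> strengthen_dom j X Y" "g \<in> strengthen_dom k W X"
  shows "(t_mult T j X Y f k W g \<star>[j + k] \<iota> (unit T W)) \<cdot> t_unit T (j + k) W Y (str1 T j X Y f \<odot>[j] g) =
    \<iota> (str1 T j X Y f) \<star>[j] t_unit T k W X g" (is "?\<alpha> = ?\<beta>")
proof -
  let ?F = "str1 T j X Y f" and ?G = "str1 T k W X g" and ?u = "unit T W" and ?t = "t_mult T j X Y f k W g"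
  let ?H = "str1 T (j + k) W Y (?F \<odot>[j] g)" and ?S = "str2 T (j + k) W Y"
  let ?K = "str1 T 0 W W ?u"
  have s: "?F \<odot>[j] g \<in> strengthen_dom (j + k) W Y"
    using assms by simp
  have a: "(?F \<odot>[j] ?G) \<odot>[j + k] ?u = ?F \<odot>[j] (?G \<odot>[k] ?u)"
    "(?F \<odot>[j] ?G) \<odot>[j + k] ?K = ?F \<odot>[j] (?G \<odot>[k] ?K)"
    using assms by (simp_all add: J.C.pcomp1_assoc)
  let ?\<mu> = "t_mult T k W X g 0 W ?u" and ?\<nu> = "t_mult T j X Y f k W (?G \<odot>[k] ?u)"
  \<comment> \<open>\<open>?P\<close> leads from the strengthening of
    \<open>?F \<odot>[j] (?G \<odot>[k] ?u)\<close> to \<open>?F \<odot>[j] ?G\<close>: multiply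
    twice, then remove the strengthened unit. It ends in \<open>\<theta>\<close> so that
    \<open>mult_unit\<close> can be reached from either side.\<close>
  let ?P = "(\<iota> ?F \<star>[j] (\<iota> ?G \<star>[k] \<theta> T W)) \<cdot> ((\<iota> ?F \<star>[j] ?\<mu>) \<cdot> ?\<nu>)"
  have P: "J.C.invertible ?P" "Src C ?P = str1 T (j + k) W Y (?F \<odot>[j] (?G \<odot>[k] ?u))"
    using assms by simp_all
  note ty = assms[simplified] a
  have "?P \<cdot> ?S ?\<alpha> = ?t"
  proof -
    have "?P \<cdot> ?S ?\<alpha> = ((\<iota> ?F \<star>[j] (\<iota> ?G \<star>[k] \<theta> T W)) \<cdot>
        ((\<iota> ?F \<star>[j] ?\<mu>) \<cdot> (?\<nu> \<cdot> ?S (?t \<star>[j + k] \<iota> ?u)))) \<cdot> ?S (t_unit T (j + k) W Y (?F \<odot>[j] g))"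
    proof -
      have "?S ?\<alpha> = ?S (?t \<star>[j + k] \<iota> ?u) \<cdot> ?S (t_unit T (j + k) W Y (?F \<odot>[j] g))"
        by (rule str2_Vcomp') (simp_all add: ty)
      then show ?thesis
        by (simp only:) (rule J.C.Vcomp_assoc5; simp add: ty)
    qed
    also have "(\<iota> ?F \<star>[j] ?\<mu>) \<cdot> (?\<nu> \<cdot> ?S (?t \<star>[j + k] \<iota> ?u)) =
        (?t \<star>[j + k] \<iota> ?K) \<cdot> t_mult T (j + k) W Y (?F \<odot>[j] g) 0 W ?u"
      using mult_assoc[OF assms, of ?u 0 W] assms by simp
    also have "((\<iota> ?F \<star>[j] (\<iota> ?G \<star>[k] \<theta> T W)) \<cdot>
        ((?t \<star>[j + k] \<iota> ?K) \<cdot> t_mult T (j + k) W Y (?F \<odot>[j] g) 0 W ?u)) \<cdot> ?S (t_unit T (j + k) W Y (?F \<odot>[j] g)) =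
      ((\<iota> ?F \<star>[j] (\<iota> ?G \<star>[k] \<theta> T W)) \<cdot> (?t \<star>[j + k] \<iota> ?K)) \<cdot>
      (t_mult T (j + k) W Y (?F \<odot>[j] g) 0 W ?u \<cdot> ?S (t_unit T (j + k) W Y (?F \<odot>[j] g)))"
      by (simp add: ty J.C.Vcomp_assoc')
    \<comment> \<open>\<open>\<theta>\<close> acts on what is substituted at \<open>j + k\<close>,
      \<open>?t\<close> on the arrow substituted into, so the two can be exchanged; afterwards
      \<open>\<theta>\<close> is whiskered with \<open>?H\<close>, as \<open>mult_unit\<close>
      requires.\<close>
    also have "(\<iota> ?F \<star>[j] (\<iota> ?G \<star>[k] \<theta> T W)) \<cdot> (?t \<star>[j + k] \<iota> ?K) =
       ?t \<cdot> (\<iota> ?H \<star>[j + k] \<theta> T W)"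
    proof -
      have "(\<iota> ?F \<star>[j] (\<iota> ?G \<star>[k] \<theta> T W)) = \<iota> (?F \<odot>[j] ?G) \<star>[j + k] \<theta> T W"
        by (simp add: ty J.C.pcomp2_assoc[symmetric])
      then show ?thesis
        using whisker_exchange[of ?t "\<theta> T W" "j + k"] by (simp add: ty)
    qed
    also have "(?t \<cdot> (\<iota> ?H \<star>[j + k] \<theta> T W)) \<cdot>
      (t_mult T (j + k) W Y (?F \<odot>[j] g) 0 W ?u \<cdot> ?S (t_unit T (j + k) W Y (?F \<odot>[j] g))) =
      ?t \<cdot> ((\<iota> ?H \<star>[j + k] \<theta> T W) \<cdot>
      (t_mult T (j + k) W Y (?F \<odot>[j] g) 0 W ?u \<cdot> ?S (t_unit T (j + k) W Y (?F \<odot>[j] g))))"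
      by (simp add: ty J.C.Vcomp_assoc')
    also have "\<dots> = ?t"
      unfolding mult_unit[OF s(1)] by (simp add: ty)
    finally show ?thesis .
  qed
  moreover have "?P \<cdot> ?S ?\<beta> = ?t"
  proof -
    have "?P \<cdot> ?S ?\<beta> = (\<iota> ?F \<star>[j] (\<iota> ?G \<star>[k] \<theta> T W)) \<cdot>
        ((\<iota> ?F \<star>[j] ?\<mu>) \<cdot> (?\<nu> \<cdot> ?S ?\<beta>))"
      by (simp add: ty J.C.Vcomp_assoc')
    also have "?\<nu> \<cdot> ?S ?\<beta> = (\<iota> ?F \<star>[j] str2 T k W X (t_unit T k W X g)) \<cdot> ?t"
      using csquare_t_mult[of "\<iota> f" "t_unit T k W X g" j X Y k W, THEN J.C.csquare_eq]
      by (simp add: ty str2_Id2)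
    also have "(\<iota> ?F \<star>[j] (\<iota> ?G \<star>[k] \<theta> T W)) \<cdot>
        ((\<iota> ?F \<star>[j] ?\<mu>) \<cdot> ((\<iota> ?F \<star>[j] str2 T k W X (t_unit T k W X g)) \<cdot> ?t)) =
        ((\<iota> ?F \<star>[j] (\<iota> ?G \<star>[k] \<theta> T W)) \<cdot>
        ((\<iota> ?F \<star>[j] ?\<mu>) \<cdot> (\<iota> ?F \<star>[j] str2 T k W X (t_unit T k W X g)))) \<cdot> ?t"
      by (simp add: ty J.C.Vcomp_assoc')
    also have "(\<iota> ?F \<star>[j] (\<iota> ?G \<star>[k] \<theta> T W)) \<cdot>
        ((\<iota> ?F \<star>[j] ?\<mu>) \<cdot> (\<iota> ?F \<star>[j] str2 T k W X (t_unit T k W X g))) =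
        \<iota> ?F \<star>[j] ((\<iota> ?G \<star>[k] \<theta> T W) \<cdot> (?\<mu> \<cdot> str2 T k W X (t_unit T k W X g)))"
      by (simp add: ty J.C.interchange)
    also have "\<dots> \<cdot> ?t = ?t"
      unfolding mult_unit[OF assms(2)] by (simp add: ty)
    finally show ?thesis .
  qed
  ultimately have e: "?P \<cdot> ?S ?\<alpha> = ?P \<cdot> ?S ?\<beta>"
    by (rule trans_sym)
  have "?S ?\<alpha> = ?S ?\<beta>"
  proof (rule J.C.cancel_left[OF P(1) _ _ _ _ e])
    show "?S ?\<alpha> \<in> Cell C" "?S ?\<beta> \<in> Cell C" "Tgt C (?S ?\<alpha>) = Src C ?P" "Tgt C (?S ?\<beta>) = Src C ?P"
      by (simp_all add: ty)
  qed
  then show ?thesis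
    by (rule str2_faithful[rotated 5]) (simp_all add: ty)
qed

context
  fixes X assumes X: "X \<in> Obj D"
begin

abbreviation (input) "U \<equiv> unit T X"
abbreviation (input) "K \<equiv> str1 T 0 X X (unit T X)"
abbreviation (input) "\<eta> \<equiv> t_unit T 0 X X (unit T X)"
abbreviation (input) "\<mu> \<equiv> t_mult T 0 X X (unit T X) 0 X (unit T X)"
text \<open>The inverse of \<open>\<iota> K \<star>[0] \<theta> T X\<close>: both are invertible,
  and by \<open>mult_unit\<close> their composite in one order is an identity.\<close>

abbreviation (input) "\<sigma> \<equiv> t_mult T 0 X X (unit T X) 0 X (unit T X) \<cdot> str2 T 0 X X (t_unit T 0 X X (unit T X))"

lemma \<theta>_\<sigma>: "(\<iota> K \<star>[0] \<theta> T X) \<cdot> \<sigma> = \<iota> K"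
  using mult_unit[of "unit T X" 0 X X] X by simp

text \<open>Whiskering with \<open>K\<close> is isomorphic to the identity via \<open>\<theta>\<close>.\<close>

lemma whisker_K_faithful:
  assumes "\<alpha> \<in> Cell C" "\<beta> \<in> Cell C" "Src C \<beta> = Src C \<alpha>" "Tgt C \<beta> = Tgt C \<alpha>" "Cod C (Src C \<alpha>) = TO T X"
    "\<iota> K \<star>[0] \<alpha> = \<iota> K \<star>[0] \<beta>"
  shows "\<alpha> = \<beta>"
proof (rule J.C.cancel_right)
  have n: "(\<theta> T X \<star>[0] \<iota> (Tgt C \<alpha>)) \<cdot> (\<iota> K \<star>[0] \<gamma>) = \<gamma> \<cdot> (\<theta> T X \<star>[0] \<iota> (Src C \<alpha>))"
    if "\<gamma> \<in> Cell C" "Src C \<gamma> = Src C \<alpha>" "Tgt C \<gamma> = Tgt C \<alpha>" for \<gamma>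
    using whisker_exchange[of "\<theta> T X" \<gamma> 0] that assms(5) X by simp
  show "\<alpha> \<cdot> (\<theta> T X \<star>[0] \<iota> (Src C \<alpha>)) = \<beta> \<cdot> (\<theta> T X \<star>[0] \<iota> (Src C \<alpha>))"
    using n[OF assms(1)] n[OF assms(2-4)] assms(6) by simp
  show "J.C.invertible (\<theta> T X \<star>[0] \<iota> (Src C \<alpha>))"
    "Src C \<alpha> = Tgt C (\<theta> T X \<star>[0] \<iota> (Src C \<alpha>))"
    using assms(1,5) X TO_Obj[OF X] by simp_all
  then show "Src C \<beta> = Tgt C (\<theta> T X \<star>[0] \<iota> (Src C \<alpha>))"
    using assms(3) by simp
qed fact+

text \<open>Both sides are whiskered with \<open>K\<close>, which is faithful, and preceded by
  \<open>?s\<close> and \<open>?\<nu>'\<close>. On the left, \<open>mult_assoc\<close> for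
  \<open>U\<close>, \<open>U\<close>, \<open>g\<close> produces \<open>\<mu>\<close>; on the right,
  naturality of \<open>t_mult\<close> moves \<open>\<theta>\<close> under the strengthening. Either
  way \<open>\<theta>\<close> meets \<open>\<sigma>\<close>, they cancel, and \<open>?\<nu>\<close>
  is left.\<close>

lemma \<theta>_t_mult:
  assumes "g \<in> strengthen_dom k W X"
  shows "(\<theta> T X \<star>[0] \<iota> (str1 T k W X g)) \<cdot> t_mult T 0 X X (unit T X) k W g =
    str2 T k W X (\<theta> T X \<star>[0] \<iota> g)" (is "?L \<cdot> ?\<nu> = ?R")
proof (rule whisker_K_faithful)
  let ?G = "str1 T k W X g"
  note ty = assms[simplified] X TO_Obj[OF X]
  let ?\<nu>' = "t_mult T 0 X X U k W (K \<odot>[0] g)"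
  let ?N = "(\<iota> K \<star>[0] (?L \<cdot> ?\<nu>)) \<cdot> ?\<nu>'"
  let ?M = "(\<iota> K \<star>[0] ?R) \<cdot> ?\<nu>'"
  let ?s = "str2 T k W X (\<sigma> \<star>[0] \<iota> g)"
  have a: "(K \<odot>[0] K) \<odot>[0] g = K \<odot>[0] (K \<odot>[0] g)" "(K \<odot>[0] K) \<odot>[0] ?G = K \<odot>[0] (K \<odot>[0] ?G)"
    using J.C.pcomp1_assoc[of K K g 0 0] J.C.pcomp1_assoc[of K K ?G 0 0] by (simp_all add: ty)
  have d: "Dom C (K \<odot>[0] U) = [FO J X]"
    by (simp add: ty J.C.Dom_pcomp1)
  note ty = ty d
  have "?N \<cdot> ?s = ?\<nu>"
  proof -
    have s: "?s = str2 T k W X (\<mu> \<star>[0] \<iota> g) \<cdot> str2 T k W X (str2 T 0 X X \<eta> \<star>[0] \<iota> g)"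
      by (subst str2_Vcomp'[symmetric]) (simp_all add: ty J.C.interchange)
    have "\<iota> K \<star>[0] (?L \<cdot> ?\<nu>) = (\<iota> K \<star>[0] ?L) \<cdot> (\<iota> K \<star>[0] ?\<nu>)"
      by (simp add: ty J.C.interchange)
    then have "?N \<cdot> ?s = ((\<iota> K \<star>[0] ?L) \<cdot> (\<iota> K \<star>[0] ?\<nu>) \<cdot> ?\<nu>') \<cdot>
        (str2 T k W X (\<mu> \<star>[0] \<iota> g) \<cdot> str2 T k W X (str2 T 0 X X \<eta> \<star>[0] \<iota> g))"
      unfolding s by simp
    also have "\<dots> = (\<iota> K \<star>[0] ?L) \<cdot> (((\<iota> K \<star>[0] ?\<nu>) \<cdot> (?\<nu>' \<cdot>
        str2 T k W X (\<mu> \<star>[0] \<iota> g))) \<cdot> str2 T k W X (str2 T 0 X X \<eta> \<star>[0] \<iota> g))"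
      by (rule J.C.Vcomp_assoc5'; simp add: ty a)
    also have "(\<iota> K \<star>[0] ?\<nu>) \<cdot> (?\<nu>' \<cdot> str2 T k W X (\<mu> \<star>[0] \<iota> g)) =
        (\<mu> \<star>[0] \<iota> ?G) \<cdot> t_mult T 0 X X (K \<odot>[0] U) k W g"
      using mult_assoc[of U 0 X X U 0 X g k W] by (simp add: ty)
    also have "((\<mu> \<star>[0] \<iota> ?G) \<cdot> t_mult T 0 X X (K \<odot>[0] U) k W g) \<cdot>
        str2 T k W X (str2 T 0 X X \<eta> \<star>[0] \<iota> g) =
        (\<mu> \<star>[0] \<iota> ?G) \<cdot> (t_mult T 0 X X (K \<odot>[0] U) k W g \<cdot>
        str2 T k W X (str2 T 0 X X \<eta> \<star>[0] \<iota> g))"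
      by (rule J.C.Vcomp_assoc'; simp add: ty a)
    also have "t_mult T 0 X X (K \<odot>[0] U) k W g \<cdot> str2 T k W X (str2 T 0 X X \<eta> \<star>[0] \<iota> g) =
        (str2 T 0 X X \<eta> \<star>[0] \<iota> ?G) \<cdot> ?\<nu>"
      using csquare_t_mult[of \<eta> "\<iota> g" 0 X X k W, THEN J.C.csquare_eq] by (simp add: ty str2_Id2)
    also have "(\<mu> \<star>[0] \<iota> ?G) \<cdot> ((str2 T 0 X X \<eta> \<star>[0] \<iota> ?G) \<cdot> ?\<nu>) =
        ((\<mu> \<star>[0] \<iota> ?G) \<cdot> (str2 T 0 X X \<eta> \<star>[0] \<iota> ?G)) \<cdot> ?\<nu>"
      by (rule J.C.Vcomp_assoc'[symmetric]; simp add: ty a)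
    also have "(\<mu> \<star>[0] \<iota> ?G) \<cdot> (str2 T 0 X X \<eta> \<star>[0] \<iota> ?G) = \<sigma> \<star>[0] \<iota> ?G"
      by (simp add: ty J.C.interchange)
    also have "\<iota> K \<star>[0] ?L = (\<iota> K \<star>[0] \<theta> T X) \<star>[0] \<iota> ?G"
      using J.C.pcomp2_assoc[of "\<iota> K" "\<theta> T X" "\<iota> ?G" 0 0] by (simp add: ty)
    also have "((\<iota> K \<star>[0] \<theta> T X) \<star>[0] \<iota> ?G) \<cdot> ((\<sigma> \<star>[0] \<iota> ?G) \<cdot> ?\<nu>) =
        (((\<iota> K \<star>[0] \<theta> T X) \<star>[0] \<iota> ?G) \<cdot> (\<sigma> \<star>[0] \<iota> ?G)) \<cdot> ?\<nu>"
      by (rule J.C.Vcomp_assoc'[symmetric]; simp add: ty a)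
    also have "((\<iota> K \<star>[0] \<theta> T X) \<star>[0] \<iota> ?G) \<cdot> (\<sigma> \<star>[0] \<iota> ?G) =
        ((\<iota> K \<star>[0] \<theta> T X) \<cdot> \<sigma>) \<star>[0] (\<iota> ?G \<cdot> \<iota> ?G)"
      by (rule J.C.interchange; simp add: ty)
    also have "\<dots> \<cdot> ?\<nu> = ?\<nu>"
      unfolding \<theta>_\<sigma> by (simp add: ty)
    finally show ?thesis .
  qed
  moreover have "?M \<cdot> ?s = ?\<nu>"
  proof -
    have "?M = ?\<nu> \<cdot> str2 T k W X (\<iota> K \<star>[0] (\<theta> T X \<star>[0] \<iota> g))"
      using csquare_t_mult[of "\<iota> U" "\<theta> T X \<star>[0] \<iota> g" 0 X X k W, THEN J.C.csquare_eq]
      by (simp add: ty str2_Id2)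
    also have "\<iota> K \<star>[0] (\<theta> T X \<star>[0] \<iota> g) = (\<iota> K \<star>[0] \<theta> T X) \<star>[0] \<iota> g"
      using J.C.pcomp2_assoc[of "\<iota> K" "\<theta> T X" "\<iota> g" 0 0] by (simp add: ty)
    finally have "?M \<cdot> ?s = (?\<nu> \<cdot> str2 T k W X ((\<iota> K \<star>[0] \<theta> T X) \<star>[0] \<iota> g)) \<cdot> ?s" 
      by (rule arg_cong)
    also have "\<dots> = ?\<nu> \<cdot> (str2 T k W X ((\<iota> K \<star>[0] \<theta> T X) \<star>[0] \<iota> g) \<cdot> ?s)"
      by (rule J.C.Vcomp_assoc'; simp add: ty a)
    also have "str2 T k W X ((\<iota> K \<star>[0] \<theta> T X) \<star>[0] \<iota> g) \<cdot> ?s =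
        str2 T k W X (((\<iota> K \<star>[0] \<theta> T X) \<star>[0] \<iota> g) \<cdot> (\<sigma> \<star>[0] \<iota> g))"
      by (rule str2_Vcomp'[symmetric]; simp add: ty a)
    also have "((\<iota> K \<star>[0] \<theta> T X) \<star>[0] \<iota> g) \<cdot> (\<sigma> \<star>[0] \<iota> g) =
        ((\<iota> K \<star>[0] \<theta> T X) \<cdot> \<sigma>) \<star>[0] (\<iota> g \<cdot> \<iota> g)"
      by (rule J.C.interchange; simp add: ty)
    also have "?\<nu> \<cdot> str2 T k W X \<dots> = ?\<nu>"
      unfolding \<theta>_\<sigma> by (simp add: ty str2_Id2)
    finally show ?thesis .
  qed
  ultimately have e: "?N \<cdot> ?s = ?M \<cdot> ?s"
    by (rule trans_sym)
  have "?N = ?M"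
    by (rule J.C.cancel_right[OF _ _ _ _ _ e]) (simp_all add: ty a)
  then show "\<iota> K \<star>[0] (?L \<cdot> ?\<nu>) = \<iota> K \<star>[0] ?R"
    by (rule J.C.cancel_right[rotated 5]) (simp_all add: ty a)
qed (simp_all add: assms[simplified] X TO_Obj[OF X])

text \<open>Exchanging \<open>\<theta>\<close> with itself and cancelling one copy shows that
  whiskering \<open>\<theta>\<close> with \<open>K\<close> on either side gives the same cell. Hence
  \<open>mult_unit\<close> also holds with \<open>\<theta>\<close> on the outer factor, and by
  \<open>\<theta>_t_mult\<close> this is the strengthening of the claim; strengthening is
  faithful.\<close>

lemma \<theta>_t_unit: "(\<theta> T X \<star>[0] \<iota> U) \<cdot> \<eta> = \<iota> U"
proof -
  have s: "U \<in> strengthen_dom 0 X X" using X by simp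
  have "(\<theta> T X \<star>[0] \<iota> K) = (\<iota> K \<star>[0] \<theta> T X)"
    by (rule J.C.cancel_left[of "\<theta> T X"])
      (use whisker_exchange[of "\<theta> T X" "\<theta> T X" 0] X TO_Obj[OF X] in simp_all)
  then have "(\<theta> T X \<star>[0] \<iota> K) \<cdot> \<sigma> = \<iota> K"
    using \<theta>_\<sigma> by simp
  moreover have "(\<theta> T X \<star>[0] \<iota> K) \<cdot> \<sigma> = ((\<theta> T X \<star>[0] \<iota> K) \<cdot> \<mu>) \<cdot> str2 T 0 X X \<eta>"
    by (rule J.C.Vcomp_assoc'[symmetric]) (use X in simp_all)
  ultimately have "str2 T 0 X X (\<theta> T X \<star>[0] \<iota> U) \<cdot> str2 T 0 X X \<eta> = \<iota> K"
    using \<theta>_t_mult[OF s] by simp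
  then have "str2 T 0 X X ((\<theta> T X \<star>[0] \<iota> U) \<cdot> \<eta>) = str2 T 0 X X (\<iota> U)"
    using X TO_Obj[OF X] by (simp add: str2_Id2)
  then show ?thesis
    by (rule str2_faithful[rotated 5]) (simp_all add: X TO_Obj[OF X])
qed

end

section \<open>The composition cells\<close>

text \<open>
  \<open>J_arrow Ws X g\<close> says that \<open>g\<close> has the type of some \<open>J g'\<close>, and \<open>lift1 Ws X (J g')\<close> is \<open>T g'\<close>. Only the
  type of \<open>J g'\<close> matters until \<open>J\<close> is assumed to be multicategorical.
\<close>

definition J_arrow :: "'x list \<Rightarrow> 'x \<Rightarrow> 'm \<Rightarrow> bool" where
  J_arrow_def [simp]: "J_arrow Ws X g \<longleftrightarrow> g \<in> Mor C \<and> Dom C g = map (FO J) Ws \<and> Cod C g = FO J X \<and>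
     set Ws \<subseteq> Obj D \<and> X \<in> Obj D"

definition lift1 :: "'x list \<Rightarrow> 'x \<Rightarrow> 'm \<Rightarrow> 'm" where
  "lift1 Ws X g = strs 0 Ws X (unit T X \<odot>[0] g)"

definition lift2 :: "'x list \<Rightarrow> 'x \<Rightarrow> 'c \<Rightarrow> 'c" where
  "lift2 Ws X \<beta> = strs2 0 Ws X (\<iota> (unit T X) \<star>[0] \<beta>)"

text \<open>The part of the composition cell that is not pseudonaturality. It runs from
  \<open>A \<odot>[j] g\<close>, strengthened along \<open>Ws\<close>, to
  \<open>str1 T j X Y A \<odot>[j] lift1 Ws X g\<close>; the other arguments of \<open>A\<close> are
  left alone.\<close>

definition t_unit_mults :: "nat \<Rightarrow> 'x \<Rightarrow> 'x \<Rightarrow> 'm \<Rightarrow> 'x list \<Rightarrow> 'm \<Rightarrow> 'c" where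
  "t_unit_mults j X Y A Ws g = t_mults j X Y A 0 Ws (unit T X \<odot>[0] g) \<cdot>
     strs2 j Ws Y (t_unit T j X Y A \<star>[j] \<iota> g)"

lemma block_pcomp_J_arrow [simp]:
  assumes "F \<in> Mor C" "j < length (Dom C F)" "Cod C F = TO T Y" "Y \<in> Obj D"
    "g \<in> Mor C" "Dom C g = map (FO J) Ws" "set Ws \<subseteq> Obj D" "Cod C g = Dom C F ! j"
  shows "block j Ws Y (F \<odot>[j] g)"
proof -
  have "Dom C (F \<odot>[j] g) ! (j + i) = FO J (Ws ! i)" if "i < length Ws" for i
    using that assms J.C.nth_Dom_pcomp1(2)[of F g j i] by simp
  then show ?thesis
    using assms by (auto simp: block_def)
qed

lemma block_pcomp_str1_0 [simp]:
  "\<lbrakk>f \<in> strengthen_dom j X Y; block 0 Ws X g\<rbrakk> \<Longrightarrow> block j Ws Y (str1 T j X Y f \<odot>[j] g)"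
  using block_pcomp_str1[of f j X Y 0 Ws g] by simp

lemma block_unit_pcomp [simp]: "J_arrow Ws X g \<Longrightarrow> block 0 Ws X (unit T X \<odot>[0] g)"
  by simp

lemma lift1_simps [simp]:
  assumes "J_arrow Ws X g"
  shows "lift1 Ws X g \<in> Mor C" "Cod C (lift1 Ws X g) = TO T X" "Dom C (lift1 Ws X g) = map (TO T) Ws"
proof -
  show "lift1 Ws X g \<in> Mor C" "Cod C (lift1 Ws X g) = TO T X"
    using assms by (simp_all add: lift1_def)
  have l: "length (Dom C (lift1 Ws X g)) = length Ws"
    using assms by (simp add: lift1_def)
  then show "Dom C (lift1 Ws X g) = map (TO T) Ws"
    using assms nth_Dom_strs_in[of 0 Ws X "unit T X \<odot>[0] g"] by (intro nth_equalityI) (simp_all add: lift1_def)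
qed

lemma lift2_simps [simp]:
  assumes "\<beta> \<in> Cell C" "J_arrow Ws X (Src C \<beta>)"
  shows "lift2 Ws X \<beta> \<in> Cell C" "Src C (lift2 Ws X \<beta>) = lift1 Ws X (Src C \<beta>)"
    "Tgt C (lift2 Ws X \<beta>) = lift1 Ws X (Tgt C \<beta>)"
  using assms by (simp_all add: lift1_def lift2_def)

lemma lift2_Id2 [simp]: "J_arrow Ws X g \<Longrightarrow> lift2 Ws X (\<iota> g) = \<iota> (lift1 Ws X g)"
  by (simp add: lift2_def lift1_def)

lemma pcomp_unit_assoc [simp]:
  assumes "F \<in> Mor C" "j < length (Dom C F)" "Dom C F ! j = TO T X" "X \<in> Obj D"
    "g \<in> Mor C" "Cod C g = FO J X"
  shows "(F \<odot>[j] unit T X) \<odot>[j] g = F \<odot>[j] (unit T X \<odot>[0] g)"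
  using J.C.pcomp1_assoc[of F "unit T X" g j 0] assms by simp

lemma t_unit_mults_typing:
  assumes "A \<in> strengthen_dom j X Y" "J_arrow Ws X g"
  shows "J.C.invertible (t_unit_mults j X Y A Ws g) \<and> Src C (t_unit_mults j X Y A Ws g) = strs j Ws Y (A \<odot>[j] g) \<and>
    Tgt C (t_unit_mults j X Y A Ws g) = str1 T j X Y A \<odot>[j] lift1 Ws X g"
  using assms by (simp add: t_unit_mults_def lift1_def)

lemma t_unit_mults_simps [simp]:
  assumes "A \<in> strengthen_dom j X Y" "J_arrow Ws X g"
  shows "J.C.invertible (t_unit_mults j X Y A Ws g)" "Src C (t_unit_mults j X Y A Ws g) = strs j Ws Y (A \<odot>[j] g)"
    "Tgt C (t_unit_mults j X Y A Ws g) = str1 T j X Y A \<odot>[j] lift1 Ws X g"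
  using t_unit_mults_typing[OF assms] by auto

lemma csquare_t_unit:
  assumes "\<alpha> \<in> Cell C" "Src C \<alpha> \<in> strengthen_dom j X Y"
  shows "J.C.csquare (t_unit T j X Y (Src C \<alpha>)) (str2 T j X Y \<alpha> \<star>[j] \<iota> (unit T X)) \<alpha> (t_unit T j X Y (Tgt C \<alpha>))"
proof -
  have "(str2 T j X Y \<alpha> \<star>[j] \<iota> (unit T X)) \<cdot> t_unit T j X Y (Src C \<alpha>) = t_unit T j X Y (Tgt C \<alpha>) \<cdot> \<alpha>"
    by (rule t_unit_natural) (use assms in \<open>simp_all add: cells_def\<close>)
  then show ?thesis
    using assms by (simp add: J.C.csquare_def)
qed

lemma csquare_t_unit_mults:
  assumes "\<alpha> \<in> Cell C" "\<beta> \<in> Cell C" "Src C \<alpha> \<in> strengthen_dom j X Y" "J_arrow Ws X (Src C \<beta>)"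
  shows "J.C.csquare (t_unit_mults j X Y (Src C \<alpha>) Ws (Src C \<beta>)) (str2 T j X Y \<alpha> \<star>[j] lift2 Ws X \<beta>)
    (strs2 j Ws Y (\<alpha> \<star>[j] \<beta>)) (t_unit_mults j X Y (Tgt C \<alpha>) Ws (Tgt C \<beta>))"
proof -
  note ty = assms[simplified]
  have "J.C.csquare (t_unit T j X Y (Src C \<alpha>) \<star>[j] \<iota> (Src C \<beta>))
      ((str2 T j X Y \<alpha> \<star>[j] \<iota> (unit T X)) \<star>[j] \<beta>) (\<alpha> \<star>[j] \<beta>)
      (t_unit T j X Y (Tgt C \<alpha>) \<star>[j] \<iota> (Tgt C \<beta>))"
    by (rule J.C.csquare_pcomp2[OF csquare_t_unit J.C.csquare_Id2_h]) (simp_all add: ty)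
  also have "(str2 T j X Y \<alpha> \<star>[j] \<iota> (unit T X)) \<star>[j] \<beta> = str2 T j X Y \<alpha> \<star>[j] (\<iota> (unit T X) \<star>[0] \<beta>)"
    using J.C.pcomp2_assoc[of "str2 T j X Y \<alpha>" "\<iota> (unit T X)" \<beta> j 0] by (simp add: ty)
  finally have "J.C.csquare (strs2 j Ws Y (t_unit T j X Y (Src C \<alpha>) \<star>[j] \<iota> (Src C \<beta>)))
      (strs2 j Ws Y (str2 T j X Y \<alpha> \<star>[j] (\<iota> (unit T X) \<star>[0] \<beta>))) (strs2 j Ws Y (\<alpha> \<star>[j] \<beta>))
      (strs2 j Ws Y (t_unit T j X Y (Tgt C \<alpha>) \<star>[j] \<iota> (Tgt C \<beta>)))"
    by (rule csquare_strs2) (simp add: ty)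
  moreover have "J.C.csquare (t_mults j X Y (Src C \<alpha>) 0 Ws (unit T X \<odot>[0] Src C \<beta>))
      (str2 T j X Y \<alpha> \<star>[j] lift2 Ws X \<beta>) (strs2 j Ws Y (str2 T j X Y \<alpha> \<star>[j] (\<iota> (unit T X) \<star>[0] \<beta>)))
      (t_mults j X Y (Tgt C \<alpha>) 0 Ws (unit T X \<odot>[0] Tgt C \<beta>))"
    using csquare_t_mults[of \<alpha> "\<iota> (unit T X) \<star>[0] \<beta>" j X Y 0 Ws] by (simp add: ty lift2_def)
  ultimately show ?thesis
    unfolding t_unit_mults_def by (rule J.C.csquare_hpaste)
qed

text \<open>The units inserted for \<open>q\<close> and for
  \<open>str1 T j X Y f \<odot>[j] q\<close> differ by a \<open>t_mult\<close>, which is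
  \<open>t_unit_pcomp\<close>. That \<open>t_mult\<close> is the edge along which
  \<open>csquare_t_mults_assoc\<close> is then pasted.\<close>

lemma csquare_t_mults_t_unit_mults:
  assumes "f \<in> strengthen_dom j X Y" "q \<in> strengthen_dom k W X" "J_arrow Vs W h"
  shows "J.C.csquare (t_mults j X Y f k Vs (q \<odot>[k] h)) (\<iota> (str1 T j X Y f) \<star>[j] t_unit_mults k W X q Vs h)
    (t_unit_mults (j + k) W Y (str1 T j X Y f \<odot>[j] q) Vs h) (t_mult T j X Y f k W q \<star>[j + k] \<iota> (lift1 Vs W h))"
proof -
  let ?F = "str1 T j X Y f" and ?u = "unit T W \<odot>[0] h" and ?t = "t_mult T j X Y f k W q"
  let ?Q = "str1 T k W X q" and ?S = "strs2 (j + k) Vs Y"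
  note ty = assms[simplified]
  have a: "(?F \<odot>[j] q) \<odot>[j + k] h = ?F \<odot>[j] (q \<odot>[k] h)"
    "(?F \<odot>[j] ?Q) \<odot>[j + k] unit T W = ?F \<odot>[j] (?Q \<odot>[k] unit T W)"
    "(?F \<odot>[j] ?Q) \<odot>[j + k] ?u = ?F \<odot>[j] (?Q \<odot>[k] ?u)"
    by (simp_all add: J.C.pcomp1_assoc ty)
  have b: "block (j + k) Vs Y (?F \<odot>[j] (q \<odot>[k] h))" "block (j + k) Vs Y (?F \<odot>[j] (?Q \<odot>[k] ?u))"
    by (rule block_pcomp_str1; simp add: ty)+
  let ?tu = "t_unit T (j + k) W Y (?F \<odot>[j] q)"
  have "\<iota> ?F \<star>[j] (t_unit T k W X q \<star>[k] \<iota> h) = (\<iota> ?F \<star>[j] t_unit T k W X q) \<star>[j + k] \<iota> h"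
    by (rule J.C.pcomp2_assoc[symmetric]) (simp_all add: ty)
  also have "\<dots> = ((?t \<star>[j + k] \<iota> (unit T W)) \<cdot> ?tu) \<star>[j + k] (\<iota> h \<cdot> \<iota> h)"
    unfolding t_unit_pcomp[OF assms(1,2)] by (simp add: ty)
  also have "\<dots> = ((?t \<star>[j + k] \<iota> (unit T W)) \<star>[j + k] \<iota> h) \<cdot> (?tu \<star>[j + k] \<iota> h)"
    by (rule J.C.interchange[symmetric]) (simp_all add: ty)
  also have "(?t \<star>[j + k] \<iota> (unit T W)) \<star>[j + k] \<iota> h = ?t \<star>[j + k] \<iota> ?u"
    using J.C.pcomp2_assoc[of ?t "\<iota> (unit T W)" "\<iota> h" "j + k" 0] by (simp add: ty)
  finally have e: "\<iota> ?F \<star>[j] (t_unit T k W X q \<star>[k] \<iota> h) = (?t \<star>[j + k] \<iota> ?u) \<cdot> (?tu \<star>[j + k] \<iota> h)" .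
  have e2: "?S (\<iota> ?F \<star>[j] (t_unit T k W X q \<star>[k] \<iota> h)) = ?S (?t \<star>[j + k] \<iota> ?u) \<cdot> ?S (?tu \<star>[j + k] \<iota> h)"
    unfolding e by (rule strs2_Vcomp) (simp_all add: ty)
  have n: "J.C.csquare (t_mults j X Y f k Vs (q \<odot>[k] h)) (\<iota> ?F \<star>[j] strs2 k Vs X (t_unit T k W X q \<star>[k] \<iota> h))
     (?S (?t \<star>[j + k] \<iota> ?u) \<cdot> ?S (?tu \<star>[j + k] \<iota> h)) (t_mults j X Y f k Vs (?Q \<odot>[k] ?u))"
    using csquare_t_mults[of "\<iota> f" "t_unit T k W X q \<star>[k] \<iota> h" j X Y k Vs] unfolding e2[symmetric]
    by (simp add: ty str2_Id2)
  have "J.C.csquare (?S (?t \<star>[j + k] \<iota> ?u))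
     ((\<iota> ?F \<star>[j] t_mults k W X q 0 Vs ?u) \<cdot> t_mults j X Y f k Vs (?Q \<odot>[k] ?u))
     (t_mults (j + k) W Y (?F \<odot>[j] q) 0 Vs ?u) (?t \<star>[j + k] \<iota> (lift1 Vs W h))"
    using csquare_t_mults_assoc[of f j X Y q k W 0 Vs ?u] by (simp add: ty lift1_def)
  then have m2: "J.C.csquare (t_mults j X Y f k Vs (?Q \<odot>[k] ?u) \<cdot> ?S (?t \<star>[j + k] \<iota> ?u))
     (\<iota> ?F \<star>[j] t_mults k W X q 0 Vs ?u)
     (t_mults (j + k) W Y (?F \<odot>[j] q) 0 Vs ?u) (?t \<star>[j + k] \<iota> (lift1 Vs W h))"
    by (rule J.C.csquare_shift) (simp_all add: ty a)
  \<comment> \<open>In \<open>n\<close> the cell \<open>?t\<close> sits on the left edge, while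
    pasting with \<open>m2\<close> needs it on the common horizontal edge; hence a shift across a
    corner between two transpositions.\<close>
  have n2: "J.C.csquare (t_mults j X Y f k Vs (q \<odot>[k] h)) (\<iota> ?F \<star>[j] strs2 k Vs X (t_unit T k W X q \<star>[k] \<iota> h))
     (?S (?tu \<star>[j + k] \<iota> h)) (t_mults j X Y f k Vs (?Q \<odot>[k] ?u) \<cdot> ?S (?t \<star>[j + k] \<iota> ?u))"
    by (rule J.C.csquare_transpose, rule J.C.csquare_unshift, rule J.C.csquare_transpose, rule n) (simp_all add: ty a b)
  have r: "(\<iota> ?F \<star>[j] t_mults k W X q 0 Vs ?u) \<cdot> (\<iota> ?F \<star>[j] strs2 k Vs X (t_unit T k W X q \<star>[k] \<iota> h)) =
     \<iota> ?F \<star>[j] t_unit_mults k W X q Vs h"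
    by (simp add: ty t_unit_mults_def J.C.interchange)
  from J.C.csquare_vpaste[OF n2 m2] show ?thesis
    unfolding r t_unit_mults_def[of "j + k"] .
qed

text \<open>Unless \<open>Xs\<close> is empty, \<open>p\<close> lies before
  \<open>p + length Xs\<close> and is not shifted; for empty \<open>Xs\<close> the position is
  ignored.\<close>

lemma shift_self_simps [simp]:
  "strs (shift (p + length Xs) m p) Xs = strs p Xs"
  "strs2 (shift (p + length Xs) m p) Xs = strs2 p Xs"
  "strs_nat (shift (p + length Xs) m p) Xs = strs_nat p Xs"
  "t_mults j X Y f (shift (p + length Xs) m p) Xs = t_mults j X Y f p Xs"
  "strs (i + shift (p + length Xs) m p) Xs = strs (i + p) Xs"
  by (cases Xs; auto simp: shift_def fun_eq_iff)+

lemma block_pcomp_before [simp]: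
  assumes "block p Xs Y f" "p + length Xs < length (Dom C f)" "g \<in> Mor C" "Cod C g = Dom C f ! (p + length Xs)"
  shows "block p Xs Y (f \<odot>[p + length Xs] g)"
proof (cases Xs)
  case Nil
  then show ?thesis using assms by auto
next
  case (Cons X Xs')
  then have "shift (p + length Xs) (length (Dom C g)) p = p" by (simp add: shift_def)
  then show ?thesis using block_pcomp_out[OF assms(1) _ assms(2-4) refl] by simp
qed

lemma block_pcomp_after [simp]:
  assumes "block (Suc k) Xs Y f" "k < length (Dom C f)" "g \<in> Mor C" "Cod C g = Dom C f ! k"
    "m = length (Dom C g)"
  shows "block (k + m) Xs Y (f \<odot>[k] g)"
  using block_pcomp_out[OF assms(1) _ assms(2-5)] by simp

text \<open>All of the composition cell except the trailing arguments. It is kept apart because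
  squares about it are established first and then strengthened along the trailing run as a
  whole.\<close>

definition comp_cell_pre :: "nat \<Rightarrow> 'x list \<Rightarrow> 'x \<Rightarrow> 'x \<Rightarrow> 'm \<Rightarrow> 'x list \<Rightarrow> 'm \<Rightarrow> 'c" where
  "comp_cell_pre p Xs X Y P Ws g = t_unit_mults (p + length Xs) X Y (strs p Xs Y P) Ws g \<cdot>
     strs2 (p + length Xs) Ws Y (strs_nat p Xs Y P (p + length Xs) g)"

text \<open>The pseudo-multifunctor takes \<open>p = 0\<close> and \<open>P = i \<circ> J f\<close>.
  The general form is for associativity, where the same construction for \<open>h\<close> occurs
  inside larger arrows such as \<open>str1 T j X Y f \<odot>[j] q\<close>, at a later run of
  arguments.\<close>

definition comp_cell :: "nat \<Rightarrow> 'x list \<Rightarrow> 'x \<Rightarrow> 'x list \<Rightarrow> 'x \<Rightarrow> 'm \<Rightarrow> 'x list \<Rightarrow> 'm \<Rightarrow> 'c" where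
  "comp_cell p Xs X Xs' Y P Ws g =
     strs_nat (Suc (p + length Xs)) Xs' Y (str1 T (p + length Xs) X Y (strs p Xs Y P)) (p + length Xs) (lift1 Ws X g) \<cdot>
     strs2 (p + length Xs + length Ws) Xs' Y (comp_cell_pre p Xs X Y P Ws g)"

lemma comp_cell_pre_simps [simp]:
  assumes "block p Xs Y P" "P \<in> strengthen_dom (p + length Xs) X Y" "J_arrow Ws X g"
  shows "J.C.invertible (comp_cell_pre p Xs X Y P Ws g)"
    "Src C (comp_cell_pre p Xs X Y P Ws g) = strs (p + length Xs) Ws Y (strs p Xs Y (P \<odot>[p + length Xs] g))"
    "Tgt C (comp_cell_pre p Xs X Y P Ws g) = str1 T (p + length Xs) X Y (strs p Xs Y P) \<odot>[p + length Xs] lift1 Ws X g"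
  unfolding comp_cell_pre_def using assms by simp_all

lemma comp_cell_simps [simp]:
  assumes "block p Xs Y P" "P \<in> strengthen_dom (p + length Xs) X Y" "block (Suc (p + length Xs)) Xs' Y P" "J_arrow Ws X g"
  shows "J.C.invertible (comp_cell p Xs X Xs' Y P Ws g)"
    "Src C (comp_cell p Xs X Xs' Y P Ws g) = strs (p + length Xs + length Ws) Xs' Y
       (strs (p + length Xs) Ws Y (strs p Xs Y (P \<odot>[p + length Xs] g)))"
    "Tgt C (comp_cell p Xs X Xs' Y P Ws g) = strs (Suc (p + length Xs)) Xs' Y
       (str1 T (p + length Xs) X Y (strs p Xs Y P)) \<odot>[p + length Xs] lift1 Ws X g"
  unfolding comp_cell_def using assms by simp_all

section \<open>Naturality of the composition cells\<close>

lemma csquare_comp_cell_pre: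
  assumes "\<alpha> \<in> Cell C" "\<beta> \<in> Cell C" "block p Xs Y (Src C \<alpha>)" "Src C \<alpha> \<in> strengthen_dom (p + length Xs) X Y"
    "J_arrow Ws X (Src C \<beta>)"
  shows "J.C.csquare (comp_cell_pre p Xs X Y (Src C \<alpha>) Ws (Src C \<beta>))
    (str2 T (p + length Xs) X Y (strs2 p Xs Y \<alpha>) \<star>[p + length Xs] lift2 Ws X \<beta>)
    (strs2 (p + length Xs) Ws Y (strs2 p Xs Y (\<alpha> \<star>[p + length Xs] \<beta>)))
    (comp_cell_pre p Xs X Y (Tgt C \<alpha>) Ws (Tgt C \<beta>))"
proof -
  note ty = assms[simplified]
  let ?j = "p + length Xs"
  have "J.C.csquare (strs_nat p Xs Y (Src C \<alpha>) ?j (Src C \<beta>)) (strs2 p Xs Y \<alpha> \<star>[?j] \<beta>)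
      (strs2 p Xs Y (\<alpha> \<star>[?j] \<beta>)) (strs_nat p Xs Y (Tgt C \<alpha>) ?j (Tgt C \<beta>))"
    using csquare_strs_nat[of \<alpha> \<beta> p Xs Y ?j] by (simp add: ty)
  then have "J.C.csquare (strs2 ?j Ws Y (strs_nat p Xs Y (Src C \<alpha>) ?j (Src C \<beta>)))
      (strs2 ?j Ws Y (strs2 p Xs Y \<alpha> \<star>[?j] \<beta>))
      (strs2 ?j Ws Y (strs2 p Xs Y (\<alpha> \<star>[?j] \<beta>))) (strs2 ?j Ws Y (strs_nat p Xs Y (Tgt C \<alpha>) ?j (Tgt C \<beta>)))"
    by (rule csquare_strs2) (simp add: ty)
  moreover have "J.C.csquare (t_unit_mults ?j X Y (strs p Xs Y (Src C \<alpha>)) Ws (Src C \<beta>))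
      (str2 T ?j X Y (strs2 p Xs Y \<alpha>) \<star>[?j] lift2 Ws X \<beta>) (strs2 ?j Ws Y (strs2 p Xs Y \<alpha> \<star>[?j] \<beta>))
      (t_unit_mults ?j X Y (strs p Xs Y (Tgt C \<alpha>)) Ws (Tgt C \<beta>))"
    using csquare_t_unit_mults[of "strs2 p Xs Y \<alpha>" \<beta> ?j X Y Ws] by (simp add: ty)
  ultimately show ?thesis
    unfolding comp_cell_pre_def by (rule J.C.csquare_hpaste)
qed

lemma csquare_comp_cell:
  assumes "\<alpha> \<in> Cell C" "\<beta> \<in> Cell C" "block p Xs Y (Src C \<alpha>)" "Src C \<alpha> \<in> strengthen_dom (p + length Xs) X Y"
    "block (Suc (p + length Xs)) Xs' Y (Src C \<alpha>)" "J_arrow Ws X (Src C \<beta>)"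
  shows "J.C.csquare (comp_cell p Xs X Xs' Y (Src C \<alpha>) Ws (Src C \<beta>))
    (strs2 (Suc (p + length Xs)) Xs' Y (str2 T (p + length Xs) X Y (strs2 p Xs Y \<alpha>))
      \<star>[p + length Xs] lift2 Ws X \<beta>)
    (strs2 (p + length Xs + length Ws) Xs' Y
      (strs2 (p + length Xs) Ws Y (strs2 p Xs Y (\<alpha> \<star>[p + length Xs] \<beta>))))
    (comp_cell p Xs X Xs' Y (Tgt C \<alpha>) Ws (Tgt C \<beta>))"
proof -
  note ty = assms[simplified]
  let ?j = "p + length Xs"
  let ?S = "strs2 (?j + length Ws) Xs' Y"
  have "J.C.csquare (?S (comp_cell_pre p Xs X Y (Src C \<alpha>) Ws (Src C \<beta>)))
      (?S (str2 T ?j X Y (strs2 p Xs Y \<alpha>) \<star>[?j] lift2 Ws X \<beta>))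
      (?S (strs2 ?j Ws Y (strs2 p Xs Y (\<alpha> \<star>[?j] \<beta>)))) (?S (comp_cell_pre p Xs X Y (Tgt C \<alpha>) Ws (Tgt C \<beta>)))"
    by (rule csquare_strs2[OF csquare_comp_cell_pre]) (simp_all add: ty)
  moreover have "J.C.csquare
      (strs_nat (Suc ?j) Xs' Y (str1 T ?j X Y (strs p Xs Y (Src C \<alpha>))) ?j (lift1 Ws X (Src C \<beta>)))
      (strs2 (Suc ?j) Xs' Y (str2 T ?j X Y (strs2 p Xs Y \<alpha>)) \<star>[?j] lift2 Ws X \<beta>)
      (?S (str2 T ?j X Y (strs2 p Xs Y \<alpha>) \<star>[?j] lift2 Ws X \<beta>))
      (strs_nat (Suc ?j) Xs' Y (str1 T ?j X Y (strs p Xs Y (Tgt C \<alpha>))) ?j (lift1 Ws X (Tgt C \<beta>)))"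
    using csquare_strs_nat[of "str2 T ?j X Y (strs2 p Xs Y \<alpha>)" "lift2 Ws X \<beta>" "Suc ?j" Xs' Y ?j] by (simp add: ty)
  ultimately show ?thesis
    unfolding comp_cell_def by (rule J.C.csquare_hpaste)
qed

section \<open>Composition cells inside a strengthened argument\<close>

lemma csquare_t_mults_comp_cell_pre:
  assumes "f \<in> strengthen_dom j X Y" "block k Ws X q" "q \<in> strengthen_dom (k + length Ws) W X" "J_arrow Vs W h"
  shows "J.C.csquare (t_mults j X Y f (k + length Ws) Vs (strs k Ws X (q \<odot>[k + length Ws] h)) \<cdot>
      strs2 (j + (k + length Ws)) Vs Y (t_mults j X Y f k Ws (q \<odot>[k + length Ws] h)))
    (\<iota> (str1 T j X Y f) \<star>[j] comp_cell_pre k Ws W X q Vs h)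
    (comp_cell_pre (j + k) Ws W Y (str1 T j X Y f \<odot>[j] q) Vs h)
    ((t_mult T j X Y f (k + length Ws) W (strs k Ws X q) \<cdot>
      str2 T (j + (k + length Ws)) W Y (t_mults j X Y f k Ws q)) \<star>[j + (k + length Ws)] \<iota> (lift1 Vs W h))"
proof -
  let ?F = "str1 T j X Y f" and ?k = "k + length Ws" and ?q = "strs k Ws X q"
  let ?S = "strs2 (j + (k + length Ws)) Vs Y"
  note ty = assms[simplified]
  have b: "block (j + ?k) Vs Y (?F \<odot>[j] (q \<odot>[?k] h))"
    by (rule block_pcomp_str1) (simp_all add: ty)
  have c1: "J.C.csquare (t_mults j X Y f k Ws (q \<odot>[?k] h)) (\<iota> ?F \<star>[j] strs_nat k Ws X q ?k h)
      (strs_nat (j + k) Ws Y (?F \<odot>[j] q) (j + ?k) h) (t_mults j X Y f k Ws q \<star>[j + ?k] \<iota> h)"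
    using csquare_t_mults_inner[of f j X Y k Ws q ?k h] by (simp add: ty)
  have c1': "J.C.csquare (?S (t_mults j X Y f k Ws (q \<odot>[?k] h))) (?S (\<iota> ?F \<star>[j] strs_nat k Ws X q ?k h))
      (?S (strs_nat (j + k) Ws Y (?F \<odot>[j] q) (j + ?k) h)) (?S (t_mults j X Y f k Ws q \<star>[j + ?k] \<iota> h))"
    by (rule csquare_strs2[OF c1]) (simp add: ty b)
  have c2: "J.C.csquare (t_mults j X Y f ?k Vs (strs k Ws X (q \<odot>[?k] h)))
      (\<iota> ?F \<star>[j] strs2 ?k Vs X (strs_nat k Ws X q ?k h)) (?S (\<iota> ?F \<star>[j] strs_nat k Ws X q ?k h))
      (t_mults j X Y f ?k Vs (?q \<odot>[?k] h))"
    using csquare_t_mults[of "\<iota> f" "strs_nat k Ws X q ?k h" j X Y ?k Vs] by (simp add: ty str2_Id2)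
  have c3: "J.C.csquare (t_mults j X Y f ?k Vs (?q \<odot>[?k] h)) (\<iota> ?F \<star>[j] t_unit_mults ?k W X ?q Vs h)
      (t_unit_mults (j + ?k) W Y (?F \<odot>[j] ?q) Vs h) (t_mult T j X Y f ?k W ?q \<star>[j + ?k] \<iota> (lift1 Vs W h))"
    by (rule csquare_t_mults_t_unit_mults) (simp_all add: ty)
  have c4: "J.C.csquare (t_unit_mults (j + ?k) W Y (strs (j + k) Ws Y (?F \<odot>[j] q)) Vs h)
      (str2 T (j + ?k) W Y (t_mults j X Y f k Ws q) \<star>[j + ?k] \<iota> (lift1 Vs W h))
      (?S (t_mults j X Y f k Ws q \<star>[j + ?k] \<iota> h)) (t_unit_mults (j + ?k) W Y (?F \<odot>[j] ?q) Vs h)"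
    using csquare_t_unit_mults[of "t_mults j X Y f k Ws q" "\<iota> h" "j + ?k" W Y Vs] by (simp add: ty)
  have e1: "(\<iota> ?F \<star>[j] t_unit_mults ?k W X ?q Vs h) \<cdot> (\<iota> ?F \<star>[j] strs2 ?k Vs X (strs_nat k Ws X q ?k h)) =
      \<iota> ?F \<star>[j] comp_cell_pre k Ws W X q Vs h"
    by (simp add: ty comp_cell_pre_def J.C.interchange)
  have e2: "t_unit_mults (j + ?k) W Y (strs (j + k) Ws Y (?F \<odot>[j] q)) Vs h \<cdot>
      ?S (strs_nat (j + k) Ws Y (?F \<odot>[j] q) (j + ?k) h) = comp_cell_pre (j + k) Ws W Y (?F \<odot>[j] q) Vs h"
    by (simp add: comp_cell_pre_def add.assoc)
  have e3: "(t_mult T j X Y f ?k W ?q \<star>[j + ?k] \<iota> (lift1 Vs W h)) \<cdot>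
      (str2 T (j + ?k) W Y (t_mults j X Y f k Ws q) \<star>[j + ?k] \<iota> (lift1 Vs W h)) =
      (t_mult T j X Y f ?k W ?q \<cdot> str2 T (j + ?k) W Y (t_mults j X Y f k Ws q)) \<star>[j + ?k]
      (\<iota> (lift1 Vs W h) \<cdot> \<iota> (lift1 Vs W h))"
    by (rule J.C.interchange) (simp_all add: ty)
  have e4: "\<iota> (lift1 Vs W h) \<cdot> \<iota> (lift1 Vs W h) = \<iota> (lift1 Vs W h)"
    by (simp add: ty)
  \<comment> \<open>A two-by-two grid. The upper row is compatibility of \<open>t_mults\<close> with
    pseudonaturality, strengthened along \<open>Vs\<close>, and naturality of
    \<open>t_mults\<close>; the lower row is naturality of \<open>t_unit_mults\<close> and the
    square that rests on \<open>mult_assoc\<close>.\<close>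
  from J.C.csquare_vpaste[OF J.C.csquare_hpaste[OF c1' c2] J.C.csquare_hpaste[OF J.C.csquare_transpose[OF c4] c3]]
  show ?thesis
    unfolding e1 e2 e3 e4 .
qed

text \<open>The one step of the associativity law that is not naturality or bookkeeping.\<close>

lemma csquare_t_mults_comp_cell:
  assumes "f \<in> strengthen_dom j X Y" "block k Ws X q" "q \<in> strengthen_dom (k + length Ws) W X"
    "block (Suc (k + length Ws)) Ws' X q" "J_arrow Vs W h"
  shows "J.C.csquare (t_mults j X Y f k (Ws @ Vs @ Ws') (q \<odot>[k + length Ws] h))
    (\<iota> (str1 T j X Y f) \<star>[j] comp_cell k Ws W Ws' X q Vs h)
    (comp_cell (j + k) Ws W Ws' Y (str1 T j X Y f \<odot>[j] q) Vs h)
    (t_mults j X Y f k (Ws @ W # Ws') q \<star>[j + (k + length Ws)] \<iota> (lift1 Vs W h))"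
proof -
  let ?F = "str1 T j X Y f" and ?k = "k + length Ws" and ?q = "strs k Ws X q"
  let ?Q = "str1 T ?k W X ?q" and ?E = "lift1 Vs W h" and ?u = "comp_cell_pre k Ws W X q Vs h"
  let ?S = "strs2 (j + ?k + length Vs) Ws' Y"
  let ?m = "t_mult T j X Y f ?k W ?q \<cdot> str2 T (j + ?k) W Y (t_mults j X Y f k Ws q)"
  let ?top = "t_mults j X Y f ?k Vs (strs k Ws X (q \<odot>[?k] h)) \<cdot> strs2 (j + ?k) Vs Y (t_mults j X Y f k Ws (q \<odot>[?k] h))"
  note ty = assms[simplified]
  have b: "block (j + ?k) Vs Y (?F \<odot>[j] (q \<odot>[?k] h))" "block (j + k) Ws Y (?F \<odot>[j] (q \<odot>[?k] h))"
    by (rule block_pcomp_str1; simp add: ty)+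
  have b': "block (j + (?k + length Vs)) Ws' Y (?F \<odot>[j] (q \<odot>[?k] h))"
    by (rule block_pcomp_str1; simp add: ty)
  have bq: "block (?k + length Vs) Ws' X (q \<odot>[?k] h)"
    by (simp add: ty)
  have b'': "block (j + ?k + length Vs) Ws' Y (?F \<odot>[j] (q \<odot>[?k] h))"
    using b' by (simp only: add.assoc)
  have b2: "block (Suc (j + ?k)) Ws' Y (?F \<odot>[j] q)"
    by (rule block_pcomp_str1_Suc; simp add: ty)
  have mt: "?m \<in> Cell C" "Src C ?m = str1 T (j + ?k) W Y (strs (j + k) Ws Y (?F \<odot>[j] q))"
    "Tgt C ?m = ?F \<odot>[j] ?Q"
    by (simp_all add: ty)
  have c1: "J.C.csquare (?S ?top) (?S (\<iota> ?F \<star>[j] ?u)) (?S (comp_cell_pre (j + k) Ws W Y (?F \<odot>[j] q) Vs h))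
      (?S (?m \<star>[j + ?k] \<iota> ?E))"
    by (rule csquare_strs2[OF csquare_t_mults_comp_cell_pre]) (simp_all add: ty b b'')
  have c2: "J.C.csquare (t_mults j X Y f (?k + length Vs) Ws' (strs ?k Vs X (strs k Ws X (q \<odot>[?k] h))))
      (\<iota> ?F \<star>[j] strs2 (?k + length Vs) Ws' X ?u) (?S (\<iota> ?F \<star>[j] ?u))
      (t_mults j X Y f (?k + length Vs) Ws' (?Q \<odot>[?k] ?E))"
    using csquare_t_mults[of "\<iota> f" ?u j X Y "?k + length Vs" Ws'] by (simp add: ty str2_Id2 add.assoc bq[unfolded add.assoc])
  have c3: "J.C.csquare (t_mults j X Y f (?k + length Vs) Ws' (?Q \<odot>[?k] ?E))
      (\<iota> ?F \<star>[j] strs_nat (Suc ?k) Ws' X ?Q ?k ?E) (strs_nat (Suc (j + ?k)) Ws' Y (?F \<odot>[j] ?Q) (j + ?k) ?E)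
      (t_mults j X Y f (Suc ?k) Ws' ?Q \<star>[j + ?k] \<iota> ?E)"
    using csquare_t_mults_inner[of f j X Y "Suc ?k" Ws' ?Q ?k ?E] by (simp add: ty)
  let ?R = "str1 T (j + ?k) W Y (strs (j + k) Ws Y (?F \<odot>[j] q))"
  \<comment> \<open>Only the boundary of \<open>?m\<close> matters here, so the square is stated for
    any \<open>m\<close> with that boundary; the composite \<open>?m\<close> is opened only in
    \<open>e5\<close>.\<close>
  have c4: "J.C.csquare (strs_nat (Suc (j + ?k)) Ws' Y ?R (j + ?k) ?E)
      (strs2 (Suc (j + ?k)) Ws' Y m \<star>[j + ?k] \<iota> ?E) (?S (m \<star>[j + ?k] \<iota> ?E))
      (strs_nat (Suc (j + ?k)) Ws' Y (?F \<odot>[j] ?Q) (j + ?k) ?E)"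
    if "m \<in> Cell C" "Src C m = ?R" "Tgt C m = ?F \<odot>[j] ?Q" for m
  proof -
    have E: "Src C (\<iota> ?E) = ?E" "Tgt C (\<iota> ?E) = ?E" "\<iota> ?E \<in> Cell C" "Cod C ?E = TO T W"
      "length (Dom C ?E) = length Vs"
      by (simp_all add: ty)
    have R: "block (Suc (j + ?k)) Ws' Y ?R" "j + ?k < length (Dom C ?R)" "Dom C ?R ! (j + ?k) = TO T W"
      by (simp_all add: ty b2)
    have "J.C.csquare (strs_nat (Suc (j + ?k)) Ws' Y (Src C m) (j + ?k) (Src C (\<iota> ?E)))
        (strs2 (Suc (j + ?k)) Ws' Y m \<star>[j + ?k] \<iota> ?E)
        (strs2 (shift (j + ?k) (length (Dom C (Src C (\<iota> ?E)))) (Suc (j + ?k))) Ws' Y (m \<star>[j + ?k] \<iota> ?E))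
        (strs_nat (Suc (j + ?k)) Ws' Y (Tgt C m) (j + ?k) (Tgt C (\<iota> ?E)))"
      by (rule csquare_strs_nat; (unfold that E)?; (rule that E R)?) (simp add: R)+
    then show ?thesis
      unfolding E that shift_Suc_self .
  qed
  have e1: "(\<iota> ?F \<star>[j] strs_nat (Suc ?k) Ws' X ?Q ?k ?E) \<cdot> (\<iota> ?F \<star>[j] strs2 (?k + length Vs) Ws' X ?u) =
      \<iota> ?F \<star>[j] comp_cell k Ws W Ws' X q Vs h"
    by (simp add: ty comp_cell_def J.C.interchange)
  have e2: "strs_nat (Suc (j + ?k)) Ws' Y ?R (j + ?k) ?E \<cdot> ?S (comp_cell_pre (j + k) Ws W Y (?F \<odot>[j] q) Vs h) =
      comp_cell (j + k) Ws W Ws' Y (?F \<odot>[j] q) Vs h"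
    by (simp add: comp_cell_def add.assoc)
  have e3: "(t_mults j X Y f (Suc ?k) Ws' ?Q \<star>[j + ?k] \<iota> ?E) \<cdot> (strs2 (Suc (j + ?k)) Ws' Y ?m \<star>[j + ?k] \<iota> ?E) =
      (t_mults j X Y f (Suc ?k) Ws' ?Q \<cdot> strs2 (Suc (j + ?k)) Ws' Y ?m) \<star>[j + ?k] (\<iota> ?E \<cdot> \<iota> ?E)"
  proof -
    have "(t_mults j X Y f (Suc ?k) Ws' ?Q \<star>[j + ?k] \<iota> ?E) \<cdot> (strs2 (Suc (j + ?k)) Ws' Y m \<star>[j + ?k] \<iota> ?E) =
      (t_mults j X Y f (Suc ?k) Ws' ?Q \<cdot> strs2 (Suc (j + ?k)) Ws' Y m) \<star>[j + ?k] (\<iota> ?E \<cdot> \<iota> ?E)"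
      if "m \<in> Cell C" "Src C m = ?R" "Tgt C m = ?F \<odot>[j] ?Q" for m
      by (rule J.C.interchange) (simp_all add: ty that b2)
    from this[OF mt] show ?thesis .
  qed
  have e4: "\<iota> ?E \<cdot> \<iota> ?E = \<iota> ?E"
    by (simp add: ty)
  \<comment> \<open>The run \<open>Ws @ W # Ws'\<close> is multiplied in by stages
    \<open>Ws\<close>, \<open>W\<close>, \<open>Ws'\<close>, and \<open>?m\<close> comprises the
    first two.\<close>
  have e5: "t_mults j X Y f (Suc ?k) Ws' ?Q \<cdot> strs2 (Suc (j + ?k)) Ws' Y ?m = t_mults j X Y f k (Ws @ W # Ws') q"
  proof -
    have "strs2 (Suc (j + ?k)) Ws' Y ?m = strs2 (Suc (j + ?k)) Ws' Y (t_mult T j X Y f ?k W ?q) \<cdot>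
        strs2 (Suc (j + ?k)) Ws' Y (str2 T (j + ?k) W Y (t_mults j X Y f k Ws q))"
      by (rule strs2_Vcomp) (simp_all add: ty b2)
    moreover have "t_mults j X Y f k (Ws @ W # Ws') q =
        (t_mults j X Y f (Suc ?k) Ws' ?Q \<cdot> strs2 (Suc (j + ?k)) Ws' Y (t_mult T j X Y f ?k W ?q)) \<cdot>
        strs2 (Suc (j + ?k)) Ws' Y (str2 T (j + ?k) W Y (t_mults j X Y f k Ws q))"
      by (subst t_mults_append) (simp_all add: ty add.assoc)
    moreover have "\<dots> = t_mults j X Y f (Suc ?k) Ws' ?Q \<cdot> (strs2 (Suc (j + ?k)) Ws' Y (t_mult T j X Y f ?k W ?q) \<cdot>
        strs2 (Suc (j + ?k)) Ws' Y (str2 T (j + ?k) W Y (t_mults j X Y f k Ws q)))"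
      by (rule J.C.Vcomp_assoc') (simp_all add: ty b2)
    ultimately show ?thesis by simp
  qed
  have e6: "t_mults j X Y f (?k + length Vs) Ws' (strs ?k Vs X (strs k Ws X (q \<odot>[?k] h))) \<cdot> ?S ?top =
      t_mults j X Y f k (Ws @ Vs @ Ws') (q \<odot>[?k] h)"
  proof -
    have "t_mults j X Y f k ((Ws @ Vs) @ Ws') (q \<odot>[?k] h) =
        t_mults j X Y f (?k + length Vs) Ws' (strs ?k Vs X (strs k Ws X (q \<odot>[?k] h))) \<cdot>
        ?S (t_mults j X Y f k (Ws @ Vs) (q \<odot>[?k] h))"
      by (subst t_mults_append) (simp_all add: ty add.assoc strs_append bq[unfolded add.assoc])
    moreover have "t_mults j X Y f k (Ws @ Vs) (q \<odot>[?k] h) = ?top"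
      by (subst t_mults_append) (simp_all add: ty add.assoc)
    ultimately show ?thesis by simp
  qed
  \<comment> \<open>Here \<open>c1\<close> is the square for \<open>comp_cell_pre\<close>,
    strengthened along \<open>Ws'\<close>. The other three bring in the constraint of the trailing
    run: naturality of \<open>t_mults\<close>, naturality of \<open>strs_nat\<close>, and
    compatibility of the two.\<close>
  from J.C.csquare_vpaste[OF J.C.csquare_hpaste[OF c1 c2] J.C.csquare_hpaste[OF J.C.csquare_transpose[OF c4[OF mt]] c3]]
  show ?thesis
    unfolding e1 e2 e3 e4 e5 e6 .
qed

lemma block_pcomp_str1_at_0 [simp]:
  "\<lbrakk>f \<in> strengthen_dom 0 X Y; block k Ws X g\<rbrakk> \<Longrightarrow> block k Ws Y (str1 T 0 X Y f \<odot>[0] g)"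
  using block_pcomp_str1[of f 0 X Y k Ws g] by simp

text \<open>\<open>t_unit_mults\<close> consists of a strengthened \<open>t_unit\<close> followed by
  \<open>t_mults\<close>. Naturality of the composition cell in \<open>?\<alpha>\<close> deals with
  the first factor, \<open>csquare_t_mults_comp_cell\<close> with the second.\<close>

lemma csquare_t_unit_mults_comp_cell:
  assumes "A \<in> strengthen_dom j X Y" "J_arrow (Ws @ W # Ws') X g" "J_arrow Vs W h"
  shows "J.C.csquare (t_unit_mults j X Y A (Ws @ Vs @ Ws') (g \<odot>[length Ws] h))
    (\<iota> (str1 T j X Y A) \<star>[j] comp_cell 0 Ws W Ws' X (unit T X \<odot>[0] g) Vs h)
    (comp_cell j Ws W Ws' Y (A \<odot>[j] g) Vs h)
    (t_unit_mults j X Y A (Ws @ W # Ws') g \<star>[j + length Ws] \<iota> (lift1 Vs W h))"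
proof -
  let ?u = "unit T X \<odot>[0] g" and ?k = "length Ws" and ?E = "lift1 Vs W h" and ?B = "str1 T j X Y A"
  let ?\<alpha> = "t_unit T j X Y A \<star>[j] \<iota> g"
  have "j < length (Dom C A) + length Ws'" using assms by simp
  note ty = assms[simplified] this
  have bu: "block 0 (Ws @ W # Ws') X ?u"
    by (rule block_unit_pcomp) (use assms in simp)
  have bA: "block j (Ws @ W # Ws') Y (A \<odot>[j] g)"
    by (rule block_pcomp_J_arrow) (simp_all add: ty)
  note b = bu[simplified] bA[simplified]
  have a: "?u \<odot>[?k] h = unit T X \<odot>[0] (g \<odot>[?k] h)"
    using J.C.pcomp1_assoc[of "unit T X" g h 0 ?k] by (simp add: ty nth_append)
  have c1: "J.C.csquare (comp_cell j Ws W Ws' Y (A \<odot>[j] g) Vs h)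
      (strs2 j (Ws @ W # Ws') Y ?\<alpha> \<star>[j + ?k] \<iota> ?E)
      (strs2 j (Ws @ Vs @ Ws') Y (t_unit T j X Y A \<star>[j] \<iota> (g \<odot>[?k] h)))
      (comp_cell j Ws W Ws' Y (?B \<odot>[j] ?u) Vs h)"
  proof -
    have e: "?\<alpha> \<star>[j + ?k] \<iota> h = t_unit T j X Y A \<star>[j] \<iota> (g \<odot>[?k] h)"
      using J.C.pcomp2_assoc[of "t_unit T j X Y A" "\<iota> g" "\<iota> h" j ?k] by (simp add: ty nth_append)
    show ?thesis
      using csquare_comp_cell[of ?\<alpha> "\<iota> h" j Ws Y W Ws' Vs] unfolding e
      by (simp add: ty b strs2_append)
  qed
  have c2: "J.C.csquare (t_mults j X Y A 0 (Ws @ Vs @ Ws') (unit T X \<odot>[0] (g \<odot>[?k] h)))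
      (\<iota> ?B \<star>[j] comp_cell 0 Ws W Ws' X ?u Vs h) (comp_cell j Ws W Ws' Y (?B \<odot>[j] ?u) Vs h)
      (t_mults j X Y A 0 (Ws @ W # Ws') ?u \<star>[j + ?k] \<iota> ?E)"
    using csquare_t_mults_comp_cell[of A j X Y 0 Ws ?u W Ws' Vs h] by (simp add: ty b a)
  have e: "(t_mults j X Y A 0 (Ws @ W # Ws') ?u \<star>[j + ?k] \<iota> ?E) \<cdot> (strs2 j (Ws @ W # Ws') Y ?\<alpha> \<star>[j + ?k] \<iota> ?E) =
      t_unit_mults j X Y A (Ws @ W # Ws') g \<star>[j + ?k] (\<iota> ?E \<cdot> \<iota> ?E)"
    unfolding t_unit_mults_def by (rule J.C.interchange) (use b in \<open>simp_all add: ty strs_append\<close>)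
  have e2: "\<iota> ?E \<cdot> \<iota> ?E = \<iota> ?E"
    by (simp add: ty)
  from J.C.csquare_hpaste[OF J.C.csquare_transpose[OF c1] c2] show ?thesis
    unfolding e e2 t_unit_mults_def[of j X Y A "Ws @ Vs @ Ws'"] .
qed

lemma block_pcomp_early:
  assumes "block p Xs Y f" "p + length Xs \<le> k" "k < length (Dom C f)" "g \<in> Mor C" "Cod C g = Dom C f ! k"
  shows "block p Xs Y (f \<odot>[k] g)"
proof (cases Xs)
  case Nil
  then show ?thesis using assms by auto
next
  case (Cons X Xs')
  then have "shift k (length (Dom C g)) p = p" using assms(2) by (simp add: shift_def)
  then show ?thesis using block_pcomp_out[OF assms(1) _ assms(3-5) refl] assms(2) by simp
qed

lemma shift_late [simp]:
  "strs (shift (p + length Xs + n) m p) Xs = strs p Xs"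
  "strs2 (shift (p + length Xs + n) m p) Xs = strs2 p Xs"
  "strs_nat (shift (p + length Xs + n) m p) Xs = strs_nat p Xs"
  by (cases Xs; auto simp: shift_def fun_eq_iff)+

text \<open>
  In the cell for \<open>(f \<circ>\<^sub>j g) \<circ>\<^sub>j\<^sub>+\<^sub>k h\<close>, the arguments of \<open>f\<close> and those of \<open>g\<close> are strengthened past \<open>h\<close>
  separately; what remains for \<open>g\<close> has the form of the cell for \<open>g \<circ>\<^sub>k h\<close>.
\<close>

lemma comp_cell_append:
  fixes p :: nat
  defines "j \<equiv> \<lambda>Xs. p + length Xs" and "l \<equiv> \<lambda>Xs Ws. p + length Xs + length Ws"
  assumes "block p Xs Y Q" "block (p + length Xs) Ws Y Q" "Q \<in> strengthen_dom (p + length Xs + length Ws) W Y"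
    "block (Suc (p + length Xs + length Ws)) Ws' Y Q"
    "block (Suc (p + length Xs + length Ws + length Ws')) Xs' Y Q" "J_arrow Vs W h"
  shows "comp_cell p (Xs @ Ws) W (Ws' @ Xs') Y Q Vs h =
    strs_nat (Suc (l Xs Ws + length Ws')) Xs' Y
      (strs (Suc (l Xs Ws)) Ws' Y (str1 T (l Xs Ws) W Y (strs (j Xs) Ws Y (strs p Xs Y Q)))) (l Xs Ws) (lift1 Vs W h) \<cdot>
    strs2 (l Xs Ws + length Vs + length Ws') Xs' Y (comp_cell (j Xs) Ws W Ws' Y (strs p Xs Y Q) Vs h \<cdot>
      strs2 (l Xs Ws + length Vs) Ws' Y (strs2 (l Xs Ws) Vs Y (strs2 (j Xs) Ws Y (strs_nat p Xs Y Q (l Xs Ws) h))))"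
proof -
  let ?E = "lift1 Vs W h" and ?Q = "strs p Xs Y Q" and ?j = "p + length Xs" and ?l = "p + length Xs + length Ws"
  let ?B = "str1 T ?l W Y (strs ?j Ws Y ?Q)"
  note ty = assms(3-8)[simplified]
  let ?a = "strs_nat (Suc (?l + length Ws')) Xs' Y (strs (Suc ?l) Ws' Y ?B) ?l ?E"
  let ?b = "strs_nat (Suc ?l) Ws' Y ?B ?l ?E"
  let ?n = "strs_nat ?j Ws Y ?Q ?l h" and ?m = "strs2 ?j Ws Y (strs_nat p Xs Y Q ?l h)"
  let ?t = "t_unit_mults ?l W Y (strs ?j Ws Y ?Q) Vs h" and ?r = "comp_cell_pre ?j Ws W Y ?Q Vs h"
  let ?S1 = "strs2 ?l Vs Y" and ?S2 = "strs2 (?l + length Vs) Ws' Y" and ?S3 = "strs2 (?l + length Vs + length Ws') Xs' Y"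
  have B: "block p Xs Y (Q \<odot>[?l] h)" "block ?j Ws Y (Q \<odot>[?l] h)" "block ?l Vs Y (Q \<odot>[?l] h)"
    "block (?l + length Vs) Ws' Y (Q \<odot>[?l] h)" "block ?j Ws Y (?Q \<odot>[?l] h)" "block ?l Vs Y (?Q \<odot>[?l] h)"
    "block (?l + length Vs) Ws' Y (?Q \<odot>[?l] h)"
    by (simp_all add: block_pcomp_early ty)
  have "block (?l + length Vs) (Ws' @ Xs') Y (Q \<odot>[?l] h)" "block (?l + length Vs) (Ws' @ Xs') Y (?Q \<odot>[?l] h)"
    by (rule block_pcomp_after; simp add: ty)+
  note B = B this[simplified]
  have s1: "strs_nat (Suc ?l) (Ws' @ Xs') Y ?B ?l ?E = ?a \<cdot> ?S3 ?b"
    by (subst strs_nat_append) (simp_all add: ty)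
  have s: "strs2 (shift ?l k p + length Xs) Ws = strs2 ?j Ws" for k
    by (cases Ws) (simp_all add: fun_eq_iff shift_def)
  have s2: "strs_nat p (Xs @ Ws) Y Q ?l h = ?n \<cdot> ?m"
    by (subst strs_nat_append) (simp_all add: ty s)
  have m: "?m \<in> Cell C" "Src C ?m = strs ?j Ws Y (strs p Xs Y (Q \<odot>[?l] h))" "Tgt C ?m = strs ?j Ws Y (?Q \<odot>[?l] h)"
    by (simp_all add: ty B)
  have n: "?n \<in> Cell C" "Src C ?n = strs ?j Ws Y (?Q \<odot>[?l] h)" "Tgt C ?n = strs ?j Ws Y ?Q \<odot>[?l] h"
    by (simp_all add: ty)
  have t: "?t \<in> Cell C" "Src C ?t = strs ?l Vs Y (strs ?j Ws Y ?Q \<odot>[?l] h)"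
    by (simp_all add: ty)
  have r: "?r \<in> Cell C" "Src C ?r = strs ?l Vs Y (strs ?j Ws Y (?Q \<odot>[?l] h))" "Tgt C ?r = ?B \<odot>[?l] ?E"
    by (simp_all add: ty)
  have b: "?b \<in> Cell C" "Src C ?b = strs (?l + length Vs) Ws' Y (?B \<odot>[?l] ?E)"
    "Tgt C ?b = strs (Suc ?l) Ws' Y ?B \<odot>[?l] ?E"
    by (simp_all add: ty)
  have a: "?a \<in> Cell C" "Src C ?a = strs (?l + length Vs + length Ws') Xs' Y (strs (Suc ?l) Ws' Y ?B \<odot>[?l] ?E)"
    by (simp_all add: ty)
  have BB: "block ?l Vs Y (strs ?j Ws Y (strs p Xs Y (Q \<odot>[?l] h)))"
    "block (?l + length Vs) Ws' Y (strs ?l Vs Y (strs ?j Ws Y (strs p Xs Y (Q \<odot>[?l] h))))"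
    "block (?l + length Vs) Ws' Y (strs ?l Vs Y (strs ?j Ws Y (?Q \<odot>[?l] h)))"
    "block (?l + length Vs + length Ws') Xs' Y (strs (?l + length Vs) Ws' Y (strs ?l Vs Y (strs ?j Ws Y (strs p Xs Y (Q \<odot>[?l] h)))))"
    "block ?l Vs Y (strs ?j Ws Y (?Q \<odot>[?l] h))"
    by (simp_all add: ty B)
  have z: "?S2 (?S1 ?m) \<in> Cell C" "Src C (?S2 (?S1 ?m)) = strs (?l + length Vs) Ws' Y (strs ?l Vs Y (strs ?j Ws Y (strs p Xs Y (Q \<odot>[?l] h))))"
    "Tgt C (?S2 (?S1 ?m)) = strs (?l + length Vs) Ws' Y (strs ?l Vs Y (strs ?j Ws Y (?Q \<odot>[?l] h)))"
    using m BB by simp_all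
  have Sr: "?S2 ?r \<in> Cell C" "Src C (?S2 ?r) = strs (?l + length Vs) Ws' Y (strs ?l Vs Y (strs ?j Ws Y (?Q \<odot>[?l] h)))"
    "Tgt C (?S2 ?r) = strs (?l + length Vs) Ws' Y (?B \<odot>[?l] ?E)"
    using r BB by simp_all
  \<comment> \<open>The constraint past \<open>h\<close> splits into \<open>?m\<close>, from the run
    \<open>Xs\<close>, followed by \<open>?n\<close>, from the run \<open>Ws\<close>. The latter is
    absorbed into \<open>comp_cell_pre\<close>; the former is carried out to the right through the
    later stages.\<close>
  have "?t \<cdot> ?S1 (?n \<cdot> ?m) = ?t \<cdot> (?S1 ?n \<cdot> ?S1 ?m)"
    by (subst strs2_Vcomp) (simp_all only: m n BB)
  also have "\<dots> = ?r \<cdot> ?S1 ?m"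
    unfolding comp_cell_pre_def by (rule J.C.Vcomp_assoc'[symmetric]) (use m n t BB in simp_all)
  finally have 1: "?t \<cdot> ?S1 (?n \<cdot> ?m) = ?r \<cdot> ?S1 ?m" .
  have 2: "?S2 (?r \<cdot> ?S1 ?m) = ?S2 ?r \<cdot> ?S2 (?S1 ?m)"
    by (rule strs2_Vcomp) (use m r BB in simp_all)
  have 3: "?b \<cdot> (?S2 ?r \<cdot> ?S2 (?S1 ?m)) = (?b \<cdot> ?S2 ?r) \<cdot> ?S2 (?S1 ?m)"
    by (rule J.C.Vcomp_assoc'[symmetric]) (simp_all only: z b Sr)
  have z': "?S2 ?r \<cdot> ?S2 (?S1 ?m) \<in> Cell C" 
    "Src C (?S2 ?r \<cdot> ?S2 (?S1 ?m)) = strs (?l + length Vs) Ws' Y (strs ?l Vs Y (strs ?j Ws Y (strs p Xs Y (Q \<odot>[?l] h))))"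
    "Tgt C (?S2 ?r \<cdot> ?S2 (?S1 ?m)) = strs (?l + length Vs) Ws' Y (?B \<odot>[?l] ?E)"
    using J.C.Vcomp_simps[of "?S2 (?S1 ?m)" "?S2 ?r"] by (simp_all only: z Sr simp_thms)
  have "block (?l + length Vs) (Ws' @ Xs') Y (?B \<odot>[?l] ?E)"
    by (rule block_pcomp_after) (simp_all add: ty)
  note BE = this[simplified]
  have "block (?l + length Vs + length Ws') Xs' Y (Src C ?b)"
    unfolding b by (simp add: ty BE)
  note Sb = strs2_simps[OF b(1) this, unfolded b]
  have "block (?l + length Vs + length Ws') Xs' Y (Src C (?S2 ?r \<cdot> ?S2 (?S1 ?m)))"
    unfolding z' by (rule BB)
  note Sz = strs2_simps[OF z'(1) this, unfolded z']
  have e: "p + length (Xs @ Ws) = ?l"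
    by simp
  have "comp_cell p (Xs @ Ws) W (Ws' @ Xs') Y Q Vs h = (?a \<cdot> ?S3 ?b) \<cdot> ?S3 (?S2 ?r \<cdot> ?S2 (?S1 ?m))"
    unfolding comp_cell_def comp_cell_pre_def[of p] e s1 s2 strs_append strs2_append 1 2 ..
  also have "\<dots> = ?a \<cdot> (?S3 ?b \<cdot> ?S3 (?S2 ?r \<cdot> ?S2 (?S1 ?m)))"
    by (rule J.C.Vcomp_assoc') (simp_all only: a Sb Sz)
  also have "?S3 ?b \<cdot> ?S3 (?S2 ?r \<cdot> ?S2 (?S1 ?m)) = ?S3 (?b \<cdot> (?S2 ?r \<cdot> ?S2 (?S1 ?m)))"
    by (rule strs2_Vcomp[symmetric]) (simp_all only: b z' BB)
  also have "\<dots> = ?S3 (comp_cell ?j Ws W Ws' Y ?Q Vs h \<cdot> ?S2 (?S1 ?m))"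
    unfolding 3 comp_cell_def ..
  finally show ?thesis
    unfolding j_def l_def .
qed

section \<open>The unit laws\<close>

lemma \<theta>_t_mults:
  assumes "block k Ws X g"
  shows "(\<theta> T X \<star>[0] \<iota> (strs k Ws X g)) \<cdot> t_mults 0 X X (unit T X) k Ws g = strs2 k Ws X (\<theta> T X \<star>[0] \<iota> g)"
  using assms
proof (induction Ws arbitrary: k g)
  case Nil
  then show ?case by (simp add: TO_Obj)
next
  case (Cons W Ws)
  let ?G = "str1 T k W X g"
  note ty = Cons.prems[simplified]
  have "(\<theta> T X \<star>[0] \<iota> (strs (Suc k) Ws X ?G)) \<cdot> (t_mults 0 X X (unit T X) (Suc k) Ws ?G \<cdot>
      strs2 (Suc k) Ws X (t_mult T 0 X X (unit T X) k W g)) =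
      ((\<theta> T X \<star>[0] \<iota> (strs (Suc k) Ws X ?G)) \<cdot> t_mults 0 X X (unit T X) (Suc k) Ws ?G) \<cdot>
      strs2 (Suc k) Ws X (t_mult T 0 X X (unit T X) k W g)"
    by (rule J.C.Vcomp_assoc'[symmetric]) (simp_all add: ty)
  also have "(\<theta> T X \<star>[0] \<iota> (strs (Suc k) Ws X ?G)) \<cdot> t_mults 0 X X (unit T X) (Suc k) Ws ?G =
      strs2 (Suc k) Ws X (\<theta> T X \<star>[0] \<iota> ?G)"
    by (rule Cons.IH) (simp add: ty)
  also have "\<dots> \<cdot> strs2 (Suc k) Ws X (t_mult T 0 X X (unit T X) k W g) =
      strs2 (Suc k) Ws X ((\<theta> T X \<star>[0] \<iota> ?G) \<cdot> t_mult T 0 X X (unit T X) k W g)"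
    by (rule strs2_Vcomp[symmetric]) (simp_all add: ty)
  also have "(\<theta> T X \<star>[0] \<iota> ?G) \<cdot> t_mult T 0 X X (unit T X) k W g = str2 T k W X (\<theta> T X \<star>[0] \<iota> g)"
    by (rule \<theta>_t_mult) (simp_all add: ty)
  finally show ?case by simp
qed

text \<open>An identity has no arguments before or after, so the composition cell reduces to a
  strengthened \<open>t_unit\<close> followed by \<open>t_mults\<close>. By
  \<open>\<theta>_t_mults\<close> the cell \<open>\<theta>\<close> passes under the strengthenings,
  where \<open>\<theta>_t_unit\<close> cancels it against \<open>t_unit\<close>.\<close>

lemma comp_cell_unit_left:
  assumes "J_arrow Ws Y g"
  shows "(\<theta> T Y \<star>[0] \<iota> (lift1 Ws Y g)) \<cdot> comp_cell 0 [] Y [] Y (unit T Y) Ws g = \<iota> (lift1 Ws Y g)"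
proof -
  let ?u = "unit T Y \<odot>[0] g" and ?\<alpha> = "t_unit T 0 Y Y (unit T Y) \<star>[0] \<iota> g"
  note ty = assms[simplified] TO_Obj
  have c: "comp_cell 0 [] Y [] Y (unit T Y) Ws g = t_mults 0 Y Y (unit T Y) 0 Ws ?u \<cdot> strs2 0 Ws Y ?\<alpha>"
    by (simp add: comp_cell_def comp_cell_pre_def t_unit_mults_def ty lift1_def)
  have "(\<theta> T Y \<star>[0] \<iota> (lift1 Ws Y g)) \<cdot> (t_mults 0 Y Y (unit T Y) 0 Ws ?u \<cdot> strs2 0 Ws Y ?\<alpha>) =
      ((\<theta> T Y \<star>[0] \<iota> (lift1 Ws Y g)) \<cdot> t_mults 0 Y Y (unit T Y) 0 Ws ?u) \<cdot> strs2 0 Ws Y ?\<alpha>"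
    by (rule J.C.Vcomp_assoc'[symmetric]) (simp_all add: ty lift1_def)
  also have "(\<theta> T Y \<star>[0] \<iota> (lift1 Ws Y g)) \<cdot> t_mults 0 Y Y (unit T Y) 0 Ws ?u = strs2 0 Ws Y (\<theta> T Y \<star>[0] \<iota> ?u)"
    unfolding lift1_def by (rule \<theta>_t_mults) (simp add: ty)
  also have "\<dots> \<cdot> strs2 0 Ws Y ?\<alpha> = strs2 0 Ws Y ((\<theta> T Y \<star>[0] \<iota> ?u) \<cdot> ?\<alpha>)"
    by (rule strs2_Vcomp[symmetric]) (simp_all add: ty)
  also have "\<theta> T Y \<star>[0] \<iota> ?u = (\<theta> T Y \<star>[0] \<iota> (unit T Y)) \<star>[0] \<iota> g"
    using J.C.pcomp2_assoc[of "\<theta> T Y" "\<iota> (unit T Y)" "\<iota> g" 0 0] by (simp add: ty)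
  also have "((\<theta> T Y \<star>[0] \<iota> (unit T Y)) \<star>[0] \<iota> g) \<cdot> ?\<alpha> =
      ((\<theta> T Y \<star>[0] \<iota> (unit T Y)) \<cdot> t_unit T 0 Y Y (unit T Y)) \<star>[0] (\<iota> g \<cdot> \<iota> g)"
    by (rule J.C.interchange) (simp_all add: ty)
  also have "\<dots> = \<iota> ?u"
    by (subst \<theta>_t_unit) (simp_all add: ty)
  also have "strs2 0 Ws Y \<dots> = \<iota> (lift1 Ws Y g)"
    by (simp add: ty lift1_def)
  finally show ?thesis unfolding c .
qed

text \<open>The constraint of the early arguments past an identity is trivial. Naturality of the
  late constraint moves \<open>\<theta>\<close> under the strengthenings along \<open>Xs'\<close>,
  and what it meets there is exactly the composite in \<open>mult_unit\<close>.\<close>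

lemma comp_cell_unit_right:
  assumes "block p (Xs @ X # Xs') Y P"
  shows "(\<iota> (strs p (Xs @ X # Xs') Y P) \<star>[p + length Xs] \<theta> T X) \<cdot>
    comp_cell p Xs X Xs' Y P [X] (\<one> (FO J X)) = \<iota> (strs p (Xs @ X # Xs') Y P)"
proof -
  let ?j = "p + length Xs" and ?u = "unit T X"
  let ?A = "strs p Xs Y P"
  let ?B = "str1 T ?j X Y ?A" and ?K = "str1 T 0 X X ?u"
  let ?S = "strs2 (Suc ?j) Xs' Y"
  have X: "X \<in> Obj D" using assms by simp
  note ty = assms[simplified] TO_Obj[OF X] J.FO_Obj[OF X]
  let ?v = "t_mult T ?j X Y ?A 0 X ?u \<cdot> str2 T ?j X Y (t_unit T ?j X Y ?A)"
  have A: "?A \<in> strengthen_dom ?j X Y" by (simp add: ty)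
  have E: "lift1 [X] X (\<one> (FO J X)) = ?K" by (simp add: lift1_def ty)
  have "strs_nat p Xs Y P ?j (\<one> (FO J X)) = \<iota> ?A"
    by (rule strs_nat_Id1) (simp_all add: ty)
  then have c: "comp_cell p Xs X Xs' Y P [X] (\<one> (FO J X)) = strs_nat (Suc ?j) Xs' Y ?B ?j ?K \<cdot> ?S ?v"
    by (simp add: comp_cell_def comp_cell_pre_def t_unit_mults_def ty E str2_Id2)
  have TP: "strs p (Xs @ X # Xs') Y P = strs (Suc ?j) Xs' Y ?B"
    by (simp add: strs_append)
  have v: "?v \<in> Cell C" "Src C ?v = ?B" "Tgt C ?v = ?B \<odot>[?j] ?K"
    by (simp_all add: ty)
  have R: "block (Suc ?j) Xs' Y (?B \<odot>[?j] ?K)"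
    using block_pcomp_after[of ?j Xs' Y ?B ?K 1] by (simp add: ty)
  have n: "(\<iota> (strs (Suc ?j) Xs' Y ?B) \<star>[?j] \<theta> T X) \<cdot> strs_nat (Suc ?j) Xs' Y ?B ?j ?K = ?S (\<iota> ?B \<star>[?j] \<theta> T X)"
  proof -
    \<comment> \<open>\<open>\<theta>\<close> ends in an identity, past which the constraint is
      trivial, so its naturality square in \<open>\<theta>\<close> degenerates to a
      triangle.\<close>
    have "strs_nat (Suc ?j) Xs' Y ?B ?j (\<one> (TO T X)) = \<iota> (strs (Suc ?j) Xs' Y ?B)"
      by (rule strs_nat_Id1) (simp_all add: ty)
    then show ?thesis
      using csquare_strs_nat[of "\<iota> ?B" "\<theta> T X" "Suc ?j" Xs' Y ?j, THEN J.C.csquare_eq] by (simp add: ty R)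
  qed
  have "(\<iota> (strs (Suc ?j) Xs' Y ?B) \<star>[?j] \<theta> T X) \<cdot> (strs_nat (Suc ?j) Xs' Y ?B ?j ?K \<cdot> ?S v) =
     ?S ((\<iota> ?B \<star>[?j] \<theta> T X) \<cdot> v)" if "v \<in> Cell C" "Src C v = ?B" "Tgt C v = ?B \<odot>[?j] ?K" for v
  proof -
    have "(\<iota> (strs (Suc ?j) Xs' Y ?B) \<star>[?j] \<theta> T X) \<cdot> (strs_nat (Suc ?j) Xs' Y ?B ?j ?K \<cdot> ?S v) =
      ((\<iota> (strs (Suc ?j) Xs' Y ?B) \<star>[?j] \<theta> T X) \<cdot> strs_nat (Suc ?j) Xs' Y ?B ?j ?K) \<cdot> ?S v"
      by (rule J.C.Vcomp_assoc'[symmetric]) (simp_all add: ty that R)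
    also have "\<dots> = ?S ((\<iota> ?B \<star>[?j] \<theta> T X) \<cdot> v)"
      unfolding n by (rule strs2_Vcomp[symmetric]) (simp_all add: ty that R)
    finally show ?thesis .
  qed
  from this[OF v] show ?thesis
    unfolding c TP mult_unit[OF A] by (simp add: ty)
qed

section \<open>The associativity law\<close>

lemma block_replace:
  assumes "block j (Ws @ W # Ws') Y Q" "J_arrow Vs W h"
  shows "block j (Ws @ Vs @ Ws') Y (Q \<odot>[j + length Ws] h)"
  by (simp add: assms[simplified] block_pcomp_early)

text \<open>The essential square enters only in \<open>q1\<close>, through
  \<open>csquare_t_unit_mults_comp_cell\<close>. Around it \<open>strs_nat_comp\<close> splits the
  constraints past a composite, for the arguments of the outer arrow before and after the
  composition position, and \<open>comp_cell_append\<close> identifies the remaining factors with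
  the cell for \<open>h\<close>.\<close>

lemma comp_cell_assoc:
  assumes "block p (Xs @ X # Xs') Y P" "J_arrow (Ws @ W # Ws') X g" "J_arrow Vs W h"
  shows "(\<iota> (strs p (Xs @ X # Xs') Y P) \<star>[p + length Xs] comp_cell 0 Ws W Ws' X (unit T X \<odot>[0] g) Vs h) \<cdot>
      comp_cell p Xs X Xs' Y P (Ws @ Vs @ Ws') (g \<odot>[length Ws] h) =
    (comp_cell p Xs X Xs' Y P (Ws @ W # Ws') g \<star>[p + length Xs + length Ws] \<iota> (lift1 Vs W h)) \<cdot>
      comp_cell p (Xs @ Ws) W (Ws' @ Xs') Y (P \<odot>[p + length Xs] g) Vs h"
proof -
  let ?j = "p + length Xs" and ?k = "length Ws" and ?l = "p + length Xs + length Ws"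
  let ?A = "strs p Xs Y P" and ?Q = "P \<odot>[p + length Xs] g" and ?E = "lift1 Vs W h"
  let ?B = "str1 T ?j X Y ?A" and ?u = "unit T X \<odot>[0] g" and ?Tg = "lift1 (Ws @ W # Ws') X g"
  let ?TB = "strs (Suc ?j) Xs' Y ?B" and ?Q' = "strs p Xs Y ?Q"
  let ?\<alpha> = "strs_nat p Xs Y P ?j g" and ?v = "comp_cell_pre p Xs X Y P (Ws @ W # Ws') g"
  let ?c = "comp_cell ?j Ws W Ws' Y ?Q' Vs h" and ?d = "comp_cell 0 Ws W Ws' X ?u Vs h"
  let ?n = "strs_nat p Xs Y ?Q ?l h" and ?S = "strs2 ?j (Ws @ Vs @ Ws') Y"
  let ?S2 = "strs2 (?l + length Vs + length Ws') Xs' Y"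
  let ?R' = "strs (Suc ?l) Ws' Y (str1 T ?l W Y (strs ?j Ws Y ?Q'))"
  note ty = assms[simplified]
  have pQ: "block p Xs Y ?Q"
    by (rule block_pcomp_early) (simp_all add: ty)
  have bQ: "block ?j (Ws @ W # Ws') Y ?Q"
    by (rule block_pcomp_J_arrow) (simp_all add: ty)
  have bQ': "block ?j (Ws @ W # Ws') Y ?Q'"
    by (rule iffD2[OF block_strs[OF pQ] bQ]) simp
  have bQ2: "block (?j + length (Ws @ W # Ws')) Xs' Y ?Q"
    by (rule block_pcomp_after) (simp_all add: ty)
  then have bQ3: "block (Suc (?l + length Ws')) Xs' Y ?Q"
    by (simp add: add.assoc[symmetric])
  have bu: "block 0 (Ws @ W # Ws') X ?u"
    by (rule block_unit_pcomp) (use assms in simp)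
  have J_arrow: "J_arrow (Ws @ W # Ws') X g" "J_arrow Vs W h" "J_arrow (Ws @ Vs @ Ws') X (g \<odot>[?k] h)"
    using assms by (simp_all add: J.C.Dom_pcomp1 nth_append)
  have A: "?A \<in> strengthen_dom ?j X Y" "block p Xs Y P" "P \<in> strengthen_dom ?j X Y" "block (Suc ?j) Xs' Y P"
    by (simp_all add: ty)
  have E: "Src C (\<iota> ?E) = ?E" "Tgt C (\<iota> ?E) = ?E" "\<iota> ?E \<in> Cell C" "?E \<in> Mor C" "Cod C ?E = TO T W"
    "Dom C ?E = map (TO T) Vs" "\<iota> ?E \<cdot> \<iota> ?E = \<iota> ?E" "length (Dom C ?E) = length Vs"
    using J_arrow(2) by simp_all
  have R: "block (Suc (?l + length Ws')) Xs' Y ?R'" "?l < length (Dom C ?R')" "Dom C ?R' ! ?l = TO T W"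
    using pQ bQ bQ3 by simp_all
  have Tg: "?Tg \<in> Mor C" "Cod C ?Tg = TO T X" "Dom C ?Tg ! ?k = TO T W" "length (Dom C ?Tg) = Suc (?k + length Ws')"
    "Dom C ?Tg = map (TO T) (Ws @ W # Ws')"
    using lift1_simps[OF J_arrow(1)] by (simp_all add: nth_append)
  have \<alpha>: "?\<alpha> \<in> Cell C" "Src C ?\<alpha> = ?Q'" "Tgt C ?\<alpha> = ?A \<odot>[?j] g"
    by (simp_all add: ty)
  have v: "?v \<in> Cell C" "Src C ?v = ?R'" "Tgt C ?v = ?B \<odot>[?j] ?Tg"
    using comp_cell_pre_simps[OF A(2,3) J_arrow(1)] by (simp_all add: strs_append)
  have d: "?d \<in> Cell C" "Src C ?d = lift1 (Ws @ Vs @ Ws') X (g \<odot>[?k] h)" "Tgt C ?d = ?Tg \<odot>[?k] ?E"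
  proof -
    have "?u \<odot>[?k] h = unit T X \<odot>[0] (g \<odot>[?k] h)"
      using J.C.pcomp1_assoc[of "unit T X" g h 0 ?k] by (simp add: ty nth_append)
    then show "?d \<in> Cell C" "Src C ?d = lift1 (Ws @ Vs @ Ws') X (g \<odot>[?k] h)" "Tgt C ?d = ?Tg \<odot>[?k] ?E"
      using comp_cell_simps[of 0 Ws X ?u W Ws' Vs h] bu J_arrow(2) by (simp_all add: lift1_def strs_append)
  qed
  have n: "?n \<in> Cell C" "Src C ?n = strs p Xs Y (?Q \<odot>[?l] h)" "Tgt C ?n = ?Q' \<odot>[?l] h"
    using pQ bQ by (simp_all add: ty)
  have c: "?c \<in> Cell C" "Src C ?c = strs ?j (Ws @ Vs @ Ws') Y (?Q' \<odot>[?l] h)" "Tgt C ?c = ?R' \<odot>[?l] ?E"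
    using comp_cell_simps[of ?j Ws Y ?Q' W Ws' Vs h] bQ' J_arrow(2) by (simp_all add: strs_append)
  have bn: "block ?j (Ws @ Vs @ Ws') Y (?Q' \<odot>[?l] h)" "block ?j (Ws @ Vs @ Ws') Y (Src C ?n)"
    "block (?l + length Vs + length Ws') Xs' Y (Src C (?S ?n))"
  proof -
    have l: "?l < length (Dom C ?Q)" "h \<in> Mor C" "Cod C h = Dom C ?Q ! ?l"
      using bQ J_arrow(2) by simp_all
    have p: "block p Xs Y (?Q \<odot>[?l] h)"
      by (rule block_pcomp_early[OF pQ _ l]) simp
    show "block ?j (Ws @ Vs @ Ws') Y (?Q' \<odot>[?l] h)"
      by (rule block_replace[OF bQ' J_arrow(2)])
    show n2: "block ?j (Ws @ Vs @ Ws') Y (Src C ?n)"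
      unfolding n by (rule iffD2[OF block_strs[OF p] block_replace[OF bQ J_arrow(2)]]) simp
    have "block (?l + length Vs) (Ws' @ Xs') Y (?Q \<odot>[?l] h)"
      by (rule block_pcomp_after) (use bQ bQ3 l J_arrow(2) in simp_all)
    then have x: "block (?l + length Vs + length Ws') Xs' Y (?Q \<odot>[?l] h)"
      by simp
    have "block (?l + length Vs + length Ws') Xs' Y (strs p Xs Y (?Q \<odot>[?l] h))"
      by (rule iffD2[OF block_strs[OF p] x]) simp
    then have "block (?l + length Vs + length Ws') Xs' Y (strs ?j (Ws @ Vs @ Ws') Y (Src C ?n))"
      unfolding n by (rule iffD2[OF block_strs[OF n2[unfolded n]], rotated]) simp
    then show "block (?l + length Vs + length Ws') Xs' Y (Src C (?S ?n))"
      using strs2_simps(2)[OF n(1) n2] by simp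
  qed
  have Sn: "?S ?n \<in> Cell C" "Tgt C (?S ?n) = strs ?j (Ws @ Vs @ Ws') Y (?Q' \<odot>[?l] h)"
    using strs2_simps[OF n(1) bn(2)] n by simp_all
  \<comment> \<open>The early constraint past \<open>g \<odot>[?k] h\<close> is \<open>?n\<close>
    followed by \<open>?\<alpha>\<close> whiskered with \<open>h\<close>. The latter is handled by
    naturality of the cell for \<open>h\<close> in \<open>?\<alpha>\<close>, pasted to the square
    for \<open>t_unit_mults\<close>; \<open>?n\<close> is just precomposed.\<close>
  have q1: "J.C.csquare (comp_cell_pre p Xs X Y P (Ws @ Vs @ Ws') (g \<odot>[?k] h)) (\<iota> ?B \<star>[?j] ?d) (?c \<cdot> ?S ?n) (?v \<star>[?l] \<iota> ?E)"
  proof -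
    let ?T = "t_unit_mults ?j X Y ?A (Ws @ W # Ws') g" and ?T' = "t_unit_mults ?j X Y ?A (Ws @ Vs @ Ws') (g \<odot>[?k] h)"
    let ?S\<alpha> = "strs2 ?j (Ws @ W # Ws') Y ?\<alpha>" and ?\<alpha>h = "?\<alpha> \<star>[?l] \<iota> h"
    have s1: "J.C.csquare ?c (?S\<alpha> \<star>[?l] \<iota> ?E) (?S ?\<alpha>h) (comp_cell ?j Ws W Ws' Y (?A \<odot>[?j] g) Vs h)"
      using csquare_comp_cell[OF \<alpha>(1), of "\<iota> h" ?j Ws Y W Ws' Vs, unfolded \<alpha>] bQ' J_arrow(2)
      by (simp add: strs2_append)
    have s2: "J.C.csquare ?T' (\<iota> ?B \<star>[?j] ?d) (comp_cell ?j Ws W Ws' Y (?A \<odot>[?j] g) Vs h) (?T \<star>[?l] \<iota> ?E)"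
      by (rule csquare_t_unit_mults_comp_cell) (use A(1) J_arrow in simp_all)
    have S\<alpha>: "?S\<alpha> \<in> Cell C" "Tgt C ?S\<alpha> = strs ?j (Ws @ W # Ws') Y (?A \<odot>[?j] g)"
      "Src C ?S\<alpha> = ?R'" "?l < length (Dom C (Src C ?S\<alpha>))" "Dom C (Src C ?S\<alpha>) ! ?l = TO T W"
    proof -
      show "?S\<alpha> \<in> Cell C" "Tgt C ?S\<alpha> = strs ?j (Ws @ W # Ws') Y (?A \<odot>[?j] g)" "Src C ?S\<alpha> = ?R'"
        using strs2_simps[OF \<alpha>(1), of ?j "Ws @ W # Ws'" Y] \<alpha> bQ' by (simp_all add: strs_append)
      then show "?l < length (Dom C (Src C ?S\<alpha>))" "Dom C (Src C ?S\<alpha>) ! ?l = TO T W"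
        using R by simp_all
    qed
    have T: "?T \<in> Cell C" "Src C ?T = strs ?j (Ws @ W # Ws') Y (?A \<odot>[?j] g)"
      using t_unit_mults_simps[OF A(1) J_arrow(1)] by simp_all
    have e: "(?T \<star>[?l] \<iota> ?E) \<cdot> (?S\<alpha> \<star>[?l] \<iota> ?E) = (?T \<cdot> ?S\<alpha>) \<star>[?l] (\<iota> ?E \<cdot> \<iota> ?E)"
      by (rule J.C.interchange) (simp_all only: S\<alpha> T E R)
    have \<alpha>h: "?\<alpha>h \<in> Cell C" "Src C ?\<alpha>h = ?Q' \<odot>[?l] h" 
      using J.C.pcomp2_simps[OF \<alpha>(1), of "\<iota> h" ?l] \<alpha> J_arrow(2) bQ' by simp_all
    have S\<alpha>h: "?S ?\<alpha>h \<in> Cell C" "Src C (?S ?\<alpha>h) = strs ?j (Ws @ Vs @ Ws') Y (?Q' \<odot>[?l] h)"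
      using strs2_simps(1,2)[OF \<alpha>h(1), of ?j "Ws @ Vs @ Ws'" Y] bn(1) unfolding \<alpha>h by simp_all
    have "J.C.csquare (?T' \<cdot> ?S ?\<alpha>h) (\<iota> ?B \<star>[?j] ?d) ?c (?v \<star>[?l] \<iota> ?E)"
      using J.C.csquare_hpaste[OF J.C.csquare_transpose[OF s1] s2] unfolding e E(7) comp_cell_pre_def .
    then have "J.C.csquare ((?T' \<cdot> ?S ?\<alpha>h) \<cdot> ?S ?n) (\<iota> ?B \<star>[?j] ?d) (?c \<cdot> ?S ?n) (?v \<star>[?l] \<iota> ?E)"
      by (rule J.C.csquare_precomp) (simp_all only: Sn c)
    also have "(?T' \<cdot> ?S ?\<alpha>h) \<cdot> ?S ?n = ?T' \<cdot> (?S ?\<alpha>h \<cdot> ?S ?n)"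
      by (rule J.C.Vcomp_assoc') (use s1 s2 in \<open>simp_all add: Sn S\<alpha>h J.C.csquare_def\<close>)
    also have "?S ?\<alpha>h \<cdot> ?S ?n = ?S (?\<alpha>h \<cdot> ?n)"
      by (rule strs2_Vcomp[symmetric]) (simp_all only: n \<alpha>h bn(2)[unfolded n])
    also have "?\<alpha>h \<cdot> ?n = strs_nat p Xs Y P ?j (g \<odot>[?k] h)"
      using strs_nat_comp[of p Xs Y P ?j g ?k h] A J_arrow by (simp add: nth_append)
    finally show ?thesis
      unfolding comp_cell_pre_def .
  qed
  have q2: "J.C.csquare (?S2 (comp_cell_pre p Xs X Y P (Ws @ Vs @ Ws') (g \<odot>[?k] h))) (?S2 (\<iota> ?B \<star>[?j] ?d))
      (?S2 (?c \<cdot> ?S ?n)) (?S2 (?v \<star>[?l] \<iota> ?E))"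
  proof (rule csquare_strs2[OF q1])
    have "Src C (comp_cell_pre p Xs X Y P (Ws @ Vs @ Ws') (g \<odot>[?k] h)) = Src C (?c \<cdot> ?S ?n)"
      using q1 by (simp add: J.C.csquare_def)
    also have "\<dots> = Src C (?S ?n)"
      by (rule J.C.Vcomp_simps) (simp_all only: Sn c)
    finally show "block (?l + length Vs + length Ws') Xs' Y (Src C (comp_cell_pre p Xs X Y P (Ws @ Vs @ Ws') (g \<odot>[?k] h)))"
      using bn(3) by simp
  qed
  \<comment> \<open>This square and \<open>q4\<close> are naturality of the late constraints, in the
    inner cell \<open>?d\<close> and in \<open>?v\<close>. Each is stated for an arbitrary cell
    first, since only the boundary matters.\<close>
  have q3: "J.C.csquare (strs_nat (Suc ?j) Xs' Y ?B ?j (lift1 (Ws @ Vs @ Ws') X (g \<odot>[?k] h))) (\<iota> ?TB \<star>[?j] ?d)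
     (?S2 (\<iota> ?B \<star>[?j] ?d)) (strs_nat (Suc ?j) Xs' Y ?B ?j (?Tg \<odot>[?k] ?E))"
  proof -
    have "J.C.csquare (strs_nat (Suc ?j) Xs' Y ?B ?j (lift1 (Ws @ Vs @ Ws') X (g \<odot>[?k] h))) (\<iota> ?TB \<star>[?j] \<delta>)
       (?S2 (\<iota> ?B \<star>[?j] \<delta>)) (strs_nat (Suc ?j) Xs' Y ?B ?j (?Tg \<odot>[?k] ?E))"
      if "\<delta> \<in> Cell C" "Src C \<delta> = lift1 (Ws @ Vs @ Ws') X (g \<odot>[?k] h)" "Tgt C \<delta> = ?Tg \<odot>[?k] ?E" for \<delta>
      using csquare_strs_nat[of "\<iota> ?B" \<delta> "Suc ?j" Xs' Y ?j] lift1_simps[OF J_arrow(3)]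
      by (simp add: ty that add.assoc)
    from this[OF d] show ?thesis .
  qed
  have q4: "J.C.csquare (strs_nat (Suc (?l + length Ws')) Xs' Y ?R' ?l ?E) (strs2 (Suc (?l + length Ws')) Xs' Y ?v \<star>[?l] \<iota> ?E)
     (?S2 (?v \<star>[?l] \<iota> ?E)) (strs_nat (Suc (?l + length Ws')) Xs' Y (?B \<odot>[?j] ?Tg) ?l ?E)"
  proof -
    have "J.C.csquare (strs_nat (Suc (?l + length Ws')) Xs' Y (Src C \<delta>) ?l (Src C (\<iota> ?E)))
      (strs2 (Suc (?l + length Ws')) Xs' Y \<delta> \<star>[?l] \<iota> ?E)
      (strs2 (shift ?l (length (Dom C (Src C (\<iota> ?E)))) (Suc (?l + length Ws'))) Xs' Y (\<delta> \<star>[?l] \<iota> ?E))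
      (strs_nat (Suc (?l + length Ws')) Xs' Y (Tgt C \<delta>) ?l (Tgt C (\<iota> ?E)))"
      if "\<delta> \<in> Cell C" "Src C \<delta> = ?R'" for \<delta>
      by (rule csquare_strs_nat; (unfold that E)?; (rule that E R)?) (simp add: R)+
    from this[OF v(1,2)] show ?thesis
      unfolding E v shift_Suc_add length_map .
  qed
  have b: "block (Suc ?j) Xs' Y ?B" "outside (Suc ?j) (length Xs') ?j" "?j < length (Dom C ?B)"
    "Cod C ?Tg = Dom C ?B ! ?j" "?k < length (Dom C ?Tg)" "Cod C ?E = Dom C ?Tg ! ?k"
    using A Tg E by simp_all
  \<comment> \<open>Composition with \<open>g\<close> puts its \<open>Suc (?k + length Ws')\<close>
    arguments in place of argument \<open>?j\<close>, so the late run starts here.\<close>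
  have pos: "?j + Suc (?k + length Ws') = Suc (?l + length Ws')"
    by simp
  have comp: "strs_nat (Suc ?j) Xs' Y ?B ?j (?Tg \<odot>[?k] ?E) = (strs_nat (Suc ?j) Xs' Y ?B ?j ?Tg \<star>[?l] \<iota> ?E) \<cdot>
     strs_nat (Suc (?l + length Ws')) Xs' Y (?B \<odot>[?j] ?Tg) ?l ?E"
    using strs_nat_comp[OF b(1-3) Tg(1) b(4,5) E(4) b(6)] unfolding Tg(4) shift_Suc_self pos .
  have snT: "strs_nat (Suc ?j) Xs' Y ?B ?j ?Tg \<in> Cell C"
    "Src C (strs_nat (Suc ?j) Xs' Y ?B ?j ?Tg) = strs (Suc (?l + length Ws')) Xs' Y (?B \<odot>[?j] ?Tg)"
    "Tgt C (strs_nat (Suc ?j) Xs' Y ?B ?j ?Tg) = ?TB \<odot>[?j] ?Tg"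
    using strs_nat_simps[OF b(1-3) Tg(1) b(4)] unfolding Tg(4) shift_Suc_self pos by simp_all
  have BT: "?l < length (Dom C (?B \<odot>[?j] ?Tg))" "Dom C (?B \<odot>[?j] ?Tg) ! ?l = TO T W"
    "block (Suc (?l + length Ws')) Xs' Y (?B \<odot>[?j] ?Tg)"
  proof -
    have B: "?B \<in> Mor C" using A(1) by simp
    show "?l < length (Dom C (?B \<odot>[?j] ?Tg))"
      unfolding J.C.length_Dom_pcomp1[OF B Tg(1) b(3,4)] using b(3,5) by linarith
    show "Dom C (?B \<odot>[?j] ?Tg) ! ?l = TO T W"
      using J.C.nth_Dom_pcomp1(2)[OF B Tg(1) b(3,4,5)] unfolding Tg(3) .
    show "block (Suc (?l + length Ws')) Xs' Y (?B \<odot>[?j] ?Tg)"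
      using block_pcomp_after[OF b(1,3) Tg(1) b(4) refl] unfolding Tg(4) pos .
  qed
  have snE: "(strs_nat (Suc ?j) Xs' Y ?B ?j ?Tg \<star>[?l] \<iota> ?E) \<in> Cell C"
    "Src C (strs_nat (Suc ?j) Xs' Y ?B ?j ?Tg \<star>[?l] \<iota> ?E) = strs (Suc (?l + length Ws')) Xs' Y (?B \<odot>[?j] ?Tg) \<odot>[?l] ?E"
    using J.C.pcomp2_simps(1,2)[OF snT(1) E(3), of ?l] length_Dom_strs[OF BT(3)]
      nth_Dom_strs_out[OF BT(3), of ?l] BT(1,2) unfolding snT E by simp_all
  have "(\<iota> ?TB \<star>[?j] ?d) \<cdot> comp_cell p Xs X Xs' Y P (Ws @ Vs @ Ws') (g \<odot>[?k] h) =
      (strs_nat (Suc ?j) Xs' Y ?B ?j (?Tg \<odot>[?k] ?E) \<cdot> ?S2 (?v \<star>[?l] \<iota> ?E)) \<cdot> ?S2 (?c \<cdot> ?S ?n)"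
  proof -
    have "?j + length (Ws @ Vs @ Ws') = ?l + length Vs + length Ws'"
      by simp
    then show ?thesis
      unfolding comp_cell_def[of p] by (simp only: J.C.csquare_eq[OF J.C.csquare_hpaste[OF q2 q3]])
  qed
  also have "\<dots> = strs_nat (Suc ?j) Xs' Y ?B ?j (?Tg \<odot>[?k] ?E) \<cdot> (?S2 (?v \<star>[?l] \<iota> ?E) \<cdot> ?S2 (?c \<cdot> ?S ?n))"
    by (rule J.C.Vcomp_assoc') (use q2 q3 in \<open>simp_all add: J.C.csquare_def\<close>)
  \<comment> \<open>The late constraint past the composite has a factor past \<open>?E\<close> that
    comes before the one past \<open>?Tg\<close>. Exchanging it with the strengthened
    \<open>?v\<close> collects all factors of the cell for \<open>g\<close> on the left and all
    factors of the cell for \<open>h\<close> on the right.\<close>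
  also have "\<dots> = ((strs_nat (Suc ?j) Xs' Y ?B ?j ?Tg \<star>[?l] \<iota> ?E) \<cdot> (strs2 (Suc (?l + length Ws')) Xs' Y ?v \<star>[?l] \<iota> ?E)) \<cdot>
      (strs_nat (Suc (?l + length Ws')) Xs' Y ?R' ?l ?E \<cdot> ?S2 (?c \<cdot> ?S ?n))"
    unfolding comp
  proof (rule J.C.csquare_middle[OF J.C.csquare_transpose[OF q4]])
    show "strs_nat (Suc ?j) Xs' Y ?B ?j ?Tg \<star>[?l] \<iota> ?E \<in> Cell C" by (rule snE)
    show "?S2 (?c \<cdot> ?S ?n) \<in> Cell C" "Tgt C (?S2 (?c \<cdot> ?S ?n)) = Src C (?S2 (?v \<star>[?l] \<iota> ?E))"
      using q2 by (simp_all add: J.C.csquare_def)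
    show "Src C (strs_nat (Suc ?j) Xs' Y ?B ?j ?Tg \<star>[?l] \<iota> ?E) =
        Tgt C (strs_nat (Suc (?l + length Ws')) Xs' Y (?B \<odot>[?j] ?Tg) ?l ?E)"
      unfolding snE using strs_nat_simps(3)[OF BT(3) _ BT(1) E(4)] BT E(5) by simp
  qed
  also have "(strs_nat (Suc ?j) Xs' Y ?B ?j ?Tg \<star>[?l] \<iota> ?E) \<cdot> (strs2 (Suc (?l + length Ws')) Xs' Y ?v \<star>[?l] \<iota> ?E) =
      comp_cell p Xs X Xs' Y P (Ws @ W # Ws') g \<star>[?l] \<iota> ?E"
  proof -
    have "(strs_nat (Suc ?j) Xs' Y ?B ?j ?Tg \<star>[?l] \<iota> ?E) \<cdot> (strs2 (Suc (?l + length Ws')) Xs' Y ?v \<star>[?l] \<iota> ?E) =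
      (strs_nat (Suc ?j) Xs' Y ?B ?j ?Tg \<cdot> strs2 (Suc (?l + length Ws')) Xs' Y ?v) \<star>[?l] (\<iota> ?E \<cdot> \<iota> ?E)"
    proof (rule J.C.interchange)
      have b: "block (Suc (?l + length Ws')) Xs' Y (Src C ?v)"
        unfolding v by (rule R)
      note Sv = strs2_simps[OF v(1) b, unfolded v]
      show "strs2 (Suc (?l + length Ws')) Xs' Y ?v \<in> Cell C"
        "Src C (strs_nat (Suc ?j) Xs' Y ?B ?j ?Tg) = Tgt C (strs2 (Suc (?l + length Ws')) Xs' Y ?v)"
        by (simp_all only: Sv snT)
      show "?l < length (Dom C (Src C (strs2 (Suc (?l + length Ws')) Xs' Y ?v)))"
        "Cod C (Src C (\<iota> ?E)) = Dom C (Src C (strs2 (Suc (?l + length Ws')) Xs' Y ?v)) ! ?l"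
        unfolding Sv E using length_Dom_strs[OF R(1)] nth_Dom_strs_out[OF R(1), of ?l] R(2,3) by simp_all
    qed (simp_all only: snT E)
    then show ?thesis
      unfolding E comp_cell_def by (simp add: add.assoc)
  qed
  also have "strs_nat (Suc (?l + length Ws')) Xs' Y ?R' ?l ?E \<cdot> ?S2 (?c \<cdot> ?S ?n) = comp_cell p (Xs @ Ws) W (Ws' @ Xs') Y ?Q Vs h"
    by (subst comp_cell_append) (use pQ bQ bQ3 J_arrow(2) in \<open>simp_all add: strs2_append\<close>)
  finally show ?thesis
    by (simp add: strs_append)
qed

section \<open>The induced pseudo-multifunctor\<close>

lemma comp_cell_total:
  assumes "block 0 (Xs @ X # Xs') Y P" "J_arrow Ws X g" "j = length Xs"
  shows "J.C.invertible (comp_cell 0 Xs X Xs' Y P Ws g)"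
    "Src C (comp_cell 0 Xs X Xs' Y P Ws g) = strs 0 (Xs @ Ws @ Xs') Y (P \<odot>[j] g)"
    "Tgt C (comp_cell 0 Xs X Xs' Y P Ws g) = strs 0 (Xs @ X # Xs') Y P \<odot>[j] lift1 Ws X g"
  using comp_cell_simps[of 0 Xs Y P X Xs' Ws g] assms by (simp_all add: strs_append)

lemma lift2_Vcomp:
  assumes "\<alpha> \<in> Cell C" "\<beta> \<in> Cell C" "Src C \<beta> = Tgt C \<alpha>" "J_arrow Ws X (Src C \<alpha>)"
  shows "lift2 Ws X (\<beta> \<cdot> \<alpha>) = lift2 Ws X \<beta> \<cdot> lift2 Ws X \<alpha>"
proof -
  have "\<iota> (unit T X) \<star>[0] (\<beta> \<cdot> \<alpha>) = (\<iota> (unit T X) \<star>[0] \<beta>) \<cdot> (\<iota> (unit T X) \<star>[0] \<alpha>)"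
    using assms by (simp add: J.C.interchange)
  then show ?thesis
    unfolding lift2_def using assms by (simp add: strs2_Vcomp)
qed

text \<open>The prefix \<open>Us\<close> lets the index range start anywhere: the induction
  transfers one object at a time from \<open>Xs\<close> to \<open>Us\<close>, which leaves the
  indexed list unchanged.\<close>

lemma fold_str1:
  "fold (\<lambda>j. str1 T j ((Us @ Xs) ! j) Y) [length Us..<length Us + length Xs] f = strs (length Us) Xs Y f"
proof (induction Xs arbitrary: Us f)
  case (Cons X Xs)
  show ?case
    using Cons.IH[of "Us @ [X]" "str1 T (length Us) X Y f"]
    by (simp add: upt_conv_Cons nth_append del: upt_Suc)
qed simp

lemma fold_str2:
  "fold (\<lambda>j. str2 T j ((Us @ Xs) ! j) Y) [length Us..<length Us + length Xs] \<alpha> = strs2 (length Us) Xs Y \<alpha>"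
proof (induction Xs arbitrary: Us \<alpha>)
  case (Cons X Xs)
  show ?case
    using Cons.IH[of "Us @ [X]" "str2 T (length Us) X Y \<alpha>"]
    by (simp add: upt_conv_Cons nth_append del: upt_Suc)
qed simp

lemma induced_pseudo_multifunctor:
  assumes "multi_2functor D C J"
  shows "\<exists>Tc. pseudo_multifunctor D C (induced_functor D C J T) (\<theta> T) Tc"
proof -
  interpret M: pseudo_multifunctor D C J "(\<lambda>X. Id2 C (Id1 C (FO J X)))"
       "(\<lambda>f j g. Id2 C (pcomp1 C (FM J f) j (FM J g)))"
    using assms unfolding multi_2functor_def .
  let ?F = "induced_functor D C J T"
  let ?P = "\<lambda>f. pcomp1 C (unit T (Cod D f)) 0 (FM J f)"
  define Tc where "Tc f j g = comp_cell 0 (take j (Dom D f)) (Dom D f ! j) (drop (Suc j) (Dom D f)) (Cod D f)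
    (?P f) (Dom D g) (FM J g)" for f j g
  have Tc: "Tc f (length Xs) g = comp_cell 0 Xs X Xs' (Cod D f) (?P f) (Dom D g) (FM J g)"
    if "Dom D f = Xs @ X # Xs'" for f g Xs X Xs'
    using that by (simp add: Tc_def)
  have J_J_arrow: "J_arrow (Dom D f) (Cod D f) (FM J f)" if "f \<in> Mor D" for f
    using M.FM_hom[of f "Dom D f" "Cod D f"] that J.D.Dom_Obj[OF that] J.D.Cod_Obj[OF that]
    by (auto simp: hom_def)
  have J_Id1: "FM J (Id1 D X) = Id1 C (FO J X)" if "X \<in> Obj D" for X
    by (rule J.FM_Id1[OF that])
  \<comment> \<open>The structure cell is the identity on \<open>J f \<circ>\<^sub>j J g\<close>,
    yet its type says that it starts at \<open>J (f \<circ>\<^sub>j g)\<close>; so the two arrows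
    are equal.\<close>
  have J_pcomp1: "FM J (pcomp1 D f j g) = pcomp1 C (FM J f) j (FM J g)"
    if "f \<in> Mor D" "g \<in> Mor D" "j < length (Dom D f)" "Cod D g = Dom D f ! j" for f j g
    using M.Fc_cells[OF that] J_J_arrow[OF that(1)] J_J_arrow[OF that(2)] that(3,4)
    by (simp add: J.C.inv_cells_iff)
  have J_cell: "FC J \<alpha> \<in> Cell C" "Src C (FC J \<alpha>) = FM J (Src D \<alpha>)" "Tgt C (FC J \<alpha>) = FM J (Tgt D \<alpha>)"
    if "\<alpha> \<in> Cell D" for \<alpha>
    using M.FC_cells[of \<alpha> "Src D \<alpha>" "Tgt D \<alpha>"] that by (auto simp: cells_def)
  \<comment> \<open>With identity structure cells the naturality square has two trivial edges and
    becomes this equation.\<close>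
  have J_pcomp2: "FC J (pcomp2 D \<alpha> j \<beta>) = pcomp2 C (FC J \<alpha>) j (FC J \<beta>)"
    if "\<alpha> \<in> Cell D" "\<beta> \<in> Cell D" "j < length (Dom D (Src D \<alpha>))"
      "Cod D (Src D \<beta>) = Dom D (Src D \<alpha>) ! j" for \<alpha> j \<beta>
    using M.Fc_natural[of \<alpha> "Src D \<alpha>" "Tgt D \<alpha>" \<beta> "Src D \<beta>" "Tgt D \<beta>" j] that J_cell[OF that(1)]
      J_cell[OF that(2)] J_J_arrow[of "Src D \<alpha>"] J_J_arrow[of "Src D \<beta>"] J_cell[of "pcomp2 D \<alpha> j \<beta>"]
    by (simp add: cells_def J_pcomp1)
  have F_FO: "FO ?F X = TO T X" for X
    by (simp add: induced_functor_def)
  have F_FM: "FM ?F f = lift1 (Dom D f) (Cod D f) (FM J f)" if "f \<in> Mor D" for f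
    using fold_str1[of "[]" "Dom D f" "Cod D f"] that J.D.Cod_Obj[OF that]
    by (simp add: induced_functor_def lift1_def pcomp1_def)
  have F_FC: "FC ?F \<alpha> = lift2 (Dom D (Src D \<alpha>)) (Cod D (Src D \<alpha>)) (FC J \<alpha>)" if "\<alpha> \<in> Cell D" for \<alpha>
    using fold_str2[of "[]" "Dom D (Src D \<alpha>)" "Cod D (Src D \<alpha>)"] J.D.Cod_Obj[of "Src D \<alpha>"] that
    by (simp add: induced_functor_def lift2_def pcomp2_def Let_def)
  have block_P: "block 0 (Dom D f) (Cod D f) (?P f)" if "f \<in> Mor D" for f
    by (rule block_unit_pcomp[OF J_J_arrow[OF that]])
  have Dom_pcomp1_split: "Dom D (pcomp1 D f (length Xs) g) = Xs @ Dom D g @ Xs'"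
    if "Dom D f = Xs @ Cod D g # Xs'" "f \<in> Mor D" "g \<in> Mor D" for f g Xs Xs'
    using that by (simp add: J.D.Dom_pcomp1)
  have P_pcomp: "pcomp1 C (unit T (Cod D f)) 0 (pcomp1 C (FM J f) j (FM J g)) = pcomp1 C (?P f) j (FM J g)"
    if "f \<in> Mor D" "g \<in> Mor D" "j < length (Dom D f)" "Cod D g = Dom D f ! j" for f g j
    using J.C.pcomp1_assoc[of "unit T (Cod D f)" "FM J f" "FM J g" 0 j] J_J_arrow[OF that(1)] J_J_arrow[OF that(2)]
      that(3,4) by simp
  have "pseudo_multifunctor D C ?F (\<theta> T) Tc"
  proof (intro pseudo_multifunctor.intro pseudo_multifunctor_axioms.intro)
    show "two_multicategory D" by (rule J.D.two_multicategory_axioms)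
    show "two_multicategory C" by (rule J.C.two_multicategory_axioms)
    show "FO ?F X \<in> Obj C" if "X \<in> Obj D" for X
      using that by (simp add: F_FO TO_Obj)
    show "FM ?F f \<in> hom C (map (FO ?F) Xs) (FO ?F Y)" if "f \<in> hom D Xs Y" for f Xs Y
      using that lift1_simps[OF J_J_arrow[of f]] by (simp add: hom_def F_FO[abs_def] F_FM)
    show "FC ?F \<alpha> \<in> cells C (FM ?F f) (FM ?F f')" if "\<alpha> \<in> cells D f f'" for \<alpha> f f'
    proof -
      have t: "\<alpha> \<in> Cell D" "Src D \<alpha> = f" "Tgt D \<alpha> = f'" "f \<in> Mor D" "f' \<in> Mor D"
        "Dom D f' = Dom D f" "Cod D f' = Cod D f"
        using that J.D.cell_simps[of \<alpha>] by (auto simp: cells_def)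
      show ?thesis
        using lift2_simps[OF J_cell(1)[OF t(1)], of "Dom D f" "Cod D f"] J_J_arrow[OF t(4)] t J_cell[OF t(1)]
        by (simp add: cells_def F_FC F_FM)
    qed
    show "FC ?F (Id2 D f) = Id2 C (FM ?F f)" if "f \<in> Mor D" for f
      using that J_J_arrow[OF that] M.FC_Id2[OF that] by (simp add: F_FC F_FM)
    show "FC ?F (Vcomp D \<beta> \<alpha>) = Vcomp C (FC ?F \<beta>) (FC ?F \<alpha>)"
      if a: "\<alpha> \<in> cells D f f'" and b: "\<beta> \<in> cells D f' f''" for \<alpha> \<beta> f f' f''
    proof -
      have t: "\<alpha> \<in> Cell D" "Src D \<alpha> = f" "Tgt D \<alpha> = f'" "f \<in> Mor D" "\<beta> \<in> Cell D" "Src D \<beta> = f'"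
        "Dom D f' = Dom D f" "Cod D f' = Cod D f"
        using a b J.D.cell_simps[of \<alpha>] by (auto simp: cells_def)
      show ?thesis
        using lift2_Vcomp[OF J_cell(1)[OF t(1)] J_cell(1)[OF t(5)], of "Dom D f" "Cod D f"]
          J_J_arrow[OF t(4)] t J_cell[OF t(1)] J_cell[OF t(5)] M.FC_Vcomp[OF a b]
        by (simp add: F_FC)
    qed
    show "\<theta> T X \<in> inv_cells C (FM ?F (Id1 D X)) (Id1 C (FO ?F X))" if "X \<in> Obj D" for X
      using that J.FO_Obj[OF that] by (simp add: J.C.inv_cells_iff F_FO F_FM lift1_def J_Id1)
    show "Tc f j g \<in> inv_cells C (FM ?F (pcomp1 D f j g)) (pcomp1 C (FM ?F f) j (FM ?F g))"
      if fg: "f \<in> Mor D" "g \<in> Mor D" "j < length (Dom D f)" "Cod D g = Dom D f ! j" for f g j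
    proof -
      obtain Xs Xs' where f: "Dom D f = Xs @ Cod D g # Xs'" and j: "j = length Xs"
        using split_nth[OF fg(3)] fg(4) by metis
      have Ff: "FM ?F f = strs 0 (Xs @ Cod D g # Xs') (Cod D f) (?P f)"
        using fg(1) by (simp add: F_FM lift1_def f)
      have Fg: "FM ?F g = lift1 (Dom D g) (Cod D g) (FM J g)"
        by (rule F_FM[OF fg(2)])
      have fj: "pcomp1 D f (length Xs) g \<in> Mor D" "Cod D (pcomp1 D f (length Xs) g) = Cod D f"
        using J.D.pcomp1_simps[OF fg] unfolding j by simp_all
      have Ffg: "FM ?F (pcomp1 D f (length Xs) g) =
          strs 0 (Xs @ Dom D g @ Xs') (Cod D f) (pcomp1 C (?P f) (length Xs) (FM J g))"
        unfolding F_FM[OF fj(1)] fj(2) Dom_pcomp1_split[OF f fg(1,2)] J_pcomp1[OF fg, unfolded j]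
          lift1_def P_pcomp[OF fg, unfolded j] ..
      show ?thesis
        unfolding j Tc[OF f] J.C.inv_cells_iff Ff Fg Ffg
        using comp_cell_total[OF block_P[OF fg(1), unfolded f] J_J_arrow[OF fg(2)] refl] by (intro conjI)
    qed
    show "pcomp2 C (FC ?F \<alpha>) j (FC ?F \<beta>) \<cdot> Tc f j g = Tc f' j g' \<cdot> FC ?F (pcomp2 D \<alpha> j \<beta>)"
      if a: "\<alpha> \<in> cells D f f'" and b: "\<beta> \<in> cells D g g'" and
        c: "j < length (Dom D f)" "Cod D g = Dom D f ! j" for \<alpha> f f' \<beta> g g' j
    proof -
      have t: "\<alpha> \<in> Cell D" "Src D \<alpha> = f" "Tgt D \<alpha> = f'" "f \<in> Mor D" "f' \<in> Mor D" "Dom D f' = Dom D f"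
        "Cod D f' = Cod D f" "\<beta> \<in> Cell D" "Src D \<beta> = g" "Tgt D \<beta> = g'" "g \<in> Mor D" "Dom D g' = Dom D g"
        "Cod D g' = Cod D g"
        using a b J.D.cell_simps[of \<alpha>] J.D.cell_simps[of \<beta>] by (auto simp: cells_def)
      obtain Xs Xs' where f: "Dom D f = Xs @ Cod D g # Xs'" and j: "j = length Xs"
        using split_nth[OF c(1)] c(2) by metis
      have f': "Dom D f' = Xs @ Cod D g # Xs'" using f t by simp
      let ?u = "unit T (Cod D f)"
      let ?\<alpha> = "\<iota> ?u \<star>[0] FC J \<alpha>"
      have \<alpha>: "?\<alpha> \<in> Cell C" "Src C ?\<alpha> = ?P f" "Tgt C ?\<alpha> = ?P f'"
        using J_cell[OF t(1)] t J_J_arrow[OF t(4)] by simp_all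
      have \<beta>: "FC J \<beta> \<in> Cell C" "Src C (FC J \<beta>) = FM J g" "Tgt C (FC J \<beta>) = FM J g'"
        using J_cell[OF t(8)] t by simp_all
      have F\<alpha>: "FC ?F \<alpha> = strs2 0 (Xs @ Cod D g # Xs') (Cod D f) ?\<alpha>"
        using t by (simp add: F_FC lift2_def f)
      have F\<beta>: "FC ?F \<beta> = lift2 (Dom D g) (Cod D g) (FC J \<beta>)"
        using t by (simp add: F_FC)
      have gd: "Dom D (pcomp1 D f (length Xs) g) = Xs @ Dom D g @ Xs'"
        by (rule Dom_pcomp1_split[OF f t(4,11)])
      have F\<alpha>\<beta>: "FC ?F (pcomp2 D \<alpha> (length Xs) \<beta>) =
          strs2 0 (Xs @ Dom D g @ Xs') (Cod D f) (?\<alpha> \<star>[length Xs] FC J \<beta>)"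
      proof -
        have "?\<alpha> \<star>[length Xs] FC J \<beta> = \<iota> ?u \<star>[0] (FC J \<alpha> \<star>[length Xs] FC J \<beta>)"
          using J.C.pcomp2_assoc[of "\<iota> ?u" "FC J \<alpha>" "FC J \<beta>" 0 "length Xs"] J_cell[OF t(1)] \<beta> t
            J_J_arrow[OF t(4)] J_J_arrow[OF t(11)] f by (simp add: nth_append)
        then show ?thesis
          using t gd f by (simp add: F_FC J_pcomp2 lift2_def)
      qed
      have B: "block 0 (Xs @ Cod D g # Xs') (Cod D f) (Src C ?\<alpha>)"
        unfolding \<alpha> by (rule block_P[OF t(4), unfolded f])
      have "J.C.csquare (comp_cell 0 Xs (Cod D g) Xs' (Cod D f) (?P f) (Dom D g) (FM J g))
          (FC ?F \<alpha> \<star>[length Xs] FC ?F \<beta>) (FC ?F (pcomp2 D \<alpha> (length Xs) \<beta>))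
          (comp_cell 0 Xs (Cod D g) Xs' (Cod D f) (?P f') (Dom D g) (FM J g'))"
        unfolding F\<alpha> F\<beta> F\<alpha>\<beta>
        using csquare_comp_cell[OF \<alpha>(1) \<beta>(1), of 0 Xs "Cod D f" "Cod D g" Xs' "Dom D g", unfolded \<alpha> \<beta>]
          B[unfolded \<alpha>] J_J_arrow[OF t(11)] by (simp add: strs2_append)
      from J.C.csquare_eq[OF this] show ?thesis
        unfolding j Tc[OF f] Tc[OF f'] t(7,12) .
    qed
    show "pcomp2 C (\<theta> T Y) 0 (Id2 C (FM ?F f)) \<cdot> Tc (Id1 D Y) 0 f = Id2 C (FM ?F f)"
      if "f \<in> hom D Xs Y" for f Xs Y
    proof -
      have f: "f \<in> Mor D" "Dom D f = Xs" "Cod D f = Y" "Y \<in> Obj D"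
        using that J.D.Cod_Obj[of f] by (auto simp: hom_def)
      have "Tc (Id1 D Y) 0 f = comp_cell 0 [] Y [] Y (unit T Y) Xs (FM J f)"
        using Tc[of "Id1 D Y" "[]" Y "[]" f] f J.FO_Obj[OF f(4)] by (simp add: J_Id1)
      then show ?thesis
        using comp_cell_unit_left[OF J_J_arrow[OF f(1)]] f by (simp add: F_FM)
    qed
    show "pcomp2 C (Id2 C (FM ?F f)) j (\<theta> T (Xs ! j)) \<cdot> Tc f j (Id1 D (Xs ! j)) = Id2 C (FM ?F f)"
      if fX: "f \<in> hom D Xs Y" and jX: "j < length Xs" for f Xs Y j
    proof -
      have f: "f \<in> Mor D" "Dom D f = Xs" "Cod D f = Y" "Xs ! j \<in> Obj D"
        using fX jX J.D.Dom_Obj[of f] by (auto simp: hom_def)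
      obtain Us Vs where UV: "Xs = Us @ Xs ! j # Vs" "length Us = j"
        using split_nth[OF jX] by blast
      define X where "X = Xs ! j"
      have X: "Xs = Us @ X # Vs" "X = Xs ! j" and j: "j = length Us"
        unfolding X_def by (rule UV, rule refl, rule UV(2)[symmetric])
      have Xj: "Xs ! length Us = X" unfolding X_def UV(2) ..
      have D: "Dom D f = Us @ X # Vs" using f(2) X(1) by (rule trans)
      have O: "X \<in> Obj D" unfolding X(2) by (rule f(4))
      have "Tc f j (Id1 D X) = comp_cell 0 Us X Vs Y (?P f) [X] (\<one> (FO J X))"
        unfolding j Tc[OF D] using O f(3) by (simp add: J_Id1)
      moreover have "FM ?F f = strs 0 (Us @ X # Vs) Y (?P f)"
        using f(1,3) D by (simp add: F_FM lift1_def)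
      ultimately show ?thesis
        using comp_cell_unit_right[OF block_P[OF f(1), unfolded D], unfolded add_0] f(3)
        unfolding j Xj by (simp only:)
    qed
    show "pcomp2 C (Id2 C (FM ?F f)) j (Tc g k h) \<cdot> Tc f j (pcomp1 D g k h) =
       pcomp2 C (Tc f j g) (j + k) (Id2 C (FM ?F h)) \<cdot> Tc (pcomp1 D f j g) (j + k) h"
      if fgh: "f \<in> Mor D" "g \<in> Mor D" "h \<in> Mor D" "j < length (Dom D f)" "Cod D g = Dom D f ! j"
        "k < length (Dom D g)" "Cod D h = Dom D g ! k" for f g h j k
    proof -
      obtain Xs Xs' where f: "Dom D f = Xs @ Cod D g # Xs'" and j: "j = length Xs"
        using split_nth[OF fgh(4)] fgh(5) by metis
      obtain Ws Ws' where g: "Dom D g = Ws @ Cod D h # Ws'" and k: "k = length Ws"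
        using split_nth[OF fgh(6)] fgh(7) by metis
      have gh: "Dom D (pcomp1 D g k h) = Ws @ Dom D h @ Ws'" 
        unfolding k by (rule Dom_pcomp1_split[OF g fgh(2,3)])
      have "Dom D (pcomp1 D f j g) = Xs @ Dom D g @ Xs'"
        unfolding j by (rule Dom_pcomp1_split[OF f fgh(1,2)])
      then have fg: "Dom D (pcomp1 D f j g) = (Xs @ Ws) @ Cod D h # (Ws' @ Xs')"
        using g by simp
      have jk: "j + k = length (Xs @ Ws)" using j k by simp
      have "Tc f j (pcomp1 D g k h) = comp_cell 0 Xs (Cod D g) Xs' (Cod D f) (?P f) (Ws @ Dom D h @ Ws')
          (pcomp1 C (FM J g) (length Ws) (FM J h))"
        unfolding j Tc[OF f] gh using fgh k by (simp add: J_pcomp1)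
      moreover have "Tc (pcomp1 D f j g) (j + k) h = comp_cell 0 (Xs @ Ws) (Cod D h) (Ws' @ Xs') (Cod D f)
          (pcomp1 C (?P f) (length Xs) (FM J g)) (Dom D h) (FM J h)"
        unfolding jk Tc[OF fg] using fgh j by (simp add: J_pcomp1 P_pcomp)
      moreover have "Tc g k h = comp_cell 0 Ws (Cod D h) Ws' (Cod D g) (?P g) (Dom D h) (FM J h)"
        unfolding k Tc[OF g] ..
      moreover have "Tc f j g = comp_cell 0 Xs (Cod D g) Xs' (Cod D f) (?P f) (Ws @ Cod D h # Ws') (FM J g)"
        unfolding j Tc[OF f] unfolding g ..
      moreover have "FM ?F f = strs 0 (Xs @ Cod D g # Xs') (Cod D f) (?P f)"
        using fgh(1) by (simp add: F_FM lift1_def f)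
      moreover have "FM ?F h = lift1 (Dom D h) (Cod D h) (FM J h)"
        by (rule F_FM[OF fgh(3)])
      ultimately show ?thesis
        using comp_cell_assoc[OF block_P[OF fgh(1), unfolded f] J_J_arrow[OF fgh(2), unfolded g] J_J_arrow[OF fgh(3)], unfolded add_0]
        unfolding j k by (simp only:)
    qed
  qed
  then show ?thesis by blast
qed

end

theorem proposition3p9:
  fixes D :: "('x, 'n, 'd, 'y) two_multicat_scheme"
    and C :: "('o, 'm, 'c, 'z) two_multicat_scheme"
    and J :: "('x, 'n, 'd, 'o, 'm, 'c) functor_data"
    and T :: "('x, 'o, 'm, 'c) pseudomonad_data"
  assumes "two_multicategory D"
    and "two_multicategory C"
    and "multi_2functor D C J"
    and "strong_relative_pseudomonad D C J T"
  shows "\<exists>Tu Tc. pseudo_multifunctor D C (induced_functor D C J T) Tu Tc"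
proof -
  interpret strong_relative_pseudomonad D C J T by fact
  show ?thesis using induced_pseudo_multifunctor[OF assms(3)] by blast
qed

end
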